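(* There is an absolute constant $C$ such that for all integers $n\ge3$, $d\ge3$ and $r\ge4$ with $nd$ even, $$d_{TV}(\mathbf I_r(P),\mathbf Z)\le\frac{C\left(d+(\log n)^2\right)(d-1)^{2r-1}}{n}\quad\text{for }P\sim\mathcal P_{n,d},$$ and $$d_{TV}(\mathbf I_r(\tilde P),\tilde{\mathbf Z})\le\frac{C\left(d+(\log n)^2\right)(d-1)^{2r-1}}{n}\quad\text{for }\tilde P\sim\mathcal T_{n,d}.$$
   Context: Configuration model $\mathcal P_{n,d}$ ($nd$ even): $nd$ prevertices are partitioned into $n$ bins of size $d$, and $\mathcal P_{n,d}$ is the uniform law on perfect matchings ("pairings") of the $nd$ prevertices. The projection of a pairing is the $d$-regular pseudograph on $n$ vertices obtained by identifying all prevertices in each bin and keeping every pair as an edge. The law $\mathcal T_{n,d}$ on pairings of the $nd$ prevertices: take $\mathcal P_{n,d-2}$, add two new prevertices to each bin, sample (independently) a uniform perfect matching of the $2n$ new prevertices conditioned to project to a Hamiltonian cycle, and then reorder the $d$ prevertices in each bin uniformly at random, independently over bins. A cycle in a pairing is a collection of pairs projecting to a cycle in the pseudograph. $\mathcal J_k$ is the set of all possible cycles of length $k$ that could appear in a pairing (including $k=1$, loops, and $k=2$, double edges), so $|\mathcal J_k|=n(n-1)\cdots(n-k+1)(d(d-1))^k/(2k)$; $\mathcal J=\bigcup_{k=1}^r\mathcal J_k$. For $\alpha\in\mathcal J$, $I_\alpha(P)=\mathbf 1\{P\text{ contains }\alpha\}$, and $\mathbf I_r(P)=(I_\alpha(P),\alpha\in\mathcal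 J)$. For $\alpha\in\mathcal J_k$ set $\lambda_\alpha=\frac1{(nd)^k}$ and $\mu_\alpha=\frac1{(nd)^k}+\frac{(-1)^k-1}{(nd(d-1))^k}$. $\mathbf Z=(Z_\alpha)_{\alpha\in\mathcal J}$ has independent Poisson coordinates with $\mathbb EZ_\alpha=\lambda_\alpha$, and $\tilde{\mathbf Z}=(\tilde Z_\alpha)_{\alpha\in\mathcal J}$ has independent Poisson coordinates with $\mathbb E\tilde Z_\alpha=\mu_\alpha$ (a Poisson variable of mean $0$ being identically $0$). $d_{TV}$ is the total variation distance between the laws. *)

theory Defs
  imports "HOL-Probability.Probability"
begin

text \<open>The prevertex \<open>(i, j)\<close> is the \<open>j\<close>-th prevertex of bin \<open>i\<close>.\<close>

type_synonym prevertex = "nat \<times> nat"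
type_synonym pairing = "prevertex set set"

definition pairings_on :: "prevertex set \<Rightarrow> pairing set" where
  "pairings_on V = {P. partition_on V P \<and> (\<forall>e\<in>P. card e = 2)}"

definition pairings :: "nat \<Rightarrow> nat \<Rightarrow> pairing set" where
  "pairings n d = pairings_on ({..<n} \<times> {..<d})"

text \<open>
  A pseudograph on a vertex set that is clear from the context is given by its multiset of edges,
  an edge being its set of endpoints; so a loop at \<open>v\<close> is \<open>{v}\<close>.
\<close>

definition projection :: "pairing \<Rightarrow> nat set multiset" where
  "projection P = {# fst ` e. e \<in># mset_set P #}"

text \<open>
  The closed walk through \<open>vs\<close>. For a list of distinct vertices this is a loop if the length is 1
  and a double edge if the length is 2.
\<close>

definition cycle_edges :: "nat list \<Rightarrow> nat set multiset" where
  "cycle_edges vs = {# {vs ! i, vs ! (Suc i mod length vs)}. i \<in># mset_set {..<length vs} #}"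

definition is_cycle :: "nat \<Rightarrow> nat set multiset \<Rightarrow> bool" where
  "is_cycle k E \<longleftrightarrow> k \<ge> 1 \<and> (\<exists>vs. distinct vs \<and> length vs = k \<and> E = cycle_edges vs)"

definition is_hamiltonian_cycle :: "nat \<Rightarrow> nat set multiset \<Rightarrow> bool" where
  "is_hamiltonian_cycle n E \<longleftrightarrow> (\<exists>vs. distinct vs \<and> set vs = {..<n} \<and> E = cycle_edges vs)"


definition config_pmf :: "nat \<Rightarrow> nat \<Rightarrow> pairing pmf" where
  "config_pmf n d = pmf_of_set (pairings n d)"

text \<open>The two prevertices added to bin \<open>i\<close> are \<open>(i, d - 2)\<close> and \<open>(i, d - 1)\<close>.\<close>

definition hamiltonian_pmf :: "nat \<Rightarrow> nat \<Rightarrow> pairing pmf" where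
  "hamiltonian_pmf n d =
     cond_pmf (pmf_of_set (pairings_on ({..<n} \<times> {d - 2..<d})))
       {H. is_hamiltonian_cycle n (projection H)}"

definition reordering_pmf :: "nat \<Rightarrow> nat \<Rightarrow> (nat \<Rightarrow> nat \<Rightarrow> nat) pmf" where
  "reordering_pmf n d = Pi_pmf {..<n} id (\<lambda>_. pmf_of_set {\<pi>. \<pi> permutes {..<d}})"

definition reorder :: "(nat \<Rightarrow> nat \<Rightarrow> nat) \<Rightarrow> pairing \<Rightarrow> pairing" where
  "reorder \<sigma> P = (`) (\<lambda>(i, j). (i, \<sigma> i j)) ` P"

definition tilted_pmf :: "nat \<Rightarrow> nat \<Rightarrow> pairing pmf" where
  "tilted_pmf n d =
     do {
       P \<leftarrow> config_pmf n (d - 2);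
       H \<leftarrow> hamiltonian_pmf n d;
       \<sigma> \<leftarrow> reordering_pmf n d;
       return_pmf (reorder \<sigma> (P \<union> H))
     }"


definition cycles_of_length :: "nat \<Rightarrow> nat \<Rightarrow> nat \<Rightarrow> pairing set" where
  "cycles_of_length n d k =
     {\<alpha>. (\<exists>P \<in> pairings n d. \<alpha> \<subseteq> P) \<and> is_cycle k (projection \<alpha>)}"

definition cycles_upto :: "nat \<Rightarrow> nat \<Rightarrow> nat \<Rightarrow> pairing set" where
  "cycles_upto n d r = (\<Union>k\<in>{1..r}. cycles_of_length n d k)"

text \<open>
  Vectors indexed by the cycles of length at most \<open>r\<close> are functions that vanish at all other
  arguments.
\<close>

definition cycle_indicators :: "nat \<Rightarrow> nat \<Rightarrow> nat \<Rightarrow> pairing \<Rightarrow> pairing \<Rightarrow> nat" where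
  "cycle_indicators n d r P = (\<lambda>\<alpha>. if \<alpha> \<in> cycles_upto n d r then of_bool (\<alpha> \<subseteq> P) else 0)"

text \<open>In the two means below, \<open>card \<alpha>\<close> is the length of the cycle \<open>\<alpha>\<close>.\<close>

definition cycle_lambda :: "nat \<Rightarrow> nat \<Rightarrow> pairing \<Rightarrow> real" where
  "cycle_lambda n d \<alpha> = 1 / (real n * real d) ^ card \<alpha>"

definition cycle_mu :: "nat \<Rightarrow> nat \<Rightarrow> pairing \<Rightarrow> real" where
  "cycle_mu n d \<alpha> =
     1 / (real n * real d) ^ card \<alpha> +
     ((-1) ^ card \<alpha> - 1) / (real n * real d * (real d - 1)) ^ card \<alpha>"

text \<open>
  The library's \<^const>\<open>poisson_pmf\<close> is specified only for a positive mean. Mean 0 occurs: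
  \<^const>\<open>cycle_mu\<close> is 0 at loops when \<open>d = 3\<close>.
\<close>

definition poisson0_pmf :: "real \<Rightarrow> nat pmf" where
  "poisson0_pmf m = (if m = 0 then return_pmf 0 else poisson_pmf m)"

definition poisson_vector_pmf :: "pairing set \<Rightarrow> (pairing \<Rightarrow> real) \<Rightarrow> (pairing \<Rightarrow> nat) pmf" where
  "poisson_vector_pmf J m = Pi_pmf J 0 (\<lambda>\<alpha>. poisson0_pmf (m \<alpha>))"

definition tv_dist :: "'a pmf \<Rightarrow> 'a pmf \<Rightarrow> real" where
  "tv_dist p q = (SUP A. \<bar>measure_pmf.prob p A - measure_pmf.prob q A\<bar>)"

end

theory Submission
  imports Defs "HOL-Combinatorics.Permutations"
begin

text \<open>
  Replacing the indicators by Poisson variables one at a time, it suffices to know that each \<open>I\<^sub>\<alpha>\<close> is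
  nearly independent of any event depending on the other indicators. To see this, condition on the pairs
  of \<open>\<alpha>\<close> one after the other. In the uniform part, conditioning on a pair amounts to one random
  re-matching; in the Hamiltonian part, to the contraction of a vertex of the cycle. The coupled pairings
  contain the same short cycles other than \<open>\<alpha>\<close> unless one of them has a short walk joining two
  prescribed bins. Each step of a walk has at most \<open>d - 1\<close> continuations, and arriving in a prescribed
  bin costs \<open>1 / n\<close>, so this has probability of order \<open>(d - 1) ^ (r - 1) / n\<close>; summing over
  \<open>\<alpha>\<close> yields the other factor \<open>(d - 1) ^ r\<close>. Everything is done for a fixed choice of the prevertices
  carrying the Hamiltonian cycle, and averaged over the random reordering at the end.
\<close>

text \<open>The types, that is, the prevertices of each bin that carry the Hamiltonian cycle, are
  fixed because only then is the pairing a uniform matching joined with an independent Hamiltonian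
  one, a family closed under conditioning on a pair. Averaging is then not harmless: the types
  correlate distant indicators. This is undone by exchanging, between two independent samples, the
  types in the bins of \<alpha>; the mean of the approximate cycle probability is computed exactly.
  Contraction merges the remains of two bins into one block, so the blocks must be controlled along
  \<alpha>: a pair that is itself a block cannot occur, and the third prevertex that is affected has
  to lie in a bin of \<alpha>. A traversal that ends with a pair of the uniform part keeps the block
  at the arriving end of each Hamiltonian step equal to an original bin, which settles both. The
  logarithm is not probabilistic. The method gives r^2 + d in place of d + (log n)^2, and the claim
  is trivial unless (d - 1)^(2r - 1) < n, which forces r \<le> log n.\<close>

lemma prob_bind_pmf:
  "measure_pmf.prob (bind_pmf p f) A = measure_pmf.expectation p (\<lambda>x. measure_pmf.prob (f x) A)"
proof -
  have "ennreal (measure_pmf.prob (bind_pmf p f) A) = (\<integral>\<^sup>+x. ennreal (measure_pmf.prob (f x) A) \<partial>p)"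
    by (simp flip: measure_pmf.emeasure_eq_measure)
  also have "\<dots> = ennreal (measure_pmf.expectation p (\<lambda>x. measure_pmf.prob (f x) A))"
    by (intro nn_integral_eq_integral measure_pmf.integrable_const_bound[where B = 1]) auto
  finally show ?thesis
    by (subst (asm) ennreal_inj) (auto intro!: integral_nonneg_AE)
qed

lemma integrable_prob [simp]: "integrable (measure_pmf p) (\<lambda>x. measure_pmf.prob (f x) (A x))"
  by (intro measure_pmf.integrable_const_bound[where B = 1]) auto

lemma expectation_diff_le:
  fixes f g :: "'a \<Rightarrow> real"
  assumes "integrable (measure_pmf p) f" "integrable (measure_pmf p) g"
    and "\<And>x. x \<in> set_pmf p \<Longrightarrow> \<bar>f x - g x\<bar> \<le> e"
  shows "\<bar>measure_pmf.expectation p f - measure_pmf.expectation p g\<bar> \<le> e"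
proof -
  have "measure_pmf.expectation p f \<le> measure_pmf.expectation p (\<lambda>x. g x + e)"
    using assms by (intro integral_mono_AE AE_pmfI) (fastforce simp: abs_le_iff)+
  moreover have "measure_pmf.expectation p g \<le> measure_pmf.expectation p (\<lambda>x. f x + e)"
    using assms by (intro integral_mono_AE AE_pmfI) (fastforce simp: abs_le_iff)+
  ultimately show ?thesis
    using assms by simp
qed

lemma prob_bind_le:
  assumes "\<And>x. x \<in> set_pmf p \<Longrightarrow> measure_pmf.prob (f x) A \<le> e"
  shows "measure_pmf.prob (bind_pmf p f) A \<le> e"
proof -
  have "measure_pmf.expectation p (\<lambda>x. measure_pmf.prob (f x) A) \<le> measure_pmf.expectation p (\<lambda>x. e)"
    using assms by (intro integral_mono_AE AE_pmfI) auto
  thus ?thesis by (simp add: prob_bind_pmf)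
qed

lemma prob_coupling:
  "\<bar>measure_pmf.prob p {x. A x} - measure_pmf.prob p {x. B x}\<bar> \<le> measure_pmf.prob p {x. A x \<noteq> B x}"
proof -
  have "measure_pmf.prob p {x. A x} \<le> measure_pmf.prob p ({x. B x} \<union> {x. A x \<noteq> B x})"
    by (intro measure_pmf.finite_measure_mono) auto
  also have "\<dots> \<le> measure_pmf.prob p {x. B x} + measure_pmf.prob p {x. A x \<noteq> B x}"
    by (intro measure_Un_le) auto
  finally have *: "measure_pmf.prob p {x. A x} \<le> measure_pmf.prob p {x. B x} + measure_pmf.prob p {x. A x \<noteq> B x}" .
  have "measure_pmf.prob p {x. B x} \<le> measure_pmf.prob p ({x. A x} \<union> {x. A x \<noteq> B x})"
    by (intro measure_pmf.finite_measure_mono) auto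
  also have "\<dots> \<le> measure_pmf.prob p {x. A x} + measure_pmf.prob p {x. A x \<noteq> B x}"
    by (intro measure_Un_le) auto
  finally show ?thesis using * by linarith
qed

text \<open>Le Cam's estimate for one coordinate, tested on a function with values in [0, 1].
  Against a Bernoulli variable of the same mean m, the Poisson law has more mass at 0 and beyond 1
  and less mass at 1, either side amounting to m (1 - exp (-m)) \<le> \<open>m\<^sup>2\<close>;
  replacing the mean m by p moves mass |p - m| from one point to the other.\<close>

lemma poisson0_expectation:
  fixes \<phi> :: "nat \<Rightarrow> real"
  assumes m: "m \<ge> 0" and \<phi>: "\<And>y. 0 \<le> \<phi> y" "\<And>y. \<phi> y \<le> 1"
  shows "\<bar>measure_pmf.expectation (poisson0_pmf m) \<phi> - ((1 - p) * \<phi> 0 + p * \<phi> 1)\<bar> \<le> \<bar>p - m\<bar> + m\<^sup>2"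
proof -
  define q where "q = poisson0_pmf m"
  have q0: "pmf q 0 = exp (- m)" and q1: "pmf q 1 = m * exp (- m)"
    using m by (auto simp: q_def poisson0_pmf_def pmf_return)
  have int: "integrable (measure_pmf q) f" if "\<And>y. 0 \<le> f y" "\<And>y. f y \<le> 1" for f :: "nat \<Rightarrow> real"
    using that by (intro measure_pmf.integrable_const_bound[where B = 1]) (auto simp: abs_of_nonneg)
  define \<psi> where "\<psi> y = (if y \<ge> 2 then \<phi> y else 0)" for y
  have split: "\<phi> y = \<phi> 0 * indicator {0} y + (\<phi> 1 * indicator {1} y + \<psi> y)" for y
    by (cases y; cases "y - 1") (auto simp: \<psi>_def)
  have int\<psi>: "integrable (measure_pmf q) \<psi>"
    using \<phi> by (intro int) (auto simp: \<psi>_def)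
  have E\<phi>: "measure_pmf.expectation q \<phi> = \<phi> 0 * pmf q 0 + (\<phi> 1 * pmf q 1 + measure_pmf.expectation q \<psi>)"
  proof -
    have "measure_pmf.expectation q \<phi> =
      measure_pmf.expectation q (\<lambda>y. \<phi> 0 * indicator {0} y + (\<phi> 1 * indicator {1} y + \<psi> y))"
      by (rule Bochner_Integration.integral_cong[OF refl]) (rule split)
    moreover have "integrable (measure_pmf q) (\<lambda>y. \<phi> i * indicator {i} y)" for i
      by (intro integrable_mult_right int) auto
    ultimately show ?thesis by (simp add: int\<psi> measure_pmf_single del: One_nat_def)
  qed
  have one: "1 = pmf q 0 + (pmf q 1 + measure_pmf.expectation q (\<lambda>y. if y \<ge> 2 then 1 else 0))"
  proof -
    have int1: "integrable (measure_pmf q) (\<lambda>y. if y \<ge> 2 then 1 else (0::real))"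
      by (intro int) auto
    have "1 = measure_pmf.expectation q (\<lambda>y. 1::real)" by simp
    also have "\<dots> = measure_pmf.expectation q (\<lambda>y. indicator {0} y + (indicator {1} y + (if y \<ge> 2 then 1 else 0)))"
      by (rule Bochner_Integration.integral_cong[OF refl], rename_tac y, case_tac y; case_tac "y - 1") auto
    also have "\<dots> = pmf q 0 + (pmf q 1 + measure_pmf.expectation q (\<lambda>y. if y \<ge> 2 then 1 else 0))"
    proof -
      have "integrable (measure_pmf q) (indicator {i} :: nat \<Rightarrow> real)" for i
        by (intro int) auto
      thus ?thesis using int1 by (simp add: measure_pmf_single del: One_nat_def)
    qed
    finally show ?thesis .
  qed
  have \<psi>le: "measure_pmf.expectation q \<psi> \<le> measure_pmf.expectation q (\<lambda>y. if y \<ge> 2 then 1 else 0)"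
    using \<phi> by (intro integral_mono int) (auto simp: \<psi>_def)
  have \<psi>ge: "measure_pmf.expectation q \<psi> \<ge> 0"
    using \<phi> by (intro integral_nonneg_AE AE_pmfI) (auto simp: \<psi>_def)
  define e where "e = exp (- m)"
  have e: "1 - m \<le> e" "e \<le> 1"
    using m exp_ge_add_one_self[of "-m"] by (auto simp: e_def)
  have D: "measure_pmf.expectation q \<phi> - ((1 - m) * \<phi> 0 + m * \<phi> 1) =
        \<phi> 0 * (e - (1 - m)) - \<phi> 1 * (m * (1 - e)) + measure_pmf.expectation q \<psi>"
    by (simp add: E\<phi> q0 q1[unfolded One_nat_def] e_def algebra_simps)
  have a: "0 \<le> \<phi> 0 * (e - (1 - m))" "\<phi> 0 * (e - (1 - m)) \<le> e - (1 - m)"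
    using e \<phi>[of 0] by (auto intro: mult_left_le_one_le)
  have b: "0 \<le> \<phi> 1 * (m * (1 - e))" "\<phi> 1 * (m * (1 - e)) \<le> m * (1 - e)"
    using e m \<phi>[of 1] by (auto intro!: mult_left_le_one_le)
  have c: "m * (1 - e) \<le> m\<^sup>2"
    using e m unfolding power2_eq_square by (intro mult_left_mono) auto
  have "measure_pmf.expectation q \<psi> \<le> 1 - e - m * e"
    using \<psi>le one q0 q1 by (simp add: e_def)
  hence "\<bar>measure_pmf.expectation q \<phi> - ((1 - m) * \<phi> 0 + m * \<phi> 1)\<bar> \<le> m\<^sup>2"
    unfolding D using a b c \<psi>ge by (simp add: algebra_simps abs_le_iff)
  moreover have "\<bar>((1 - m) * \<phi> 0 + m * \<phi> 1) - ((1 - p) * \<phi> 0 + p * \<phi> 1)\<bar> \<le> \<bar>p - m\<bar>"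
  proof -
    have "((1 - m) * \<phi> 0 + m * \<phi> 1) - ((1 - p) * \<phi> 0 + p * \<phi> 1) = (p - m) * (\<phi> 0 - \<phi> 1)"
      by (simp add: algebra_simps)
    moreover have "\<bar>\<phi> 0 - \<phi> 1\<bar> \<le> 1"
      using \<phi>[of 0] \<phi>[of 1] by linarith
    ultimately show ?thesis
      by (simp add: abs_mult mult_left_le)
  qed
  ultimately show ?thesis
    unfolding q_def by linarith
qed

text \<open>
  Replacing the coordinates one at a time, the error at coordinate \<open>a\<close> only involves the
  dependence between \<open>I a\<close> and the coordinates that have not been replaced yet.
\<close>

lemma indicator_vector_poisson:
  fixes I :: "pairing \<Rightarrow> 'b \<Rightarrow> bool"
  assumes "finite J"
    and m: "\<And>a. a \<in> J \<Longrightarrow> m a \<ge> 0"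
    and p: "\<And>a. a \<in> J \<Longrightarrow> p a = measure_pmf.prob D {X. I a X}"
    and indep: "\<And>a S. a \<in> J \<Longrightarrow>
      (\<And>X Y. (\<And>b. b \<in> J \<Longrightarrow> b \<noteq> a \<Longrightarrow> I b X \<longleftrightarrow> I b Y) \<Longrightarrow> X \<in> S \<longleftrightarrow> Y \<in> S) \<Longrightarrow>
      \<bar>measure_pmf.prob D {X. I a X \<and> X \<in> S} - p a * measure_pmf.prob D S\<bar> \<le> \<eta> a"
  shows "\<bar>measure_pmf.prob (map_pmf (\<lambda>X a. if a \<in> J then of_bool (I a X) else 0) D) A
           - measure_pmf.prob (poisson_vector_pmf J m) A\<bar>
         \<le> (\<Sum>a\<in>J. \<bar>p a - m a\<bar> + (m a)\<^sup>2 + 2 * \<eta> a)"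
proof -
  define V :: "pairing set \<Rightarrow> 'b \<Rightarrow> pairing \<Rightarrow> nat" where
    "V K X = (\<lambda>a. if a \<in> K then of_bool (I a X) else 0)" for K X
  have "\<bar>measure_pmf.prob (map_pmf (V K) D) A
           - measure_pmf.prob (Pi_pmf K 0 (\<lambda>a. poisson0_pmf (m a))) A\<bar>
         \<le> (\<Sum>a\<in>K. \<bar>p a - m a\<bar> + (m a)\<^sup>2 + 2 * \<eta> a)" if "finite K" "K \<subseteq> J" for K A
    using that
  proof (induction K arbitrary: A rule: finite_induct)
    case empty
    have "V {} = (\<lambda>X. (\<lambda>_. 0))" by (auto simp: V_def)
    thus ?case by (simp add: map_pmf_const)
  next
    case (insert a K)
    \<comment> \<open>The section of \<open>A\<close> at the value \<open>y\<close> of coordinate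
      \<open>a\<close>, pulled back to the sample space; it depends on the coordinates in
      \<open>K\<close> only.\<close>
    define S where "S y = {X. (V K X)(a := y) \<in> A}" for y
    define \<phi> where "\<phi> y = measure_pmf.prob D (S y)" for y
    have aJ: "a \<in> J" using insert by auto
    have Vins: "V (insert a K) X = (V K X)(a := of_bool (I a X))" for X
      using insert by (auto simp: V_def)
    have indep': "\<bar>measure_pmf.prob D {X. I a X \<and> X \<in> S y} - p a * \<phi> y\<bar> \<le> \<eta> a" for y
      unfolding \<phi>_def
    proof (rule indep[OF aJ])
      fix X Y assume *: "\<And>b. b \<in> J \<Longrightarrow> b \<noteq> a \<Longrightarrow> I b X \<longleftrightarrow> I b Y"
      have "V K X = V K Y"
      proof (rule ext)
        fix b show "V K X b = V K Y b"
        proof (cases "b \<in> K")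
          case True
          hence "b \<in> J" "b \<noteq> a" using insert by auto
          from *[OF this] show ?thesis by (simp add: V_def)
        qed (simp add: V_def)
      qed
      thus "X \<in> S y \<longleftrightarrow> Y \<in> S y" by (simp add: S_def)
    qed
    have "measure_pmf.prob (map_pmf (V (insert a K)) D) A =
            measure_pmf.prob D ({X. I a X \<and> X \<in> S 1} \<union> {X. \<not> I a X \<and> X \<in> S 0})"
      unfolding measure_map_pmf
      by (intro arg_cong[where f = "measure_pmf.prob D"] set_eqI, rename_tac X, case_tac "I a X")
         (simp_all add: Vins S_def)
    also have "\<dots> = measure_pmf.prob D {X. I a X \<and> X \<in> S 1} + measure_pmf.prob D {X. \<not> I a X \<and> X \<in> S 0}"
      by (intro measure_pmf.finite_measure_Union) auto
    also have "{X. \<not> I a X \<and> X \<in> S 0} = S 0 - {X. I a X \<and> X \<in> S 0}"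
      by auto
    also have "measure_pmf.prob D \<dots> = \<phi> 0 - measure_pmf.prob D {X. I a X \<and> X \<in> S 0}"
      unfolding \<phi>_def by (intro measure_pmf.finite_measure_Diff) auto
    \<comment> \<open>Splitting according to \<open>I a\<close> uses the dependence bound once with
      \<open>S 1\<close> and once with \<open>S 0\<close>, hence the factor 2.\<close>
    finally have 1: "\<bar>measure_pmf.prob (map_pmf (V (insert a K)) D) A - ((1 - p a) * \<phi> 0 + p a * \<phi> 1)\<bar> \<le> 2 * \<eta> a"
      using indep'[of 0] indep'[of 1] by (simp add: algebra_simps abs_le_iff)
    have 2: "\<bar>measure_pmf.expectation (poisson0_pmf (m a)) \<phi> - ((1 - p a) * \<phi> 0 + p a * \<phi> 1)\<bar> \<le> \<bar>p a - m a\<bar> + (m a)\<^sup>2"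
      using m[OF aJ] by (intro poisson0_expectation) (auto simp: \<phi>_def)
    have "measure_pmf.prob (Pi_pmf (insert a K) 0 (\<lambda>a. poisson0_pmf (m a))) A =
        measure_pmf.expectation (poisson0_pmf (m a))
          (\<lambda>y. measure_pmf.prob (Pi_pmf K 0 (\<lambda>a. poisson0_pmf (m a))) {f. f(a := y) \<in> A})"
      using insert by (simp add: Pi_pmf_insert' prob_bind_pmf[of "poisson0_pmf (m a)"] measure_map_pmf vimage_def flip: map_pmf_def)
    also have "\<bar>measure_pmf.expectation (poisson0_pmf (m a)) \<phi> - \<dots>\<bar> \<le> (\<Sum>a\<in>K. \<bar>p a - m a\<bar> + (m a)\<^sup>2 + 2 * \<eta> a)"
    proof (rule expectation_diff_le)
      fix y
      show "\<bar>\<phi> y - measure_pmf.prob (Pi_pmf K 0 (\<lambda>a. poisson0_pmf (m a))) {f. f(a := y) \<in> A}\<bar>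
             \<le> (\<Sum>a\<in>K. \<bar>p a - m a\<bar> + (m a)\<^sup>2 + 2 * \<eta> a)"
        using insert.IH[of "{f. f(a := y) \<in> A}"] insert.prems by (simp add: \<phi>_def S_def vimage_def)
    qed (auto simp: \<phi>_def[abs_def])
    finally show ?case
      using 1 2 insert by simp
  qed
  from this[of J A] show ?thesis
    using assms(1) by (simp add: V_def[abs_def] poisson_vector_pmf_def)
qed

lemma tv_dist_le:
  assumes "\<And>A. \<bar>measure_pmf.prob p A - measure_pmf.prob q A\<bar> \<le> e"
  shows "tv_dist p q \<le> e"
  unfolding tv_dist_def using assms by (intro cSUP_least) auto

lemma tv_dist_le_1: "tv_dist p q \<le> 1"
proof (rule tv_dist_le)
  fix A
  show "\<bar>measure_pmf.prob p A - measure_pmf.prob q A\<bar> \<le> 1"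
    using measure_pmf.prob_le_1[of p A] measure_pmf.prob_le_1[of q A]
      measure_nonneg[of "measure_pmf p" A] measure_nonneg[of "measure_pmf q" A] by linarith
qed

section \<open>Perfect matchings and Hamiltonian matchings\<close>

text \<open>Besides pairings of prevertices, the family of two-element blocks that a Hamiltonian
  matching passes through is itself treated as a matching, so that \<open>mate\<close> also denotes
  the other element of a block.\<close>

definition matchings :: "'v set \<Rightarrow> 'v set set set" where
  "matchings V = {P. partition_on V P \<and> (\<forall>e\<in>P. card e = 2)}"

lemma pairings_on_eq: "pairings_on V = matchings V"
  by (simp add: pairings_on_def matchings_def)

lemma finite_matchings [simp]: "finite V \<Longrightarrow> finite (matchings V)"
  by (rule finite_subset[of _ "{P. partition_on V P}"]) (auto simp: matchings_def finitely_many_partition_on)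

lemma matchings_empty [simp]: "matchings {} = {{}}"
  by (auto simp: matchings_def partition_on_empty)

lemma matchings_Union: "R \<in> matchings V \<Longrightarrow> \<Union>R = V"
  by (auto simp: matchings_def partition_on_def)

lemma matchings_disjoint: "R \<in> matchings V \<Longrightarrow> e \<in> R \<Longrightarrow> f \<in> R \<Longrightarrow> v \<in> e \<Longrightarrow> v \<in> f \<Longrightarrow> e = f"
  unfolding matchings_def partition_on_def pairwise_def disjnt_def by fast

lemma matchings_card: "R \<in> matchings V \<Longrightarrow> e \<in> R \<Longrightarrow> card e = 2"
  by (auto simp: matchings_def)

lemma matchings_neq: "R \<in> matchings V \<Longrightarrow> {a, b} \<in> R \<Longrightarrow> a \<noteq> b"
  by (auto dest: matchings_card)

lemma matchings_mem: "R \<in> matchings V \<Longrightarrow> {a, b} \<in> R \<Longrightarrow> a \<in> V \<and> b \<in> V"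
  using matchings_Union[of R V] by blast

lemma matchings_finite: "R \<in> matchings V \<Longrightarrow> finite V \<Longrightarrow> finite R"
  using finite_UnionD[of R] matchings_Union[of R V] by blast

lemma matchings_even:
  assumes "R \<in> matchings V" "finite V"
  shows "card V = 2 * card R"
proof -
  have "card (\<Union>R) = sum card R"
    using assms by (intro card_Union_disjoint)
      (auto simp: matchings_def partition_on_def intro: finite_subset[OF Union_upper])
  thus ?thesis
    using assms by (simp add: matchings_Union matchings_card)
qed

lemma matchings_insert:
  assumes "R \<in> matchings V" "a \<notin> V" "b \<notin> V" "a \<noteq> b"
  shows "insert {a, b} R \<in> matchings (insert a (insert b V))"
proof -
  have "disjnt {a, b} (\<Union>R)"
    using assms by (auto simp: matchings_Union)
  moreover have "insert a (insert b V) - {a, b} = V"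
    using assms by auto
  ultimately show ?thesis
    using assms by (auto simp: matchings_def partition_on_insert)
qed

lemma matchings_remove:
  assumes "R \<in> matchings V" "{a, b} \<in> R"
  shows "R - {{a, b}} \<in> matchings (V - {a, b})"
proof -
  have R: "R = insert {a, b} (R - {{a, b}})"
    using assms by auto
  have "disjnt {a, b} (\<Union>(R - {{a, b}}))"
  proof -
    have "a \<notin> e \<and> b \<notin> e" if "e \<in> R - {{a, b}}" for e
      using that assms(2) matchings_disjoint[OF assms(1), of "{a, b}" e a]
        matchings_disjoint[OF assms(1), of "{a, b}" e b] by auto
    thus ?thesis by (auto simp: disjnt_def)
  qed
  hence "partition_on V (insert {a, b} (R - {{a, b}})) \<longleftrightarrow>
    partition_on (V - {a, b}) (R - {{a, b}}) \<and> {a, b} \<subseteq> V \<and> {a, b} \<noteq> {}"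
    by (rule partition_on_insert)
  thus ?thesis
    using assms R by (auto simp: matchings_def)
qed

definition mate :: "'v set set \<Rightarrow> 'v \<Rightarrow> 'v" where
  "mate R a = (THE b. {a, b} \<in> R)"

lemma mate_eq: "R \<in> matchings V \<Longrightarrow> {a, b} \<in> R \<Longrightarrow> mate R a = b"
  unfolding mate_def
  by (rule the_equality) (auto dest: matchings_disjoint[where v = a] simp: doubleton_eq_iff)

lemma mate_in:
  assumes "R \<in> matchings V" "a \<in> V"
  shows "{a, mate R a} \<in> R"
proof -
  obtain e where e: "e \<in> R" "a \<in> e"
    using assms matchings_Union[OF assms(1)] by blast
  obtain u v where "e = {u, v}"
    using matchings_card[OF assms(1) e(1)] by (auto simp: card_2_iff)
  with e have "{a, if a = u then v else u} \<in> R"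
    by (auto simp: insert_commute)
  then obtain b where "{a, b} \<in> R" ..
  thus ?thesis
    using mate_eq[OF assms(1)] by simp
qed

lemma mate_mem: "R \<in> matchings V \<Longrightarrow> a \<in> V \<Longrightarrow> mate R a \<in> V"
  using mate_in[of R V a] matchings_mem[of R V a "mate R a"] by blast

lemma mate_neq: "R \<in> matchings V \<Longrightarrow> a \<in> V \<Longrightarrow> mate R a \<noteq> a"
  using mate_in[of R V a] matchings_neq[of R V a "mate R a"] by auto

text \<open>The prevertices \<open>y\<close> and \<open>z\<close> are inserted so that \<open>y\<close> is matched with \<open>a\<close>.\<close>

definition ins :: "'v \<Rightarrow> 'v \<Rightarrow> 'v set set \<Rightarrow> 'v \<Rightarrow> 'v set set" where
  "ins y z R a = (if a = z then insert {y, z} R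
     else insert {y, a} (insert {z, mate R a} (R - {{a, mate R a}})))"

text \<open>Inverse of \<open>ins\<close>: the partners left behind by \<open>y\<close> and
  \<open>z\<close> are joined, unless \<open>y\<close> and \<open>z\<close> were matched with each
  other.\<close>

definition del :: "'v \<Rightarrow> 'v \<Rightarrow> 'v set set \<Rightarrow> 'v set set" where
  "del y z P = (if {y, z} \<in> P then P - {{y, z}}
     else insert {mate P y, mate P z} (P - {{y, mate P y}, {z, mate P z}}))"

lemma ins_matchings:
  assumes R: "R \<in> matchings V" and yz: "y \<notin> V" "z \<notin> V" "y \<noteq> z" and a: "a \<in> insert z V"
  shows "ins y z R a \<in> matchings (insert y (insert z V))"
proof (cases "a = z")
  case True
  thus ?thesis using matchings_insert[OF R] yz by (simp add: ins_def)
next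
  case False
  hence aV: "a \<in> V" using a by auto
  define b where "b = mate R a"
  have b: "b \<in> V" "b \<noteq> a" "{a, b} \<in> R"
    using mate_in[OF R aV] mate_mem[OF R aV] mate_neq[OF R aV] by (auto simp: b_def)
  have 1: "R - {{a, b}} \<in> matchings (V - {a, b})"
    using R b by (intro matchings_remove)
  have 2: "insert {z, b} (R - {{a, b}}) \<in> matchings (insert z (insert b (V - {a, b})))"
    using yz b by (intro matchings_insert[OF 1]) auto
  have "insert {y, a} (insert {z, b} (R - {{a, b}})) \<in> matchings (insert y (insert a (insert z (insert b (V - {a, b})))))"
    using yz b aV by (intro matchings_insert[OF 2]) auto
  also have "insert y (insert a (insert z (insert b (V - {a, b})))) = insert y (insert z V)"
    using aV b by auto
  finally show ?thesis
    using False by (simp add: ins_def b_def)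
qed

lemma mate_ins:
  assumes R: "R \<in> matchings V" and yz: "y \<notin> V" "z \<notin> V" "y \<noteq> z" and a: "a \<in> insert z V"
  shows "mate (ins y z R a) y = a"
  by (rule mate_eq[OF ins_matchings[OF assms]]) (simp add: ins_def)

lemma del_ins:
  assumes R: "R \<in> matchings V" and yz: "y \<notin> V" "z \<notin> V" "y \<noteq> z" and a: "a \<in> insert z V"
  shows "del y z (ins y z R a) = R"
proof -
  have notin: "e \<notin> R" if "y \<in> e \<or> z \<in> e" for e
    using that yz matchings_Union[OF R] by blast
  show ?thesis
  proof (cases "a = z")
    case True
    thus ?thesis using notin by (auto simp: ins_def del_def)
  next
    case False
    hence aV: "a \<in> V" using a by auto
    define b where "b = mate R a"
    have b: "b \<in> V" "b \<noteq> a" "{a, b} \<in> R"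
      using mate_in[OF R aV] mate_mem[OF R aV] mate_neq[OF R aV] by (auto simp: b_def)
    define P where "P = ins y z R a"
    have P: "P \<in> matchings (insert y (insert z V))"
      unfolding P_def by (rule ins_matchings[OF assms])
    have P': "P = insert {y, a} (insert {z, b} (R - {{a, b}}))"
      using False by (simp add: P_def ins_def b_def)
    have my: "mate P y = a" and mz: "mate P z = b"
      using mate_eq[OF P, of y a] mate_eq[OF P, of z b] by (auto simp: P')
    have "{y, z} \<notin> P"
      using notin[of "{y, z}"] yz aV b by (auto simp: P' doubleton_eq_iff)
    hence "del y z P = insert {a, b} (P - {{y, a}, {z, b}})"
      by (simp add: del_def my mz)
    also have "\<dots> = R"
      using notin[of "{y, a}"] notin[of "{z, b}"] b unfolding P' by auto
    finally show ?thesis by (simp add: P_def)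
  qed
qed

lemma del_matchings:
  assumes P: "P \<in> matchings (insert y (insert z V))" and yz: "y \<notin> V" "z \<notin> V" "y \<noteq> z"
  shows "del y z P \<in> matchings V \<and> mate P y \<in> insert z V \<and> ins y z (del y z P) (mate P y) = P"
proof (cases "{y, z} \<in> P")
  case True
  have "mate P y = z"
    using mate_eq[OF P True] .
  moreover have "insert y (insert z V) - {y, z} = V"
    using yz by auto
  ultimately show ?thesis
    using True matchings_remove[OF P True] by (auto simp: del_def ins_def)
next
  case False
  define a b where "a = mate P y" and "b = mate P z"
  have a: "{y, a} \<in> P" and b: "{z, b} \<in> P"
    using mate_in[OF P] by (auto simp: a_def b_def)
  have aV: "a \<in> V" and bV: "b \<in> V"
    using a b False matchings_mem[OF P a] matchings_mem[OF P b] matchings_neq[OF P a]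
      matchings_neq[OF P b] by (auto simp: insert_commute)
  have ab: "a \<noteq> b"
    using matchings_disjoint[OF P a b, of a] yz aV by (auto simp: doubleton_eq_iff)
  have 1: "P - {{y, a}} \<in> matchings (insert y (insert z V) - {y, a})"
    by (rule matchings_remove[OF P a])
  have "{z, b} \<in> P - {{y, a}}"
    using b yz aV by (auto simp: doubleton_eq_iff)
  note 2 = matchings_remove[OF 1 this]
  have 3: "insert {a, b} (P - {{y, a}} - {{z, b}}) \<in>
      matchings (insert a (insert b (insert y (insert z V) - {y, a} - {z, b})))"
    using ab by (intro matchings_insert[OF 2]) auto
  have V: "insert a (insert b (insert y (insert z V) - {y, a} - {z, b})) = V"
    using aV bV yz by auto
  have D: "del y z P = insert {a, b} (P - {{y, a}} - {{z, b}})"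
    using False by (auto simp: del_def a_def b_def)
  have DV: "del y z P \<in> matchings V"
    using 3 V D by simp
  have "mate (del y z P) a = b"
    using DV by (rule mate_eq) (simp add: D)
  moreover have "{a, b} \<notin> P"
    using matchings_disjoint[OF P _ a, of "{a, b}" a] yz aV bV by (auto simp: doubleton_eq_iff)
  moreover have "a \<noteq> z" using aV yz by auto
  ultimately have "ins y z (del y z P) a = P"
    using a b by (auto simp: ins_def D)
  thus ?thesis
    using DV aV by (simp add: a_def)
qed

text \<open>A uniform matching of the larger set is thus a uniform matching of \<open>V\<close>
  together with an independent uniform partner \<open>a\<close> of \<open>y\<close>.\<close>

lemma bij_betw_ins:
  assumes "y \<notin> V" "z \<notin> V" "y \<noteq> z"
  shows "bij_betw (\<lambda>(R, a). ins y z R a) (matchings V \<times> insert z V) (matchings (insert y (insert z V)))"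
proof (rule bij_betw_byWitness[where f' = "\<lambda>P. (del y z P, mate P y)"])
  show "\<forall>x\<in>matchings V \<times> insert z V. (del y z (case x of (R, a) \<Rightarrow> ins y z R a), mate (case x of (R, a) \<Rightarrow> ins y z R a) y) = x"
  proof (rule ballI)
    fix x assume "x \<in> matchings V \<times> insert z V"
    then obtain R a where "x = (R, a)" "R \<in> matchings V" "a \<in> insert z V" by (rule SigmaE)
    thus "(del y z (case x of (R, a) \<Rightarrow> ins y z R a), mate (case x of (R, a) \<Rightarrow> ins y z R a) y) = x"
      using del_ins[OF _ assms] mate_ins[OF _ assms] by (simp only: prod.case)
  qed
  show "\<forall>P\<in>matchings (insert y (insert z V)). (case (del y z P, mate P y) of (R, a) \<Rightarrow> ins y z R a) = P"
    using del_matchings[OF _ assms] by (simp only: prod.case) blast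
  show "(\<lambda>(R, a). ins y z R a) ` (matchings V \<times> insert z V) \<subseteq> matchings (insert y (insert z V))"
    by (clarsimp simp only: image_subset_iff mem_Sigma_iff ins_matchings[OF _ assms])
  show "(\<lambda>P. (del y z P, mate P y)) ` matchings (insert y (insert z V)) \<subseteq> matchings V \<times> insert z V"
    using del_matchings[OF _ assms] by (simp only: image_subset_iff mem_Sigma_iff) blast
qed

lemma matchings_nonempty:
  assumes "finite V" "even (card V)"
  shows "matchings V \<noteq> {}"
  using assms
proof (induction "card V" arbitrary: V rule: less_induct)
  case less
  show ?case
  proof (cases "card V = 0")
    case True
    thus ?thesis using less by simp
  next
    case False
    then obtain y where y: "y \<in> V" by (metis card.empty ex_in_conv)
    have "card V \<noteq> 1" using less.prems by auto
    hence "card V > 1" using False by linarith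
    hence "card (V - {y}) \<noteq> 0" using y less.prems by simp
    then obtain z where z: "z \<in> V" "z \<noteq> y" using less.prems by (metis Diff_iff card.empty ex_in_conv insertI1)
    define W where "W = V - {y, z}"
    have V: "V = insert y (insert z W)" "y \<notin> W" "z \<notin> W" "finite W" using y z less.prems by (auto simp: W_def)
    have c: "card V = card W + 2" using V z by simp
    hence "matchings W \<noteq> {}" using less V by auto
    then obtain R where "R \<in> matchings W" by auto
    from matchings_insert[OF this V(2,3)] z V show ?thesis by auto
  qed
qed

text \<open>The elements of \<open>B\<close> are the vertices, each with two half-edges, so
  contracting them turns \<open>M\<close> into a 2-regular multigraph. Irreducibility says that it
  is connected, hence a single cycle through all of \<open>B\<close>. This form needs no cyclic
  order and behaves well under contraction and renaming.\<close>

definition ham :: "'v set set \<Rightarrow> 'v set set set" where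
  "ham B = {M \<in> matchings (\<Union>B). \<forall>S\<subseteq>B. S \<noteq> {} \<longrightarrow> (\<forall>e\<in>M. e \<inter> \<Union>S \<noteq> {} \<longrightarrow> e \<subseteq> \<Union>S) \<longrightarrow> S = B}"

lemma ham_matchings: "M \<in> ham B \<Longrightarrow> M \<in> matchings (\<Union>B)"
  by (simp add: ham_def)

lemma ham_irreducible:
  "M \<in> ham B \<Longrightarrow> S \<subseteq> B \<Longrightarrow> S \<noteq> {} \<Longrightarrow> (\<And>e. e \<in> M \<Longrightarrow> e \<inter> \<Union>S \<noteq> {} \<Longrightarrow> e \<subseteq> \<Union>S) \<Longrightarrow> S = B"
  by (simp add: ham_def)

lemma hamI:
  "M \<in> matchings (\<Union>B) \<Longrightarrow> (\<And>S. S \<subseteq> B \<Longrightarrow> S \<noteq> {} \<Longrightarrow> (\<And>e. e \<in> M \<Longrightarrow> e \<inter> \<Union>S \<noteq> {} \<Longrightarrow> e \<subseteq> \<Union>S) \<Longrightarrow> S = B) \<Longrightarrow> M \<in> ham B"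
  by (simp add: ham_def)

lemma finite_ham [simp]: "finite (\<Union>B) \<Longrightarrow> finite (ham B)"
  by (rule finite_subset[of _ "matchings (\<Union>B)"]) (auto simp: ham_def)

lemma ham_empty [simp]: "ham {} = {{}}"
  by (auto simp: ham_def)

lemma ham_single:
  assumes "y \<noteq> z"
  shows "{{y, z}} \<in> ham {{y, z}}"
proof (rule hamI)
  show "{{y, z}} \<in> matchings (\<Union>{{y, z}})"
    using matchings_insert[of "{}" "{}" y z] assms by simp
qed auto

text \<open>Subdividing an edge by a new vertex keeps the cycle connected. The partner
  \<open>a = z\<close> is excluded here, since \<open>{y, z}\<close> would close up a component of
  its own.\<close>

lemma ins_ham:
  assumes M: "M \<in> ham B" and yz: "y \<notin> \<Union>B" "z \<notin> \<Union>B" "y \<noteq> z" and a: "a \<in> \<Union>B"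
  shows "ins y z M a \<in> ham (insert {y, z} B)"
proof (rule hamI)
  note P = ham_matchings[OF M]
  have az: "a \<noteq> z" using a yz by auto
  define b where "b = mate M a"
  have b: "b \<in> \<Union>B" "b \<noteq> a" "{a, b} \<in> M"
    using mate_in[OF P a] mate_mem[OF P a] mate_neq[OF P a] unfolding b_def by blast+
  have N: "ins y z M a = insert {y, a} (insert {z, b} (M - {{a, b}}))"
    using az by (simp add: ins_def b_def)
  have "\<Union>(insert {y, z} B) = insert y (insert z (\<Union>B))" by blast
  thus "ins y z M a \<in> matchings (\<Union>(insert {y, z} B))"
    using ins_matchings[OF P yz, of a] a by simp
  fix S assume S: "S \<subseteq> insert {y, z} B" "S \<noteq> {}"
    and cl: "\<And>e. e \<in> ins y z M a \<Longrightarrow> e \<inter> \<Union>S \<noteq> {} \<Longrightarrow> e \<subseteq> \<Union>S"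
  show "S = insert {y, z} B"
  proof (cases "{y, z} \<in> S")
    case True
    define S' where "S' = S - {{y, z}}"
    have S': "\<Union>S = insert y (insert z (\<Union>S'))" "S' \<subseteq> B"
      using True S unfolding S'_def by blast+
    have abS: "a \<in> \<Union>S" "b \<in> \<Union>S"
      using cl[of "{y, a}"] cl[of "{z, b}"] True unfolding N by blast+
    hence ab: "a \<in> \<Union>S'" "b \<in> \<Union>S'"
      using a b yz unfolding S'(1) by blast+
    have "S' = B"
    proof (rule ham_irreducible[OF M])
      show "S' \<subseteq> B" "S' \<noteq> {}" using S' ab by blast+
      fix e assume e: "e \<in> M" "e \<inter> \<Union>S' \<noteq> {}"
      show "e \<subseteq> \<Union>S'"
      proof (cases "e = {a, b}")
        case True thus ?thesis using ab by simp
      next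
        case False
        hence "e \<subseteq> \<Union>S" using cl[of e] e S' unfolding N by blast
        moreover have "e \<subseteq> \<Union>B" using e matchings_Union[OF P] by blast
        ultimately show ?thesis using yz unfolding S'(1) by blast
      qed
    qed
    thus ?thesis using S True unfolding S'_def by blast
  next
    case False
    hence SB: "S \<subseteq> B" using S by blast
    hence yzS: "y \<notin> \<Union>S" "z \<notin> \<Union>S" using yz by blast+
    hence abS: "a \<notin> \<Union>S" "b \<notin> \<Union>S"
      using cl[of "{y, a}"] cl[of "{z, b}"] unfolding N by blast+
    have "S = B"
    proof (rule ham_irreducible[OF M SB S(2)])
      fix e assume e: "e \<in> M" "e \<inter> \<Union>S \<noteq> {}"
      hence "e \<noteq> {a, b}" using abS by blast
      thus "e \<subseteq> \<Union>S" using cl[of e] e unfolding N by blast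
    qed
    thus ?thesis using abS a by blast
  qed
qed

text \<open>Contraction of the vertex \<open>{y, z}\<close>. If \<open>y\<close> and
  \<open>z\<close> were matched, this vertex alone would be closed, which irreducibility forbids as
  long as there are other vertices.\<close>

lemma del_ham:
  assumes M: "M \<in> ham (insert {y, z} B)" and yz: "y \<notin> \<Union>B" "z \<notin> \<Union>B" "y \<noteq> z" and "B \<noteq> {}"
  shows "del y z M \<in> ham B \<and> mate M y \<in> \<Union>B \<and> ins y z (del y z M) (mate M y) = M"
proof -
  have U: "\<Union>(insert {y, z} B) = insert y (insert z (\<Union>B))" by blast
  have P: "M \<in> matchings (insert y (insert z (\<Union>B)))"
    using ham_matchings[OF M] unfolding U .
  have yzM: "{y, z} \<notin> M"
  proof
    assume yzM: "{y, z} \<in> M"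
    have "{{y, z}} = insert {y, z} B"
    proof (rule ham_irreducible[OF M])
      fix e assume e: "e \<in> M" "e \<inter> \<Union>{{y, z}} \<noteq> {}"
      then obtain v where "v \<in> e" "v \<in> {y, z}" by blast
      from matchings_disjoint[OF P e(1) yzM this] show "e \<subseteq> \<Union>{{y, z}}" by blast
    qed auto
    hence "B \<subseteq> {{y, z}}" by blast
    thus False using yz \<open>B \<noteq> {}\<close> by blast
  qed
  define a b where "a = mate M y" and "b = mate M z"
  have am: "{y, a} \<in> M" and bm: "{z, b} \<in> M"
    unfolding a_def b_def by (rule mate_in[OF P], blast)+
  have "a \<in> insert z (\<Union>B)" and D: "del y z M \<in> matchings (\<Union>B)" and I: "ins y z (del y z M) a = M"
    using del_matchings[OF P yz] by (auto simp: a_def)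
  hence a: "a \<in> \<Union>B" using am yzM by blast
  have b: "b \<in> \<Union>B"
    using matchings_mem[OF P bm] matchings_neq[OF P bm] bm yzM by (auto simp: insert_commute)
  have N: "del y z M = insert {a, b} (M - {{y, a}, {z, b}})"
    using yzM by (simp add: del_def a_def b_def)
  have "del y z M \<in> ham B"
  proof (rule hamI[OF D])
    fix S assume S: "S \<subseteq> B" "S \<noteq> {}"
      and cl: "\<And>e. e \<in> del y z M \<Longrightarrow> e \<inter> \<Union>S \<noteq> {} \<Longrightarrow> e \<subseteq> \<Union>S"
    have ab: "a \<in> \<Union>S \<longleftrightarrow> b \<in> \<Union>S"
      using cl[of "{a, b}"] unfolding N by blast
    \<comment> \<open>A closed set for the contraction lifts to one for \<open>M\<close>: the
      contracted vertex is added exactly when its two neighbours belong to the set.\<close>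
    define S' where "S' = (if a \<in> \<Union>S then insert {y, z} S else S)"
    have "S' = insert {y, z} B"
    proof (rule ham_irreducible[OF M])
      show "S' \<subseteq> insert {y, z} B" "S' \<noteq> {}" using S by (auto simp: S'_def)
      fix e assume e: "e \<in> M" "e \<inter> \<Union>S' \<noteq> {}"
      have sub: "\<Union>S \<subseteq> \<Union>S'" by (auto simp: S'_def)
      consider "e = {y, a}" | "e = {z, b}" | "e \<in> del y z M" "e \<noteq> {y, a}" "e \<noteq> {z, b}"
        using e unfolding N by blast
      thus "e \<subseteq> \<Union>S'"
      proof cases
        case 1
        thus ?thesis using e ab S yz unfolding S'_def by (cases "a \<in> \<Union>S") auto
      next
        case 2
        thus ?thesis using e ab S yz unfolding S'_def by (cases "a \<in> \<Union>S") auto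
      next
        case 3
        have "y \<notin> e" "z \<notin> e"
          using 3 e(1) matchings_disjoint[OF P e(1) am, of y] matchings_disjoint[OF P e(1) bm, of z] by blast+
        hence "e \<inter> \<Union>S \<noteq> {}" using e(2) unfolding S'_def by (auto split: if_splits)
        thus ?thesis using cl[OF 3(1)] sub by blast
      qed
    qed
    moreover have nB: "{y, z} \<notin> B" "{y, z} \<notin> S" using yz S by blast+
    ultimately show "S = B"
    proof (cases "a \<in> \<Union>S")
      case True
      hence "insert {y, z} S = insert {y, z} B"
        using \<open>S' = insert {y, z} B\<close> by (simp only: S'_def if_True)
      thus ?thesis using insert_ident[OF nB(2,1)] by blast
    next
      case False
      hence "S = insert {y, z} B"
        using \<open>S' = insert {y, z} B\<close> by (simp only: S'_def if_False)
      thus ?thesis using nB by simp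
    qed
  qed
  thus ?thesis using a I by (simp add: a_def)
qed

text \<open>So a uniform Hamiltonian matching arises from one with a vertex less by subdividing at a
  uniform half-edge; the two half-edges of an edge correspond to the two orientations of the
  inserted vertex.\<close>

lemma bij_betw_ins_ham:
  assumes "y \<notin> \<Union>B" "z \<notin> \<Union>B" "y \<noteq> z" and "B \<noteq> {}"
  shows "bij_betw (\<lambda>(M, a). ins y z M a) (ham B \<times> \<Union>B) (ham (insert {y, z} B))"
proof (rule bij_betw_byWitness[where f' = "\<lambda>P. (del y z P, mate P y)"])
  show "\<forall>x\<in>ham B \<times> \<Union>B. (del y z (case x of (R, a) \<Rightarrow> ins y z R a), mate (case x of (R, a) \<Rightarrow> ins y z R a) y) = x"
  proof (rule ballI)
    fix x assume "x \<in> ham B \<times> \<Union>B"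
    then obtain R a where x: "x = (R, a)" "R \<in> ham B" "a \<in> \<Union>B" by (rule SigmaE)
    hence "R \<in> matchings (\<Union>B)" "a \<in> insert z (\<Union>B)" using ham_matchings by blast+
    thus "(del y z (case x of (R, a) \<Rightarrow> ins y z R a), mate (case x of (R, a) \<Rightarrow> ins y z R a) y) = x"
      using del_ins[OF _ assms(1-3)] mate_ins[OF _ assms(1-3)] x(1) by (simp only: prod.case)
  qed
  show "\<forall>P\<in>ham (insert {y, z} B). (case (del y z P, mate P y) of (R, a) \<Rightarrow> ins y z R a) = P"
    using del_ham[OF _ assms] by (simp only: prod.case) blast
  show "(\<lambda>(R, a). ins y z R a) ` (ham B \<times> \<Union>B) \<subseteq> ham (insert {y, z} B)"
    using ins_ham[OF _ assms(1-3)] by (intro image_subsetI, elim SigmaE) (simp only: prod.case)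
  show "(\<lambda>P. (del y z P, mate P y)) ` ham (insert {y, z} B) \<subseteq> ham B \<times> \<Union>B"
    using del_ham[OF _ assms] by (simp only: image_subset_iff mem_Sigma_iff) blast
qed

lemma ham_nonempty:
  assumes "finite V" "B \<in> matchings V"
  shows "ham B \<noteq> {}"
proof -
  have "finite B" using assms matchings_finite by blast
  thus ?thesis using assms(2)
  proof (induction B arbitrary: V rule: finite_induct)
    case empty
    thus ?case by simp
  next
    case (insert e B)
    obtain y z where e: "e = {y, z}"
      using matchings_card[OF insert.prems, of e] by (auto simp: card_2_iff)
    have yz: "y \<noteq> z" using matchings_neq[OF insert.prems, of y z] e by simp
    have "insert e B - {{y, z}} = B" using insert.hyps e by blast
    hence B: "B \<in> matchings (V - {y, z})"
      using matchings_remove[OF insert.prems, of y z] e by simp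
    hence notin: "y \<notin> \<Union>B" "z \<notin> \<Union>B" using matchings_Union[OF B] by blast+
    show ?case
    proof (cases "B = {}")
      case True
      thus ?thesis using ham_single[OF yz] e by auto
    next
      case False
      then obtain f where f: "f \<in> B" by blast
      hence "f \<noteq> {}" using matchings_card[OF B f] by auto
      then obtain a where a: "a \<in> \<Union>B" using f by blast
      obtain M where "M \<in> ham B" using insert.IH[OF B] by blast
      from ins_ham[OF this notin yz a] show ?thesis using e by blast
    qed
  qed
qed

section \<open>Transport of matchings along injective maps\<close>

lemma image_matchings_subset:
  assumes f: "inj_on f V" and R: "R \<in> matchings V"
  shows "(`) f ` R \<in> matchings (f ` V)"
proof -
  have sub: "e \<subseteq> V" if "e \<in> R" for e
    using that R matchings_Union by blast
  have "pairwise disjnt ((`) f ` R)"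
  proof (rule pairwiseI)
    fix u v assume "u \<in> (`) f ` R" "v \<in> (`) f ` R" "u \<noteq> v"
    then obtain e g where eg: "e \<in> R" "g \<in> R" "u = f ` e" "v = f ` g" "e \<noteq> g" by blast
    hence "e \<inter> g = {}" using matchings_disjoint[OF R] by blast
    hence "f ` e \<inter> f ` g = {}"
      using inj_on_image_Int[OF f sub[OF eg(1)] sub[OF eg(2)]] by simp
    thus "disjnt u v" using eg by (simp add: disjnt_def)
  qed
  moreover have "card (f ` e) = 2" if "e \<in> R" for e
    using that card_image[OF inj_on_subset[OF f sub]] matchings_card[OF R] by simp
  moreover have "\<Union>((`) f ` R) = f ` V"
    using matchings_Union[OF R] by blast
  moreover have "{} \<notin> (`) f ` R"
    using matchings_card[OF R] by fastforce
  ultimately show ?thesis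
    by (simp add: matchings_def partition_on_def)
qed

lemma image_image_cancel:
  assumes "\<And>v. v \<in> V \<Longrightarrow> g (f v) = v" "\<Union>R \<subseteq> V"
  shows "(`) g ` (`) f ` R = R"
proof -
  have "g ` f ` e = e" if "e \<in> R" for e
  proof -
    have "g ` f ` e = (\<lambda>v. v) ` e"
      unfolding image_image using assms that by (intro image_cong) blast+
    thus ?thesis by simp
  qed
  hence "(\<lambda>e. g ` f ` e) ` R = (\<lambda>e. e) ` R" by (intro image_cong) auto
  moreover have "(`) g ` (`) f ` R = (\<lambda>e. g ` f ` e) ` R" by (rule image_image)
  ultimately show ?thesis by simp
qed

lemma image_matchings:
  assumes f: "inj_on f V"
  shows "(`) ((`) f) ` matchings V = matchings (f ` V)"
proof -
  define g where "g = inv_into V f"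
  have gf: "g (f v) = v" if "v \<in> V" for v using f that by (simp add: g_def)
  have g: "inj_on g (f ` V)" unfolding g_def by (rule inj_on_inv_into) simp
  have fg: "f (g w) = w" if "w \<in> f ` V" for w using gf that by auto
  have gV: "g ` f ` V = V" using gf by force
  have "R \<in> (`) ((`) f) ` matchings V" if "R \<in> matchings (f ` V)" for R
  proof -
    have "(`) g ` R \<in> matchings V" using image_matchings_subset[OF g that] gV by simp
    moreover have "(`) f ` (`) g ` R = R"
      using image_image_cancel[of "f ` V" f g R] fg matchings_Union[OF that] by simp
    ultimately show ?thesis by (metis imageI)
  qed
  thus ?thesis using image_matchings_subset[OF f] by blast
qed

lemma image_ham_subset:
  assumes f: "inj_on f (\<Union>B)" and M: "M \<in> ham B"
  shows "(`) f ` M \<in> ham ((`) f ` B)"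
proof (rule hamI)
  have U: "f ` \<Union>B = \<Union>((`) f ` B)" by blast
  thus "(`) f ` M \<in> matchings (\<Union>((`) f ` B))"
    using image_matchings_subset[OF f ham_matchings[OF M]] by simp
  fix S assume S: "S \<subseteq> (`) f ` B" "S \<noteq> {}"
    and cl: "\<And>e. e \<in> (`) f ` M \<Longrightarrow> e \<inter> \<Union>S \<noteq> {} \<Longrightarrow> e \<subseteq> \<Union>S"
  define S' where "S' = {b\<in>B. f ` b \<in> S}"
  have SS': "S = (`) f ` S'" using S by (auto simp: S'_def)
  have "S' = B"
  proof (rule ham_irreducible[OF M])
    show "S' \<subseteq> B" unfolding S'_def by blast
    show "S' \<noteq> {}" using S(2) unfolding SS' by blast
    fix e assume e: "e \<in> M" "e \<inter> \<Union>S' \<noteq> {}"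
    have "f ` e \<inter> \<Union>S \<noteq> {}" using e SS' by blast
    hence "f ` e \<subseteq> \<Union>S" using cl e by blast
    hence "f ` e \<subseteq> f ` \<Union>S'" using SS' by blast
    moreover have "e \<subseteq> \<Union>B" using e matchings_Union[OF ham_matchings[OF M]] by blast
    ultimately show "e \<subseteq> \<Union>S'"
      using inj_on_image_subset_iff[OF f, of e "\<Union>S'"] S'_def by blast
  qed
  thus "S = (`) f ` B" using SS' by simp
qed

lemma image_ham:
  assumes f: "inj_on f (\<Union>B)"
  shows "(`) ((`) f) ` ham B = ham ((`) f ` B)"
proof -
  define g where "g = inv_into (\<Union>B) f"
  have U: "f ` \<Union>B = \<Union>((`) f ` B)" by blast
  have gf: "g (f v) = v" if "v \<in> \<Union>B" for v using f that unfolding g_def by (rule inv_into_f_f)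
  have g: "inj_on g (\<Union>((`) f ` B))" unfolding g_def U[symmetric] by (rule inj_on_inv_into) simp
  have fg: "f (g w) = w" if "w \<in> \<Union>((`) f ` B)" for w 
  proof -
    from that have "w \<in> f ` \<Union>B" by (simp only: U)
    then obtain v where "w = f v" "v \<in> \<Union>B" by (rule imageE)
    thus ?thesis using gf by simp
  qed
  have gB: "(`) g ` (`) f ` B = B"
    using image_image_cancel[of "\<Union>B" g f B] gf by simp
  have "R \<in> (`) ((`) f) ` ham B" if "R \<in> ham ((`) f ` B)" for R
  proof -
    have "(`) g ` R \<in> ham B" using image_ham_subset[OF g that] unfolding gB .
    moreover have "(`) f ` (`) g ` R = R"
      using image_image_cancel[of "\<Union>((`) f ` B)" f g R] fg matchings_Union[OF ham_matchings[OF that]] by simp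
    ultimately show ?thesis by (metis imageI)
  qed
  thus ?thesis using image_ham_subset[OF f] by blast
qed

section \<open>Coupling under conditioning on a pair\<close>

text \<open>For \<open>B = {}\<close> the Hamiltonian part is the empty matching, so the
  configuration model is included.\<close>

definition rand :: "'v set \<Rightarrow> 'v set set \<Rightarrow> 'v set set pmf" where
  "rand U B = map_pmf (\<lambda>(Q, M). Q \<union> M) (pair_pmf (pmf_of_set (matchings U)) (pmf_of_set (ham B)))"

lemma inj_on_image_image:
  assumes "inj_on f V"
  shows "inj_on ((`) ((`) f)) {R. \<Union>R \<subseteq> V}"
proof (rule inj_onI)
  fix R R' assume *: "R \<in> {R. \<Union>R \<subseteq> V}" "R' \<in> {R. \<Union>R \<subseteq> V}" "(`) f ` R = (`) f ` R'"
  have "(`) (inv_into V f) ` (`) f ` X = X" if "\<Union>X \<subseteq> V" for X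
    using that assms by (intro image_image_cancel[where V = V]) auto
  thus "R = R'" using * by (metis mem_Collect_eq)
qed

lemma map_pmf_rand:
  assumes f: "inj_on f (U \<union> \<Union>B)" and fin: "finite U" "finite (\<Union>B)"
    and ne: "matchings U \<noteq> {}" "ham B \<noteq> {}"
  shows "map_pmf ((`) ((`) f)) (rand U B) = rand (f ` U) ((`) f ` B)"
proof -
  have 1: "map_pmf ((`) ((`) f)) (pmf_of_set (matchings U)) = pmf_of_set (matchings (f ` U))"
  proof -
    have fU: "inj_on f U" using f by (rule inj_on_subset) auto
    have "matchings U \<subseteq> {R. \<Union>R \<subseteq> U}"
      using matchings_Union by blast
    from map_pmf_of_set_inj[OF inj_on_subset[OF inj_on_image_image[OF fU] this] ne(1)] show ?thesis
      using fin by (simp only: image_matchings[OF fU] finite_matchings)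
  qed
  have 2: "map_pmf ((`) ((`) f)) (pmf_of_set (ham B)) = pmf_of_set (ham ((`) f ` B))"
  proof -
    have fU: "inj_on f (\<Union>B)" using f by (rule inj_on_subset) auto
    have "ham B \<subseteq> {R. \<Union>R \<subseteq> \<Union>B}"
      using ham_matchings matchings_Union by blast
    from map_pmf_of_set_inj[OF inj_on_subset[OF inj_on_image_image[OF fU] this] ne(2)] show ?thesis
      using fin by (simp only: image_ham[OF fU] finite_ham)
  qed
  show ?thesis
    unfolding rand_def 1[symmetric] 2[symmetric] map_pair[symmetric]
    by (simp only: map_pmf_comp case_prod_unfold image_Un fst_conv snd_conv)
qed

lemma pair_pmf_of_set:
  fixes A :: "'a set" and C :: "'b set"
  assumes "finite A" "finite C" "A \<noteq> {}" "C \<noteq> {}"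
  shows "pair_pmf (pmf_of_set A) (pmf_of_set C) = pmf_of_set (A \<times> C)" (is "?l = ?r")
proof (rule pmf_eqI)
  fix w :: "'a \<times> 'b"
  obtain u v where w: "w = (u, v)" by (cases w)
  have "A \<times> C \<noteq> {}" "finite (A \<times> C)" using assms by (simp_all only: Times_empty finite_cartesian_product, simp)
  hence "pmf (pmf_of_set (A \<times> C)) w = indicator (A \<times> C) w / card (A \<times> C)"
    by (rule pmf_of_set)
  also have "\<dots> = pmf (pair_pmf (pmf_of_set A) (pmf_of_set C)) w"
    unfolding w pmf_pair pmf_of_set[OF assms(3,1)] pmf_of_set[OF assms(4,2)]
    by (simp add: card_cartesian_product indicator_times)
  finally show "pmf (pair_pmf (pmf_of_set A) (pmf_of_set C)) w = pmf (pmf_of_set (A \<times> C)) w" ..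
qed

lemma set_pmf_rand:
  assumes "finite U" "finite (\<Union>B)" "matchings U \<noteq> {}" "ham B \<noteq> {}"
  shows "set_pmf (rand U B) = (\<lambda>(Q, M). Q \<union> M) ` (matchings U \<times> ham B)"
  unfolding rand_def set_map_pmf set_pair_pmf
  by (simp only: set_pmf_of_set[OF assms(3) finite_matchings[OF assms(1)]]
      set_pmf_of_set[OF assms(4) finite_ham[OF assms(2)]])

text \<open>
  Both distributions are realised on one space, \<open>p\<close> as the pairing itself and \<open>p'\<close> as the rest of
  the pairing after conditioning on the pair \<open>e\<close>; the two pairings differ only near \<open>Z\<close> and at one
  uniformly random element of \<open>C\<close>.
\<close>

definition coupled :: "'v set \<Rightarrow> 'v set \<Rightarrow> nat \<Rightarrow> 'v set \<Rightarrow> 'v set set pmf \<Rightarrow> 'v set set pmf \<Rightarrow> bool" where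
  "coupled Z C c e p p' \<longleftrightarrow> finite C \<and> card C = c \<and> c > 0 \<and>
     (\<exists>(D :: ('v set set \<times> 'v set set) pmf) F G a0. a0 \<in> C \<and>
       p = bind_pmf D (\<lambda>\<omega>. map_pmf (F \<omega>) (pmf_of_set C)) \<and> p' = map_pmf G D \<and>
       (\<forall>\<omega>\<in>set_pmf D. F \<omega> a0 = insert e (G \<omega>) \<and> (\<forall>a\<in>C. (e \<in> F \<omega> a \<longrightarrow> a = a0) \<and>
         (\<forall>g\<in>F \<omega> a. g \<notin> insert e (G \<omega>) \<longrightarrow> g \<inter> Z \<noteq> {}) \<and>
         (\<forall>g\<in>G \<omega>. g \<notin> F \<omega> a \<longrightarrow> a \<in> g \<or> g \<inter> Z \<noteq> {}))))"

text \<open>Among the \<open>c\<close> equally likely values of \<open>a\<close> only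
  \<open>a0\<close> produces the pair \<open>e\<close>, whatever \<open>\<omega>\<close> is. So
  \<open>e\<close> has probability 1 / c, and given \<open>e\<close> the rest of the pairing has law
  \<open>p'\<close>: the conditioning is exact.\<close>

lemma coupled_prob:
  fixes p p' :: "'v set set pmf"
  assumes "coupled Z C c e p p'"
  shows "measure_pmf.prob p {R. e \<in> R \<and> R \<in> S} = 1 / real c * measure_pmf.prob p' {R. insert e R \<in> S}"
proof -
  from assms obtain D :: "('v set set \<times> 'v set set) pmf" and F G a0
    where C: "finite C" "card C = c" "c > 0" and a0: "a0 \<in> C"
    and p: "p = bind_pmf D (\<lambda>\<omega>. map_pmf (F \<omega>) (pmf_of_set C))" and p': "p' = map_pmf G D"
    and all: "\<forall>\<omega>\<in>set_pmf D. F \<omega> a0 = insert e (G \<omega>) \<and> (\<forall>a\<in>C. (e \<in> F \<omega> a \<longrightarrow> a = a0) \<and>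
         (\<forall>g\<in>F \<omega> a. g \<notin> insert e (G \<omega>) \<longrightarrow> g \<inter> Z \<noteq> {}) \<and>
         (\<forall>g\<in>G \<omega>. g \<notin> F \<omega> a \<longrightarrow> a \<in> g \<or> g \<inter> Z \<noteq> {}))"
    unfolding coupled_def by (elim conjE exE)
  have *: "\<And>\<omega>. \<omega> \<in> set_pmf D \<Longrightarrow> F \<omega> a0 = insert e (G \<omega>)"
      "\<And>\<omega> a. \<omega> \<in> set_pmf D \<Longrightarrow> a \<in> C \<Longrightarrow> e \<in> F \<omega> a \<Longrightarrow> a = a0"
    using all by blast+
  have "measure_pmf.prob p {R. e \<in> R \<and> R \<in> S} =
      measure_pmf.expectation D (\<lambda>\<omega>. measure_pmf.prob (pmf_of_set C) {a. e \<in> F \<omega> a \<and> F \<omega> a \<in> S})"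
    by (simp add: p prob_bind_pmf[of D] measure_map_pmf vimage_def)
  also have "\<dots> = measure_pmf.expectation D (\<lambda>\<omega>. 1 / real c * indicator {\<omega>. insert e (G \<omega>) \<in> S} \<omega>)"
  proof (intro integral_cong_AE AE_pmfI)
    fix \<omega> assume \<omega>: "\<omega> \<in> set_pmf D"
    have CI: "C \<inter> {a. e \<in> F \<omega> a \<and> F \<omega> a \<in> S} = (if insert e (G \<omega>) \<in> S then {a0} else {})"
    proof -
      note F0 = *(1)[OF \<omega>]
      have "a \<in> C \<inter> {a. e \<in> F \<omega> a \<and> F \<omega> a \<in> S} \<longleftrightarrow> a = a0 \<and> insert e (G \<omega>) \<in> S" for a
      proof
        assume a: "a \<in> C \<inter> {a. e \<in> F \<omega> a \<and> F \<omega> a \<in> S}"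
        hence "a = a0" using *(2)[OF \<omega>, of a] by (simp only: Int_iff mem_Collect_eq)
        thus "a = a0 \<and> insert e (G \<omega>) \<in> S" using a F0 by simp
      next
        assume "a = a0 \<and> insert e (G \<omega>) \<in> S"
        thus "a \<in> C \<inter> {a. e \<in> F \<omega> a \<and> F \<omega> a \<in> S}" using a0 F0 by simp
      qed
      hence "C \<inter> {a. e \<in> F \<omega> a \<and> F \<omega> a \<in> S} = {a. a = a0 \<and> insert e (G \<omega>) \<in> S}"
        by (intro set_eqI) (simp only: mem_Collect_eq)
      thus ?thesis by simp
    qed
    show "measure_pmf.prob (pmf_of_set C) {a. e \<in> F \<omega> a \<and> F \<omega> a \<in> S} =
        1 / real c * indicator {\<omega>. insert e (G \<omega>) \<in> S} \<omega>"
    proof -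
      have "C \<noteq> {}" using a0 by blast
      from measure_pmf_of_set[OF this C(1)] show ?thesis
        using C CI by (cases "insert e (G \<omega>) \<in> S") simp_all
    qed
  qed auto
  also have "\<dots> = 1 / real c * measure_pmf.prob p' {R. insert e R \<in> S}"
    by (simp add: p' measure_map_pmf vimage_def)
  finally show ?thesis .
qed

text \<open>Here \<open>x\<close> is matched with the random point \<open>a\<close>, and
  \<open>y\<close> inherits the former partner of \<open>a\<close>; the value \<open>a0 = y\<close>
  leaves the matching of \<open>U\<close> intact.\<close>

lemma coupled_P:
  fixes U :: "'v set"
  assumes fin: "finite U" "finite (\<Union>B)" and ne: "matchings U \<noteq> {}" "ham B \<noteq> {}"
    and xy: "x \<notin> U" "y \<notin> U" "x \<noteq> y" "x \<notin> \<Union>B"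
  shows "coupled {x, y} (insert y U) (card U + 1) {x, y} (rand (insert x (insert y U)) B) (rand U B)"
proof -
  define D where "D = pair_pmf (pmf_of_set (matchings U)) (pmf_of_set (ham B))"
  define F where "F = (\<lambda>\<omega> a. ins x y (fst \<omega>) a \<union> (snd \<omega> :: 'v set set))"
  define G where "G = (\<lambda>\<omega>::'v set set \<times> 'v set set. fst \<omega> \<union> snd \<omega>)"
  have setD: "set_pmf D = matchings U \<times> ham B"
    unfolding D_def set_pair_pmf
    by (simp only: set_pmf_of_set[OF ne(1) finite_matchings[OF fin(1)]] set_pmf_of_set[OF ne(2) finite_ham[OF fin(2)]])
  have "pmf_of_set (matchings (insert x (insert y U))) =
      map_pmf (\<lambda>(R, a). ins x y R a) (pair_pmf (pmf_of_set (matchings U)) (pmf_of_set (insert y U)))"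
    using fin ne bij_betw_ins[of x U y] xy
    by (subst pair_pmf_of_set; (subst map_pmf_of_set_bij_betw)?) auto
  hence p: "rand (insert x (insert y U)) B = bind_pmf D (\<lambda>\<omega>. map_pmf (F \<omega>) (pmf_of_set (insert y U)))"
    unfolding rand_def D_def F_def
    by (simp add: pair_pmf_def map_pmf_def bind_assoc_pmf bind_return_pmf)
       (subst bind_commute_pmf, simp)
  have 1: "a = y" if "\<omega> \<in> set_pmf D" "a \<in> insert y U" and e: "{x, y} \<in> F \<omega> a" for \<omega> a
  proof -
    obtain Q M where \<omega>: "\<omega> = (Q, M)" "Q \<in> matchings U" "M \<in> ham B"
      using \<open>\<omega> \<in> set_pmf D\<close> unfolding setD by (rule SigmaE)
    have "{x, y} \<notin> M" using xy matchings_Union[OF ham_matchings[OF \<omega>(3)]] by blast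
    hence "{x, y} \<in> ins x y Q a" using e \<omega> by (simp add: F_def)
    from mate_eq[OF ins_matchings[OF \<omega>(2) xy(1-3) that(2)] this]
    show "a = y" using mate_ins[OF \<omega>(2) xy(1-3) that(2)] by simp
  qed
  have 2: "F \<omega> y = insert {x, y} (G \<omega>)" for \<omega>
    by (simp add: F_def G_def ins_def)
  have 3: "g \<in> F \<omega> a \<Longrightarrow> g \<notin> insert {x, y} (G \<omega>) \<Longrightarrow> g \<inter> {x, y} \<noteq> {}" for g \<omega> a
    by (auto simp: F_def G_def ins_def split: if_splits)
  have 4: "g \<in> G \<omega> \<Longrightarrow> g \<notin> F \<omega> a \<Longrightarrow> a \<in> g" for g \<omega> a
    by (auto simp: F_def G_def ins_def split: if_splits)
  have all: "\<forall>\<omega>\<in>set_pmf D. F \<omega> y = insert {x, y} (G \<omega>) \<and>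
      (\<forall>a\<in>insert y U. ({x, y} \<in> F \<omega> a \<longrightarrow> a = y) \<and>
         (\<forall>g\<in>F \<omega> a. g \<notin> insert {x, y} (G \<omega>) \<longrightarrow> g \<inter> {x, y} \<noteq> {}) \<and>
         (\<forall>g\<in>G \<omega>. g \<notin> F \<omega> a \<longrightarrow> a \<in> g \<or> g \<inter> {x, y} \<noteq> {}))"
    by (intro ballI conjI impI; (rule 2)?; (rule 1; assumption)?; (rule 3; assumption)?) (rule disjI1, rule 4; assumption)
  have "rand U B = map_pmf G D"
    by (simp add: rand_def D_def G_def case_prod_unfold)
  moreover have "card (insert y U) = card U + 1" using fin xy by simp
  ultimately show ?thesis
    unfolding coupled_def using p all fin
    by (intro conjI exI[of _ D] exI[of _ F] exI[of _ G] exI[of _ y]) simp_all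
qed

lemma rename_pairing:
  assumes M: "M \<in> matchings V" and x: "x \<in> V" and z: "z \<notin> V"
  shows "(`) (id(x := z)) ` M = insert {z, mate M x} (M - {{x, mate M x}})"
proof -
  have m: "{x, mate M x} \<in> M" "mate M x \<noteq> x" using mate_in[OF M x] mate_neq[OF M x] by auto
  have other: "id(x := z) ` e = e" if "e \<in> M - {{x, mate M x}}" for e
  proof -
    have "x \<notin> e" using matchings_disjoint[OF M _ m(1), of e x] that by blast
    thus ?thesis by (auto simp: image_iff)
  qed
  have "M = insert {x, mate M x} (M - {{x, mate M x}})" using m by blast
  hence "(`) (id(x := z)) ` M = insert (id(x := z) ` {x, mate M x}) ((`) (id(x := z)) ` (M - {{x, mate M x}}))"
    by (metis image_insert)
  also have "id(x := z) ` {x, mate M x} = {z, mate M x}" using m by auto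
  also have "(`) (id(x := z)) ` (M - {{x, mate M x}}) = M - {{x, mate M x}}"
    using other by force
  finally show ?thesis .
qed

text \<open>Contracting the vertex \<open>{y, z}\<close> leaves a Hamiltonian matching on
  \<open>B\<close>, and reinserting it at \<open>a = x\<close> matches \<open>y\<close> with
  \<open>x\<close> and \<open>z\<close> with the former partner of \<open>x\<close>. So given the
  pair \<open>{x, y}\<close>, the rest is the contracted matching with \<open>x\<close> renamed to
  \<open>z\<close>: the two vertices joined by the pair have become one, whose half-edges are
  \<open>z\<close> and the other element of the vertex of \<open>x\<close>.\<close>

lemma coupled_H:
  fixes U :: "'v set"
  assumes fin: "finite U" "finite (\<Union>B)" and ne: "matchings U \<noteq> {}" "ham B \<noteq> {}"
    and yz: "y \<notin> \<Union>B" "z \<notin> \<Union>B" "y \<noteq> z" and x: "x \<in> \<Union>B" "x \<notin> U"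
  shows "coupled {x, y, z} (\<Union>B) (card (\<Union>B)) {x, y} (rand U (insert {y, z} B)) (rand U ((`) (id(x := z)) ` B))"
proof -
  have B: "B \<noteq> {}" using x by blast
  define D where "D = pair_pmf (pmf_of_set (matchings U)) (pmf_of_set (ham B))"
  define F where "F = (\<lambda>\<omega> a. fst \<omega> \<union> ins y z (snd \<omega>) a)"
  define G where "G = (\<lambda>\<omega>::'v set set \<times> 'v set set. fst \<omega> \<union> (`) (id(x := z)) ` snd \<omega>)"
  have setD: "set_pmf D = matchings U \<times> ham B"
    unfolding D_def set_pair_pmf
    by (simp only: set_pmf_of_set[OF ne(1) finite_matchings[OF fin(1)]] set_pmf_of_set[OF ne(2) finite_ham[OF fin(2)]])
  have neB: "\<Union>B \<noteq> {}" using x by blast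
  have "pmf_of_set (ham (insert {y, z} B)) =
      map_pmf (\<lambda>(R, a). ins y z R a) (pair_pmf (pmf_of_set (ham B)) (pmf_of_set (\<Union>B)))"
    unfolding pair_pmf_of_set[OF finite_ham[OF fin(2)] fin(2) ne(2) neB]
    using fin ne neB by (intro map_pmf_of_set_bij_betw[symmetric] bij_betw_ins_ham yz B) (auto simp: finite_ham)
  hence p: "rand U (insert {y, z} B) = bind_pmf D (\<lambda>\<omega>. map_pmf (F \<omega>) (pmf_of_set (\<Union>B)))"
    unfolding rand_def D_def F_def
    by (simp add: pair_pmf_def map_pmf_def bind_assoc_pmf bind_return_pmf)
  have "inj_on (id(x := z)) (\<Union>B)"
    by (rule inj_onI) (use yz in \<open>metis fun_upd_apply id_apply\<close>)
  hence "pmf_of_set (ham ((`) (id(x := z)) ` B)) = map_pmf ((`) ((`) (id(x := z)))) (pmf_of_set (ham B))"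
  proof -
    assume inj: "inj_on (id(x := z)) (\<Union>B)"
    have "ham B \<subseteq> {R. \<Union>R \<subseteq> \<Union>B}"
      using ham_matchings matchings_Union by blast
    from map_pmf_of_set_inj[OF inj_on_subset[OF inj_on_image_image[OF inj] this] ne(2)] show ?thesis
      using fin by (simp only: image_ham[OF inj] finite_ham)
  qed
  hence p': "rand U ((`) (id(x := z)) ` B) = map_pmf G D"
    by (simp add: rand_def D_def G_def pair_map_pmf2 map_pmf_comp case_prod_unfold)
  have "F \<omega> x = insert {x, y} (G \<omega>) \<and> (\<forall>a\<in>\<Union>B. ({x, y} \<in> F \<omega> a \<longrightarrow> a = x) \<and>
         (\<forall>g\<in>F \<omega> a. g \<notin> insert {x, y} (G \<omega>) \<longrightarrow> g \<inter> {x, y, z} \<noteq> {}) \<and>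
         (\<forall>g\<in>G \<omega>. g \<notin> F \<omega> a \<longrightarrow> a \<in> g \<or> g \<inter> {x, y, z} \<noteq> {}))" if \<omega>: "\<omega> \<in> set_pmf D" for \<omega>
  proof -
    obtain Q M where \<omega>: "\<omega> = (Q, M)" "Q \<in> matchings U" "M \<in> ham B"
      using \<omega> unfolding setD by (rule SigmaE)
    note M = ham_matchings[OF \<omega>(3)]
    have ren: "G \<omega> = Q \<union> insert {z, mate M x} (M - {{x, mate M x}})"
      using rename_pairing[OF M x(1) yz(2)] by (simp add: G_def \<omega>)
    have xz: "x \<noteq> z" using x yz by blast
    show ?thesis
    proof (intro conjI ballI impI)
      show "F \<omega> x = insert {x, y} (G \<omega>)"
        unfolding ren using xz by (auto simp: F_def ins_def \<omega> insert_commute)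
    next
      fix a assume a: "a \<in> \<Union>B" and e: "{x, y} \<in> F \<omega> a"
      have a': "a \<in> insert z (\<Union>B)" using a by blast
      have "{x, y} \<notin> Q" using x matchings_Union[OF \<omega>(2)] by blast
      hence "{y, x} \<in> ins y z M a" using e by (simp add: F_def \<omega> insert_commute)
      from mate_eq[OF ins_matchings[OF M yz a'] this]
      show "a = x" using mate_ins[OF M yz a'] by simp
    next
      fix a g assume "a \<in> \<Union>B" and g: "g \<in> F \<omega> a" "g \<notin> insert {x, y} (G \<omega>)"
      have "a \<noteq> z" using yz \<open>a \<in> \<Union>B\<close> by blast
      hence "g \<in> Q \<or> g = {y, a} \<or> g = {z, mate M a} \<or> g \<in> M"
        using g(1) by (auto simp: F_def ins_def \<omega>)
      thus "g \<inter> {x, y, z} \<noteq> {}" using g(2) unfolding ren by blast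
    next
      fix a g assume "a \<in> \<Union>B" and g: "g \<in> G \<omega>" "g \<notin> F \<omega> a"
      have "a \<noteq> z" using yz \<open>a \<in> \<Union>B\<close> by blast
      hence F: "F \<omega> a = Q \<union> insert {y, a} (insert {z, mate M a} (M - {{a, mate M a}}))"
        by (simp add: F_def ins_def \<omega>)
      show "a \<in> g \<or> g \<inter> {x, y, z} \<noteq> {}"
        using g unfolding ren F by blast
    qed
  qed
  thus ?thesis
    unfolding coupled_def using fin x neB p p'
    by (intro conjI exI[of _ D] exI[of _ F] exI[of _ G] exI[of _ x]) (simp_all add: card_gt_0_iff)
qed

type_synonym step = "prevertex \<times> prevertex"

section \<open>Walks\<close>

definition edges :: "step list \<Rightarrow> pairing" where
  "edges p = (\<lambda>(x, y). {x, y}) ` set p"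

definition ends :: "step list \<Rightarrow> prevertex list" where
  "ends p = concat (map (\<lambda>(x, y). [x, y]) p)"

text \<open>A step is a pair traversed from its first to its second prevertex. Between two steps the
  walk stays in a bin but changes the prevertex, which leaves d - 1 continuations.\<close>

definition chain :: "step list \<Rightarrow> bool" where
  "chain = successively (\<lambda>s t. fst (snd s) = fst (fst t) \<and> snd s \<noteq> fst t)"

lemma edges_Nil [simp]: "edges [] = {}"
  and edges_Cons [simp]: "edges (s # p) = insert {fst s, snd s} (edges p)"
  and edges_append [simp]: "edges (p @ q) = edges p \<union> edges q"
  by (auto simp: edges_def case_prod_unfold)

lemma ends_Nil [simp]: "ends [] = []"
  and ends_Cons [simp]: "ends (s # p) = fst s # snd s # ends p"
  and ends_append [simp]: "ends (p @ q) = ends p @ ends q"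
  by (simp_all add: ends_def case_prod_unfold)

lemma Union_edges: "\<Union>(edges p) = set (ends p)"
  by (induction p) auto

lemma set_ends: "set (ends p) = fst ` set p \<union> snd ` set p"
  by (induction p) auto

lemma chain_Nil [simp]: "chain []"
  and chain_single [simp]: "chain [s]"
  and chain_Cons: "chain (s # p) \<longleftrightarrow> p = [] \<or> (fst (snd s) = fst (fst (hd p)) \<and> snd s \<noteq> fst (hd p)) \<and> chain p"
  and chain_append: "chain (p @ q) \<longleftrightarrow> chain p \<and> chain q \<and>
    (p = [] \<or> q = [] \<or> (fst (snd (last p)) = fst (fst (hd q)) \<and> snd (last p) \<noteq> fst (hd q)))"
  by (auto simp: chain_def successively_Cons successively_append_iff)

lemma finite_edges [simp]: "finite (edges p)"
  by (simp add: edges_def)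

lemma edges_in_ends: "e \<in> edges p \<Longrightarrow> e \<subseteq> set (ends p)"
  using Union_edges by blast

lemma card_edges: "distinct (ends p) \<Longrightarrow> card (edges p) = length p"
proof (induction p)
  case (Cons s p)
  have "{fst s, snd s} \<notin> edges p"
    using Cons.prems edges_in_ends[of "{fst s, snd s}" p] by auto
  thus ?case using Cons by simp
qed simp

text \<open>Distinct endpoints mean that no pair is used twice, so that each step of the walk costs
  a separate factor in \<open>prob_edges\<close>.\<close>

definition hit :: "pairing \<Rightarrow> nat set \<Rightarrow> nat \<Rightarrow> prevertex \<Rightarrow> bool" where
  "hit R T M z \<longleftrightarrow> (\<exists>p. p \<noteq> [] \<and> length p \<le> M \<and> fst (hd p) = z \<and> chain p \<and> distinct (ends p) \<and>
     fst (snd (last p)) \<in> T \<and> edges p \<subseteq> R)"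

lemma hit_mono: "hit R T M z \<Longrightarrow> T \<subseteq> T' \<Longrightarrow> M \<le> M' \<Longrightarrow> hit R T' M' z"
  unfolding hit_def by (elim exE, rename_tac p, rule_tac x = p in exI) auto

text \<open>Distinctness is dropped here, so that removing the first step leaves a walk of the same
  kind and sums can be bounded recursively.\<close>

definition walks :: "prevertex set \<Rightarrow> nat set \<Rightarrow> nat \<Rightarrow> prevertex \<Rightarrow> step list set" where
  "walks V T m z = {p. p \<noteq> [] \<and> length p = m \<and> fst (hd p) = z \<and> chain p \<and> set p \<subseteq> V \<times> V \<and> fst (snd (last p)) \<in> T}"

lemma finite_walks:
  assumes "finite V"
  shows "finite (walks V T m z)"
proof (rule finite_subset)
  show "walks V T m z \<subseteq> {p. set p \<subseteq> V \<times> V \<and> length p = m}"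
    by (auto simp: walks_def)
  show "finite {p. set p \<subseteq> V \<times> V \<and> length p = m}"
    using assms by (intro finite_lists_length_eq) auto
qed

definition weight :: "(prevertex \<Rightarrow> prevertex \<Rightarrow> real) \<Rightarrow> step list \<Rightarrow> real" where
  "weight w p = prod_list (map (\<lambda>s. w (fst s) (snd s)) p)"

lemma weight_Nil [simp]: "weight w [] = 1"
  and weight_Cons [simp]: "weight w (s # p) = w (fst s) (snd s) * weight w p"
  by (simp_all add: weight_def)

lemma weight_nonneg: "(\<And>x y. w x y \<ge> 0) \<Longrightarrow> weight w p \<ge> 0"
  by (induction p) auto

lemma sum_UN_le:
  fixes f :: "'b \<Rightarrow> real"
  assumes "finite A" "\<And>a. a \<in> A \<Longrightarrow> finite (S a)" "\<And>x. f x \<ge> 0"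
  shows "sum f (\<Union>a\<in>A. S a) \<le> (\<Sum>a\<in>A. sum f (S a))"
  using assms(1,2)
proof (induction A rule: finite_induct)
  case (insert a A)
  have "sum f (\<Union>a\<in>insert a A. S a) \<le> sum f (S a) + sum f (\<Union>a\<in>A. S a)"
    using insert sum.union_inter[of "S a" "\<Union>a\<in>A. S a" f] sum_nonneg[of "S a \<inter> (\<Union>a\<in>A. S a)" f] assms(3)
    by simp
  thus ?case using insert by simp
qed simp

text \<open>A walk has \<open>d - 1\<close> choices at each intermediate bin; the last step costs \<open>t\<close>.\<close>

lemma walk_sum:
  fixes w :: "prevertex \<Rightarrow> prevertex \<Rightarrow> real"
  assumes V: "V = {..<n} \<times> {..<d}" and d: "d \<ge> 1" and w0: "\<And>x y. w x y \<ge> 0" and \<rho>: "\<rho> \<ge> 0" "t \<ge> 0"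
    and row: "\<And>z. (\<Sum>y\<in>V. w z y) \<le> \<rho>"
    and last: "\<And>z. (\<Sum>y\<in>{y\<in>V. fst y \<in> T}. w z y) \<le> \<rho> * t"
  shows "(\<Sum>p\<in>walks V T (Suc m) z. weight w p) \<le> \<rho> ^ Suc m * real (d - 1) ^ m * t"
proof (induction m arbitrary: z)
  case 0
  have fV: "finite V" by (simp add: V)
  have "walks V T (Suc 0) z \<subseteq> (\<lambda>y. [(z, y)]) ` {y\<in>V. fst y \<in> T}"
  proof
    fix p assume p: "p \<in> walks V T (Suc 0) z"
    then obtain s where s: "p = [s]" by (auto simp: walks_def length_Suc_conv)
    hence "p = [(z, snd s)]" "snd s \<in> V" "fst (snd s) \<in> T" using p by (auto simp: walks_def)
    thus "p \<in> (\<lambda>y. [(z, y)]) ` {y\<in>V. fst y \<in> T}" by blast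
  qed
  hence "(\<Sum>p\<in>walks V T (Suc 0) z. weight w p) \<le> (\<Sum>p\<in>(\<lambda>y. [(z, y)]) ` {y\<in>V. fst y \<in> T}. weight w p)"
    using w0 fV by (intro sum_mono2) (auto intro: weight_nonneg)
  also have "\<dots> = (\<Sum>y\<in>{y\<in>V. fst y \<in> T}. w z y)"
    by (subst sum.reindex) (auto simp: inj_on_def)
  finally show ?case using last[of z] by simp
next
  case (Suc m)
  have fV: "finite V" by (simp add: V)
  define N where "N y = {x\<in>V. fst x = fst y \<and> x \<noteq> y}" for y :: prevertex
  have fN: "finite (N y)" for y using fV by (simp add: N_def)
  have cN: "card (N y) \<le> d - 1" if "y \<in> V" for y
  proof -
    have "N y \<subseteq> {fst y} \<times> ({..<d} - {snd y})"
    proof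
      fix x assume "x \<in> N y"
      hence "fst x = fst y" "snd x < d" "x \<noteq> y" by (auto simp: N_def V)
      thus "x \<in> {fst y} \<times> ({..<d} - {snd y})" by (cases x; cases y) auto
    qed
    hence "card (N y) \<le> card ({fst y} \<times> ({..<d} - {snd y}))"
      by (intro card_mono) auto
    also have "\<dots> = d - 1" using that by (auto simp: V)
    finally show ?thesis .
  qed
  define B where "B = \<rho> ^ Suc m * real (d - 1) ^ m * t"
  have B0: "B \<ge> 0" using \<rho> by (simp add: B_def)
  \<comment> \<open>Decomposition by the far end \<open>y\<close> of the first step and the
    prevertex \<open>x\<close> through which the walk leaves the bin of \<open>y\<close>.\<close>
  have "walks V T (Suc (Suc m)) z \<subseteq> (\<Union>y\<in>V. \<Union>x\<in>N y. (#) (z, y) ` walks V T (Suc m) x)"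
  proof
    fix p assume p: "p \<in> walks V T (Suc (Suc m)) z"
    then obtain s t q where s: "p = s # t # q" by (auto simp: walks_def length_Suc_conv)
    have s': "s = (z, snd s)" using p s by (cases s) (auto simp: walks_def)
    have "snd s \<in> V" "fst t \<in> N (snd s)" "t # q \<in> walks V T (Suc m) (fst t)"
      using p s by (auto simp: walks_def chain_Cons N_def)
    thus "p \<in> (\<Union>y\<in>V. \<Union>x\<in>N y. (#) (z, y) ` walks V T (Suc m) x)"
      using s s' by blast
  qed
  hence "(\<Sum>p\<in>walks V T (Suc (Suc m)) z. weight w p) \<le>
      (\<Sum>p\<in>(\<Union>y\<in>V. \<Union>x\<in>N y. (#) (z, y) ` walks V T (Suc m) x). weight w p)"
    using fV fN by (intro sum_mono2 weight_nonneg w0) (auto intro!: finite_walks)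
  also have "\<dots> \<le> (\<Sum>y\<in>V. sum (weight w) (\<Union>x\<in>N y. (#) (z, y) ` walks V T (Suc m) x))"
    using fV fN by (intro sum_UN_le weight_nonneg w0) (auto intro!: finite_walks)
  also have "\<dots> \<le> (\<Sum>y\<in>V. w z y * (real (d - 1) * B))"
  proof (rule sum_mono)
    fix y assume y: "y \<in> V"
    have "sum (weight w) (\<Union>x\<in>N y. (#) (z, y) ` walks V T (Suc m) x) \<le>
        (\<Sum>x\<in>N y. sum (weight w) ((#) (z, y) ` walks V T (Suc m) x))"
      using fV fN by (intro sum_UN_le weight_nonneg w0) (auto intro!: finite_walks)
    also have "\<dots> = (\<Sum>x\<in>N y. w z y * (\<Sum>p\<in>walks V T (Suc m) x. weight w p))"
      by (intro sum.cong refl, subst sum.reindex) (auto simp: inj_on_def sum_distrib_left)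
    also have "\<dots> \<le> (\<Sum>x\<in>N y. w z y * B)"
      using Suc.IH w0 by (intro sum_mono mult_left_mono) (auto simp: B_def)
    also have "\<dots> = real (card (N y)) * (w z y * B)" by simp
    also have "\<dots> \<le> real (d - 1) * (w z y * B)"
      using cN[OF y] w0 B0 by (intro mult_right_mono) auto
    finally show "sum (weight w) (\<Union>x\<in>N y. (#) (z, y) ` walks V T (Suc m) x) \<le> w z y * (real (d - 1) * B)"
      by (simp add: algebra_simps)
  qed
  also have "\<dots> = (\<Sum>y\<in>V. w z y) * (real (d - 1) * B)"
    by (simp add: sum_distrib_right)
  also have "\<dots> \<le> \<rho> * (real (d - 1) * B)"
    using row[of z] B0 by (intro mult_right_mono) auto
  finally show ?case by (simp add: B_def algebra_simps)
qed

section \<open>Random pairings with prescribed types\<close>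

text \<open>The value \<open>h = 0\<close> belongs to the configuration model and
  \<open>h = 2\<close> to the tilted one; \<open>\<tau> v\<close> selects the prevertices of bin
  \<open>v\<close> on the Hamiltonian cycle. The lower bound on n gives r c \<le> 1 for the
  \<open>c\<close> below, so that r conditionings inflate a probability by at most (1 + c)^r \<le>
  3.\<close>

locale types =
  fixes n d h r :: nat and \<tau> :: "nat \<Rightarrow> nat set"
  assumes h: "h = 0 \<or> h = 2" and d: "d \<ge> 3" and r: "r \<ge> 1" and even_nd: "even (n * d)"
    and \<tau>: "\<And>v. v < n \<Longrightarrow> \<tau> v \<subseteq> {..<d} \<and> card (\<tau> v) = h"
    and n_large: "real n \<ge> 10 * (real r)\<^sup>2"
begin

definition V where "V = {..<n} \<times> {..<d}"
definition H0 where "H0 = Sigma {..<n} \<tau>"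
definition U0 where "U0 = V - H0"
definition B0 where "B0 = (if h = 0 then {} else (\<lambda>v. {v} \<times> \<tau> v) ` {..<n})"
definition N where "N = n * (d - h)"
text \<open>Relative change of the probability of a pair after up to 2r conditionings, in which at
  most 4r of at least n candidates disappear.\<close>

definition c where "c = 10 * real r / real n"

text \<open>The state after conditioning on \<open>j\<close> pairs. The blocks in \<open>B\<close>
  need not be bins any more, since contraction mixes prevertices of different bins; only their
  number is tracked. Parity of \<open>U\<close> and the matching property of \<open>B\<close>
  guarantee that there are matchings to choose from.\<close>

definition inv :: "nat \<Rightarrow> prevertex set \<Rightarrow> prevertex set set \<Rightarrow> bool" where
  "inv j U B \<longleftrightarrow> U \<subseteq> U0 \<and> \<Union>B \<subseteq> H0 \<and> B \<in> matchings (\<Union>B) \<and> even (card U) \<and> N \<le> card U + 2 * j \<and>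
     (h = 2 \<longrightarrow> n \<le> card B + j)"

lemma r_sq: "r\<^sup>2 * 10 \<le> n"
proof -
  have "real (r\<^sup>2 * 10) \<le> real n" using n_large by simp
  thus ?thesis by (simp only: of_nat_le_iff)
qed

lemma n_ge: "n \<ge> 10 * r"
proof -
  have "r * 1 \<le> r * r" using r by (intro mult_left_mono) auto
  hence "10 * r \<le> r * r * 10" by simp
  thus ?thesis using r_sq by (simp only: power2_eq_square)
qed

lemma n_pos: "n > 0" using n_ge r by linarith

lemma finite_V [simp]: "finite V"
  by (simp add: V_def)

lemma H0_subset: "H0 \<subseteq> V"
proof
  fix x assume "x \<in> H0"
  then obtain v j where "x = (v, j)" "v < n" "j \<in> \<tau> v" by (auto simp: H0_def)
  thus "x \<in> V" using \<tau>[of v] by (auto simp: V_def)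
qed

lemma finite_H0 [simp]: "finite H0" and finite_U0 [simp]: "finite U0"
proof -
  show "finite H0" by (rule finite_subset[OF H0_subset finite_V])
  show "finite U0" unfolding U0_def using finite_V by (rule finite_Diff)
qed

lemma finite_\<tau>: "v < n \<Longrightarrow> finite (\<tau> v)"
  using \<tau>[of v] finite_subset by blast

lemma card_H0: "card H0 = n * h"
  using \<tau> finite_\<tau> by (simp add: H0_def)

lemma h_less: "h < d" using h d by auto

lemma card_U0: "card U0 = N"
proof -
  have "card U0 = card V - card H0"
    unfolding U0_def using finite_H0 H0_subset by (rule card_Diff_subset)
  thus ?thesis by (simp add: card_H0 V_def N_def diff_mult_distrib2)
qed

lemma N_ge: "N \<ge> n"
proof -
  have "n * 1 \<le> n * (d - h)" using h_less by (intro mult_left_mono) auto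
  thus ?thesis by (simp add: N_def)
qed

lemma B0_empty: "h = 0 \<Longrightarrow> B0 = {}"
  unfolding B0_def by simp

lemma B0_image: "h \<noteq> 0 \<Longrightarrow> B0 = (\<lambda>v. {v} \<times> \<tau> v) ` {..<n}"
  unfolding B0_def by simp

lemma \<tau>_nonempty: "v < n \<Longrightarrow> h \<noteq> 0 \<Longrightarrow> \<tau> v \<noteq> {}"
  using \<tau>[of v] by (metis card.empty)

lemma Union_B0: "\<Union>B0 = H0"
proof (cases "h = 0")
  case True
  hence "card H0 = 0" using card_H0 by simp
  hence "H0 = {}" by simp
  thus ?thesis by (simp only: B0_empty[OF True] Union_empty)
next
  case False
  show ?thesis unfolding B0_image[OF False] H0_def by blast
qed

lemma B0_matching: "B0 \<in> matchings (\<Union>B0)"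
proof (cases "h = 0")
  case True
  show ?thesis by (simp only: B0_empty[OF True] Union_empty matchings_empty singletonI)
next
  case False
  hence h2: "h = 2" using h by simp
  have "disjoint B0"
  proof (rule pairwiseI)
    fix u v assume "u \<in> B0" "v \<in> B0" "u \<noteq> v"
    then obtain a b where "u = {a} \<times> \<tau> a" "v = {b} \<times> \<tau> b" "a \<noteq> b"
      unfolding B0_image[OF False] by blast
    thus "disjnt u v" by (auto simp: disjnt_def)
  qed
  moreover have "card e = 2" if e: "e \<in> B0" for e
  proof -
    obtain v where "v < n" "e = {v} \<times> \<tau> v" using e unfolding B0_image[OF False] by blast
    thus ?thesis using \<tau>[of v] h2 by (simp add: card_cartesian_product)
  qed
  moreover from this have "{} \<notin> B0" by force
  ultimately show ?thesis by (simp add: matchings_def partition_on_def)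
qed

lemma card_B0: "h = 2 \<Longrightarrow> card B0 = n"
proof -
  assume h2: "h = 2"
  hence h0: "h \<noteq> 0" by simp
  have "inj_on (\<lambda>v. {v} \<times> \<tau> v) {..<n}"
  proof (rule inj_onI)
    fix u v assume *: "u \<in> {..<n}" "v \<in> {..<n}" "{u} \<times> \<tau> u = {v} \<times> \<tau> v"
    have "\<tau> u \<noteq> {}" using \<tau>_nonempty[of u] * h0 by simp
    thus "u = v" using *(3) by blast
  qed
  thus ?thesis unfolding B0_image[OF h0] by (simp add: card_image)
qed

lemma inv_start: "inv 0 U0 B0"
proof -
  have "even N"
    using even_nd h by (auto simp: N_def)
  thus ?thesis
    using B0_matching card_B0 by (simp add: inv_def card_U0 Union_B0)
qed

lemma inv_finite: "inv j U B \<Longrightarrow> finite U \<and> finite (\<Union>B) \<and> finite B"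
proof -
  assume "inv j U B"
  hence 1: "U \<subseteq> U0" "\<Union>B \<subseteq> H0" by (simp_all add: inv_def)
  have "finite (\<Union>B)" by (rule finite_subset[OF 1(2) finite_H0])
  moreover have "finite U" by (rule finite_subset[OF 1(1) finite_U0])
  ultimately show ?thesis using finite_UnionD[of B] by simp
qed

lemma inv_matching: "inv j U B \<Longrightarrow> B \<in> matchings (\<Union>B)"
  by (simp add: inv_def)

lemma inv_nonempty:
  assumes "inv j U B"
  shows "matchings U \<noteq> {}" "ham B \<noteq> {}"
  using assms inv_finite[OF assms] matchings_nonempty[of U] ham_nonempty[of "\<Union>B" B]
  by (simp_all add: inv_def)

lemma inv_subset: "inv j U B \<Longrightarrow> U \<subseteq> U0" "inv j U B \<Longrightarrow> \<Union>B \<subseteq> H0"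
  by (simp_all add: inv_def)

lemma inv_disjoint: "inv j U B \<Longrightarrow> x \<in> U \<Longrightarrow> x \<notin> \<Union>B"
  using inv_subset[of j U B] unfolding U0_def by fast

lemma inv_card_B: "inv j U B \<Longrightarrow> card (\<Union>B) = 2 * card B"
  using matchings_even[OF inv_matching] inv_finite by blast

lemma step_P:
  assumes inv: "inv j U B" and xy: "x \<in> U" "y \<in> U" "x \<noteq> y"
  shows "coupled {x, y} (U - {x}) (card U - 1) {x, y} (rand U B) (rand (U - {x, y}) B)"
    and "inv (Suc j) (U - {x, y}) B"
proof -
  note fin = inv_finite[OF inv]
  have c2: "card (U - {x, y}) = card U - 2" using xy fin by (simp add: card_Diff_subset)
  have "card {x, y} \<le> card U" using xy fin by (intro card_mono) auto
  hence c3: "card U \<ge> 2" using xy by simp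
  show inv': "inv (Suc j) (U - {x, y}) B"
    using inv c2 c3 by (auto simp: inv_def)
  have U: "insert x (insert y (U - {x, y})) = U" "insert y (U - {x, y}) = U - {x}" "insert x (U - {x}) = U" using xy by blast+
  have "coupled {x, y} (insert y (U - {x, y})) (card (U - {x, y}) + 1) {x, y}
      (rand (insert x (insert y (U - {x, y}))) B) (rand (U - {x, y}) B)"
    using fin xy inv_disjoint[OF inv, of x] inv_nonempty[OF inv'] inv_nonempty[OF inv]
    by (intro coupled_P) simp_all
  moreover have "card (U - {x, y}) + 1 = card U - 1" using c2 c3 by simp
  ultimately show "coupled {x, y} (U - {x}) (card U - 1) {x, y} (rand U B) (rand (U - {x, y}) B)"
    by (simp only: U)
qed

text \<open>As \<open>B\<close> is a matching of its own union, \<open>mate B x\<close> is the other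
  element of the block of \<open>x\<close>. The condition \<open>x \<noteq> z\<close> excludes the
  pair that is itself a block.\<close>

lemma step_H:
  assumes inv: "inv j U B" and yz: "{y, z} \<in> B" and x: "x \<in> \<Union>B" "x \<noteq> y" "x \<noteq> z"
  defines "B' \<equiv> (`) (id(x := z)) ` (B - {{y, z}})"
  shows "coupled {x, y, z} (\<Union>(B - {{y, z}})) (2 * (card B - 1)) {x, y} (rand U B) (rand U B')"
    and "inv (Suc j) U B'" and "\<Union>B' = \<Union>B - {x, y}" and "B' = insert {z, mate B x} (B - {{y, z}} - {{x, mate B x}})"
proof -
  note fin = inv_finite[OF inv]
  note M = inv_matching[OF inv]
  define B1 where "B1 = B - {{y, z}}"
  have M1: "B1 \<in> matchings (\<Union>B - {y, z})" unfolding B1_def by (rule matchings_remove[OF M yz])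
  have U1: "\<Union>B1 = \<Union>B - {y, z}" using matchings_Union[OF M1] .
  have yz': "y \<noteq> z" using matchings_neq[OF M yz] .
  have x1: "x \<in> \<Union>B1" using x U1 by simp
  have B: "B = insert {y, z} B1" using yz by (auto simp: B1_def)
  have M1': "B1 \<in> matchings (\<Union>B1)" using M1 U1 by simp
  have inj: "inj_on (id(x := z)) (\<Union>B1)"
    by (rule inj_onI) (auto simp: U1 split: if_splits)
  have B'm: "B' \<in> matchings (id(x := z) ` \<Union>B1)"
    unfolding B'_def B1_def[symmetric] by (rule image_matchings_subset[OF inj M1'])
  have img: "id(x := z) ` \<Union>B1 = \<Union>B - {x, y}"
  proof -
    have "id(x := z) ` \<Union>B1 = insert z (\<Union>B1 - {x})" using x1 by auto
    also have "\<dots> = \<Union>B - {x, y}" unfolding U1 using x yz' yz by auto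
    finally show ?thesis .
  qed
  show UB': "\<Union>B' = \<Union>B - {x, y}" using matchings_Union[OF B'm] img by simp
  have card1: "card B1 = card B - 1" using yz fin by (simp add: B1_def)
  have cB: "card B \<ge> 1" using yz fin by (metis One_nat_def Suc_leI card_gt_0_iff empty_iff)
  have "inj_on ((`) (id(x := z))) B1"
    by (rule inj_on_subset[OF inj_on_image_Pow[OF inj]]) blast
  from card_image[OF this] have cB': "card B' = card B - 1"
    unfolding B'_def B1_def[symmetric] card1 .
  show "inv (Suc j) U B'"
  proof -
    have "B' \<in> matchings (\<Union>B')" using B'm img UB' by simp
    moreover have "\<Union>B' \<subseteq> H0" using inv_subset[OF inv] UB' by blast
    moreover have "h = 2 \<longrightarrow> n \<le> card B' + Suc j" using inv cB' cB by (simp add: inv_def)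
    ultimately show ?thesis using inv by (simp add: inv_def)
  qed
  have cU: "card (\<Union>B1) = 2 * (card B - 1)"
    using matchings_even[OF M1'] fin card1 U1 by simp
  have "coupled {x, y, z} (\<Union>B1) (card (\<Union>B1)) {x, y} (rand U (insert {y, z} B1)) (rand U ((`) (id(x := z)) ` B1))"
  proof (rule coupled_H)
    show "ham B1 \<noteq> {}" using ham_nonempty[OF _ M1'] fin U1 by simp
    show "x \<notin> U" using inv_disjoint[OF inv, of x] x by blast
  qed (use fin inv_nonempty[OF inv] U1 yz' x1 in auto)
  thus "coupled {x, y, z} (\<Union>(B - {{y, z}})) (2 * (card B - 1)) {x, y} (rand U B) (rand U B')"
    unfolding cU unfolding B[symmetric] B'_def[symmetric] by (simp only: B1_def B'_def)
  have m: "mate B1 x = mate B x"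
  proof -
    have "{x, mate B1 x} \<in> B" using mate_in[OF M1' x1] B by blast
    from mate_eq[OF M this] show ?thesis by simp
  qed
  have "z \<notin> \<Union>B1" using U1 by simp
  from rename_pairing[OF M1' x1 this] show "B' = insert {z, mate B x} (B - {{y, z}} - {{x, mate B x}})"
    unfolding m unfolding B'_def B1_def .
qed

text \<open>Upper bound for the probability of a pair after up to 2r conditionings: a prevertex of
  \<open>U0\<close> has about N candidates for its partner and one of \<open>H0\<close> about 2n.
  Pairs of mixed type cannot occur.\<close>

definition wt :: "prevertex \<Rightarrow> prevertex \<Rightarrow> real" where
  "wt x y = (if x \<in> U0 \<and> y \<in> U0 then (1 + c) / real N
     else if x \<in> H0 \<and> y \<in> H0 then (1 + c) / (2 * real n) else 0)"

lemma c_nonneg: "c \<ge> 0" by (simp add: c_def)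

lemma wt_nonneg: "wt x y \<ge> 0"
  using c_nonneg by (simp add: wt_def)

text \<open>Here M is the initial number of candidates and K what remains; 4r + 1 allows for two
  lost in each of 2r steps and for the prevertex itself. As M \<ge> 10 \<open>r\<^sup>2\<close>
  \<ge> 8r + 2, at least half of them remain, and c K \<ge> 5r covers the loss.\<close>

lemma inflate:
  assumes "real n \<le> M" "M - (4 * real r + 1) \<le> K"
  shows "K > 0" "1 / K \<le> (1 + c) / M"
proof -
  have r1: "real r \<ge> 1" using r by simp
  have n0: "real n > 0" using n_pos by simp
  have "10 * (real r)\<^sup>2 \<ge> 8 * real r + 2"
  proof -
    have "real r * 1 \<le> real r * real r" using r1 by (intro mult_left_mono) auto
    thus ?thesis using r1 unfolding power2_eq_square by linarith
  qed
  hence big: "M \<ge> 8 * real r + 2" using n_large assms(1) by linarith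
  hence K2: "K \<ge> M / 2" using assms(2) by linarith
  thus K: "K > 0" using big r1 by linarith
  have M0: "M > 0" using n0 assms by linarith
  have "c * K \<ge> (10 * real r / M) * (M / 2)"
  proof (intro mult_mono)
    show "10 * real r / M \<le> c" unfolding c_def using assms(1) n0 r1 by (intro divide_left_mono) auto
  qed (use K2 M0 c_nonneg K in auto)
  also have "(10 * real r / M) * (M / 2) = 5 * real r" using M0 by simp
  finally have "c * K \<ge> 4 * real r + 1" using r1 by linarith
  hence "M \<le> (1 + c) * K" using assms(2) by (simp add: algebra_simps)
  thus "1 / K \<le> (1 + c) / M" using K M0 by (simp add: field_simps)
qed

lemma weight_P:
  assumes "inv j U B" "j \<le> 2 * r"
  shows "1 / real (card U - 1) \<le> (1 + c) / real N" "1 / real (card U - 1) \<ge> 1 / real N" "card U \<ge> 2"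
proof -
  have U: "card U \<le> N" "N \<le> card U + 2 * j"
    using assms card_mono[OF finite_U0, of U] by (auto simp: inv_def card_U0)
  have nN: "real n \<le> real N" using N_ge by simp
  have 1: "real N - (4 * real r + 1) \<le> real (card U) - 1" using U assms(2) by linarith
  from inflate(1)[OF nN 1] have c1: "card U > 1" by linarith
  thus "card U \<ge> 2" by simp
  have eq: "real (card U - 1) = real (card U) - 1" using c1 by simp
  show "1 / real (card U - 1) \<le> (1 + c) / real N" unfolding eq by (rule inflate(2)[OF nN 1])
  show "1 / real (card U - 1) \<ge> 1 / real N" unfolding eq using U c1 by (intro divide_left_mono) auto
qed

lemma weight_H:
  assumes "inv j U B" "j \<le> 2 * r" "h = 2"
  shows "1 / real (2 * (card B - 1)) \<le> (1 + c) / (2 * real n)"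
    "1 / real (2 * (card B - 1)) \<ge> 1 / (2 * real n)" "card B \<ge> 2"
proof -
  have "card (\<Union>B) \<le> card H0" using card_mono[OF finite_H0 inv_subset(2)[OF assms(1)]] .
  hence "2 * card B \<le> n * 2" unfolding card_H0 inv_card_B[OF assms(1)] assms(3) .
  moreover have "n \<le> card B + j" using assms(1,3) unfolding inv_def by blast
  ultimately have B: "card B \<le> n" "n \<le> card B + j" by simp_all
  have nN: "real n \<le> 2 * real n" by simp
  have 2: "real n - (4 * real r + 1) \<le> real (card B) - 1"
    using B assms(2) by linarith
  from inflate(1)[OF order_refl 2] have c1: "card B > 1" by linarith
  thus "card B \<ge> 2" by simp
  have eq: "real (2 * (card B - 1)) = 2 * (real (card B) - 1)" using c1 by simp
  \<comment> \<open>There are twice as many half-edges as blocks, so \<open>inflate\<close> is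
    applied to the number of blocks and the result is halved.\<close>
  have "1 / (2 * (real (card B) - 1)) \<le> (1 + c) / (2 * real n)"
    using inflate(2)[OF order_refl 2] c1 n_pos by (simp add: field_simps)
  thus "1 / real (2 * (card B - 1)) \<le> (1 + c) / (2 * real n)" unfolding eq .
  show "1 / real (2 * (card B - 1)) \<ge> 1 / (2 * real n)" unfolding eq using B c1 by (intro divide_left_mono) auto
qed

end

section \<open>Probability of short walks\<close>

lemma ham_avoids_bin:
  assumes M: "M \<in> ham B" and e: "e \<in> B" and B: "card B \<ge> 2"
  shows "e \<notin> M"
proof
  assume eM: "e \<in> M"
  have "{e} = B"
  proof (rule ham_irreducible[OF M])
    fix g assume g: "g \<in> M" "g \<inter> \<Union>{e} \<noteq> {}"
    then obtain v where "v \<in> g" "v \<in> e" by blast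
    from matchings_disjoint[OF ham_matchings[OF M] g(1) eM this] show "g \<subseteq> \<Union>{e}" by simp
  qed (use e in auto)
  hence "card B = 1" by auto
  thus False using B by simp
qed

lemma geometric_le:
  assumes "D \<ge> (2::real)"
  shows "(\<Sum>m<Suc M. D ^ m) \<le> 2 * D ^ M"
proof (induction M)
  case (Suc M)
  have "2 * D ^ M \<le> D * D ^ M" using assms by (intro mult_right_mono) auto
  thus ?case using Suc by simp
qed simp

lemma prob_UN_le:
  assumes "finite A"
  shows "measure_pmf.prob p (\<Union>a\<in>A. S a) \<le> (\<Sum>a\<in>A. measure_pmf.prob p (S a))"
  using assms by (intro measure_pmf.finite_measure_subadditive_finite) auto

lemma prob_mono_support:
  assumes "\<And>x. x \<in> set_pmf p \<Longrightarrow> x \<in> A \<Longrightarrow> x \<in> B"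
  shows "measure_pmf.prob p A \<le> measure_pmf.prob p B"
  by (intro measure_pmf.finite_measure_mono_AE AE_pmfI) (use assms in auto)

lemma prob_zero_support:
  assumes "\<And>x. x \<in> set_pmf p \<Longrightarrow> x \<notin> A"
  shows "measure_pmf.prob p A = 0"
  using assms by (subst measure_pmf_zero_iff) auto

context types
begin

lemma inv_support:
  assumes inv: "inv j U B" and R: "R \<in> set_pmf (rand U B)"
  obtains Q M where "Q \<in> matchings U" "M \<in> ham B" "R = Q \<union> M"
proof -
  have "R \<in> (\<lambda>(Q, M). Q \<union> M) ` (matchings U \<times> ham B)"
    using R inv_nonempty[OF inv] inv_finite[OF inv] by (subst (asm) set_pmf_rand) auto
  thus ?thesis using that by blast
qed

lemma inv_support_Union:
  assumes inv: "inv j U B" and R: "R \<in> set_pmf (rand U B)"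
  shows "\<Union>R = U \<union> \<Union>B"
proof -
  obtain Q M where "Q \<in> matchings U" "M \<in> ham B" "R = Q \<union> M"
    using inv_support[OF inv R] .
  thus ?thesis using matchings_Union[of Q U] matchings_Union[OF ham_matchings[of M B]] by simp
qed

lemma inv_support_pair:
  assumes inv: "inv j U B" and R: "R \<in> set_pmf (rand U B)" and e: "{x, y} \<in> R"
  shows "(x \<in> U \<and> y \<in> U) \<or> (x \<in> \<Union>B \<and> y \<in> \<Union>B \<and> ({x, y} \<in> B \<longrightarrow> card B < 2))"
proof -
  obtain Q M where QM: "Q \<in> matchings U" "M \<in> ham B" "R = Q \<union> M"
    using inv_support[OF inv R] .
  from e QM(3) consider "{x, y} \<in> Q" | "{x, y} \<in> M" by blast
  thus ?thesis
  proof cases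
    case 1
    thus ?thesis using matchings_mem[OF QM(1)] by simp
  next
    case 2
    have "\<not> card B \<ge> 2" if "{x, y} \<in> B" using ham_avoids_bin[OF QM(2) that] 2 by auto
    thus ?thesis using matchings_mem[OF ham_matchings[OF QM(2)] 2] by (simp add: not_le)
  qed
qed

lemma inv_h: "inv j U B \<Longrightarrow> x \<in> \<Union>B \<Longrightarrow> h = 2"
proof -
  assume *: "inv j U B" "x \<in> \<Union>B"
  have "x \<in> H0" using inv_subset(2)[OF *(1)] *(2) by (rule subsetD)
  hence "card H0 \<noteq> 0" using finite_H0 by (metis card_0_eq empty_iff)
  hence "h \<noteq> 0" unfolding card_H0 by simp
  thus "h = 2" using h by simp
qed

text \<open>One conditioning step in either part. The lower bound on 1 / k holds since the number of
  candidates never exceeds its initial value; together with the upper bound it later pins the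
  probability of a whole cycle from both sides.\<close>

lemma pair_step:
  assumes inv: "inv j U B" and j: "j \<le> 2 * r" and xy: "x \<noteq> y"
    and cases: "(x \<in> U \<and> y \<in> U) \<or> (x \<in> \<Union>B \<and> y \<in> \<Union>B \<and> {x, y} \<notin> B)"
  obtains Z C k U' B' where "coupled Z C k {x, y} (rand U B) (rand U' B')" "inv (Suc j) U' B'"
    "1 / real k \<le> wt x y" "1 / real k \<ge> wt x y / (1 + c)"
    "U' \<union> \<Union>B' = U \<union> \<Union>B - {x, y}" "C \<subseteq> U \<union> \<Union>B" "Z \<subseteq> {x, y, mate B y}"
    "if x \<in> U \<and> y \<in> U then U' = U - {x, y} \<and> B' = B \<and> Z = {x, y} else U' = U \<and>
        B' = insert {mate B y, mate B x} (B - {{y, mate B y}} - {{x, mate B x}})"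
proof -
  have c0: "1 + c > 0" using c_nonneg by linarith
  show ?thesis
  proof (cases "x \<in> U \<and> y \<in> U")
    case True
    hence U0: "x \<in> U0" "y \<in> U0" using inv_subset(1)[OF inv] by auto
    note w = weight_P[OF inv j]
    have "x \<notin> \<Union>B" "y \<notin> \<Union>B" using True inv_disjoint[OF inv] by auto
    hence "U - {x, y} \<union> \<Union>B = U \<union> \<Union>B - {x, y}" by fast
    thus ?thesis
      using that[of "{x, y}" "U - {x}" "card U - 1" "U - {x, y}" B] step_P[OF inv _ _ xy] True U0 w c0
      by (auto simp: wt_def)
  next
    case False
    hence B: "x \<in> \<Union>B" "y \<in> \<Union>B" "{x, y} \<notin> B" using cases by auto
    hence h2: "h = 2" using inv_h[OF inv] by blast
    have H0: "x \<in> H0" "y \<in> H0" using inv_subset(2)[OF inv] B by auto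
    hence U0: "x \<notin> U0" by (simp add: U0_def)
    define z where "z = mate B y"
    note M = inv_matching[OF inv]
    have yz: "{y, z} \<in> B" unfolding z_def using mate_in[OF M B(2)] .
    have xz: "x \<noteq> z" using yz B(3) by (auto simp: insert_commute)
    note S = step_H[OF inv yz B(1) xy xz]
    note w = weight_H[OF inv j h2]
    have wt: "wt x y = (1 + c) / (2 * real n)" using U0 H0 by (simp add: wt_def)
    have "x \<notin> U" "y \<notin> U" using B inv_disjoint[OF inv, of x] inv_disjoint[OF inv, of y] by blast+
    hence UB: "U \<union> (\<Union>B - {x, y}) = U \<union> \<Union>B - {x, y}" by fast
    show ?thesis
    proof (rule that[OF S(1,2)])
      show "1 / real (2 * (card B - 1)) \<le> wt x y" unfolding wt by (rule w(1))
      show "1 / real (2 * (card B - 1)) \<ge> wt x y / (1 + c)" unfolding wt using w(2) c0 by simp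
      show "U \<union> \<Union>((`) (id(x := z)) ` (B - {{y, z}})) = U \<union> \<Union>B - {x, y}" unfolding S(3) by (rule UB)
      show "\<Union>(B - {{y, z}}) \<subseteq> U \<union> \<Union>B" by blast
      show "{x, y, z} \<subseteq> {x, y, mate B y}" by (simp add: z_def)
      show "if x \<in> U \<and> y \<in> U then U = U - {x, y} \<and> (`) (id(x := z)) ` (B - {{y, z}}) = B \<and> {x, y, z} = {x, y}
        else U = U \<and> (`) (id(x := z)) ` (B - {{y, z}}) = insert {mate B y, mate B x} (B - {{y, mate B y}} - {{x, mate B x}})"
        using False S(4) by (simp only: z_def if_False simp_thms)
    qed
  qed
qed

text \<open>Conditioning on the pairs one by one. The budget is 2r since walks of at most r pairs
  are looked for after up to r pairs of \<alpha> have been fixed. A pair that is impossible in the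
  current state only makes the probability 0.\<close>

lemma prob_edges:
  assumes "inv j U B" "j + length p \<le> 2 * r" "distinct (ends p)"
  shows "measure_pmf.prob (rand U B) {R. edges p \<subseteq> R} \<le> weight wt p"
  using assms
proof (induction p arbitrary: j U B)
  case Nil
  thus ?case by simp
next
  case (Cons s p)
  define x y where "x = fst s" and "y = snd s"
  have j: "j \<le> 2 * r" using Cons.prems(2) by simp
  have xy: "x \<noteq> y" and e: "{x, y} \<notin> edges p" and dp: "distinct (ends p)"
    using Cons.prems(3) edges_in_ends[of "{x, y}" p] by (auto simp: x_def y_def)
  have big: "card B \<ge> 2" if "x \<in> \<Union>B"
    using weight_H(3)[OF Cons.prems(1) j inv_h[OF Cons.prems(1) that]] .
  show ?case
  proof (cases "(x \<in> U \<and> y \<in> U) \<or> (x \<in> \<Union>B \<and> y \<in> \<Union>B \<and> {x, y} \<notin> B)")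
    case False
    have "measure_pmf.prob (rand U B) {R. edges (s # p) \<subseteq> R} = 0"
    proof (rule prob_zero_support)
      fix R assume R: "R \<in> set_pmf (rand U B)"
      show "R \<notin> {R. edges (s # p) \<subseteq> R}"
      proof
        assume "R \<in> {R. edges (s # p) \<subseteq> R}"
        hence "{x, y} \<in> R" by (simp add: x_def y_def)
        from inv_support_pair[OF Cons.prems(1) R this] show False using False big by (metis not_less)
      qed
    qed
    thus ?thesis using weight_nonneg[OF wt_nonneg] by (simp only:)
  next
    case True
    obtain Z C k U' B' where S: "coupled Z C k {x, y} (rand U B) (rand U' B')" "inv (Suc j) U' B'" "1 / real k \<le> wt x y"
      using pair_step[OF Cons.prems(1) j xy True] by metis
    have "measure_pmf.prob (rand U B) {R. edges (s # p) \<subseteq> R} =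
        measure_pmf.prob (rand U B) {R. {x, y} \<in> R \<and> R \<in> {R. edges p \<subseteq> R}}"
      by (intro arg_cong[where f = "measure_pmf.prob (rand U B)"]) (simp add: x_def y_def)
    also have "\<dots> = 1 / real k * measure_pmf.prob (rand U' B') {R. insert {x, y} R \<in> {R. edges p \<subseteq> R}}"
      by (rule coupled_prob[OF S(1)])
    also have "{R. insert {x, y} R \<in> {R. edges p \<subseteq> R}} = {R. edges p \<subseteq> R}"
      using e by (simp add: subset_insert)
    also have "1 / real k * measure_pmf.prob (rand U' B') {R. edges p \<subseteq> R} \<le> wt x y * weight wt p"
    proof (intro mult_mono S(3))
      show "measure_pmf.prob (rand U' B') {R. edges p \<subseteq> R} \<le> weight wt p"
        using Cons.prems by (intro Cons.IH[OF S(2)] dp) simp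
    qed (auto simp: wt_nonneg)
    finally show ?thesis by (simp add: x_def y_def)
  qed
qed

lemma U0_Sigma: "U0 = Sigma {..<n} (\<lambda>v. {..<d} - \<tau> v)"
  by (auto simp: U0_def V_def H0_def)

lemma card_bins_U0: "finite T \<Longrightarrow> card {y \<in> U0. fst y \<in> T} \<le> card T * (d - h)"
proof -
  assume T: "finite T"
  have "{y \<in> U0. fst y \<in> T} = Sigma (T \<inter> {..<n}) (\<lambda>v. {..<d} - \<tau> v)"
    by (auto simp: U0_Sigma)
  hence "card {y \<in> U0. fst y \<in> T} = (\<Sum>v\<in>T \<inter> {..<n}. card ({..<d} - \<tau> v))"
    using T by simp
  also have "\<dots> = (\<Sum>v\<in>T \<inter> {..<n}. d - h)"
    using \<tau> finite_\<tau> by (intro sum.cong refl) (simp add: card_Diff_subset)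
  also have "\<dots> \<le> card T * (d - h)"
    using card_mono[OF T, of "T \<inter> {..<n}"] by simp
  finally show ?thesis .
qed

lemma card_bins_H0: "finite T \<Longrightarrow> card {y \<in> H0. fst y \<in> T} \<le> card T * h"
proof -
  assume T: "finite T"
  have "{y \<in> H0. fst y \<in> T} = Sigma (T \<inter> {..<n}) \<tau>"
    by (auto simp: H0_def)
  hence "card {y \<in> H0. fst y \<in> T} = (\<Sum>v\<in>T \<inter> {..<n}. card (\<tau> v))"
    using T finite_\<tau> by simp
  also have "\<dots> = (\<Sum>v\<in>T \<inter> {..<n}. h)"
    using \<tau> by (intro sum.cong refl) simp
  also have "\<dots> \<le> card T * h"
    using card_mono[OF T, of "T \<inter> {..<n}"] by simp
  finally show ?thesis .
qed

text \<open>A set of \<open>a\<close> bins holds the share a / n of both kinds of prevertices, so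
  arriving in it costs a / n whatever the type of the starting point.\<close>

lemma wt_sum:
  assumes "finite S" "S \<subseteq> V" "card (S \<inter> U0) \<le> a * (d - h)" "card (S \<inter> H0) \<le> a * h"
  shows "(\<Sum>y\<in>S. wt z y) \<le> (1 + c) * (real a / real n)"
proof -
  have n0: "real n > 0" using n_pos by simp
  have dh: "real (d - h) > 0" using h_less by simp
  have c0: "1 + c \<ge> 0" using c_nonneg by linarith
  have N: "real N = real n * real (d - h)" by (simp add: N_def)
  consider "z \<in> U0" | "z \<in> H0" "z \<notin> U0" | "z \<notin> U0" "z \<notin> H0" by blast
  thus ?thesis
  proof cases
    case 1
    hence zH: "z \<notin> H0" by (simp add: U0_def)
    have "(\<Sum>y\<in>S. wt z y) = (\<Sum>y\<in>S \<inter> U0. (1 + c) / real N)"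
      using assms(1) 1 zH by (simp add: wt_def sum.If_cases Int_def)
    also have "\<dots> = real (card (S \<inter> U0)) * ((1 + c) / real N)" by simp
    also have "\<dots> \<le> real (a * (d - h)) * ((1 + c) / real N)"
      using assms(3) c0 by (intro mult_right_mono) (auto simp del: of_nat_mult)
    also have "\<dots> = (1 + c) * (real a / real n)"
      using dh n0 by (simp add: N)
    finally show ?thesis .
  next
    case 2
    have "(\<Sum>y\<in>S. wt z y) = (\<Sum>y\<in>S \<inter> H0. (1 + c) / (2 * real n))"
      using assms(1) 2 by (simp add: wt_def sum.If_cases Int_def)
    also have "\<dots> = real (card (S \<inter> H0)) * ((1 + c) / (2 * real n))" by simp
    also have "\<dots> \<le> real (a * 2) * ((1 + c) / (2 * real n))"
    proof (intro mult_right_mono)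
      have "a * h \<le> a * 2" using h by auto
      thus "real (card (S \<inter> H0)) \<le> real (a * 2)" using assms(4) by linarith
    qed (use c0 n0 in auto)
    also have "\<dots> = (1 + c) * (real a / real n)" by simp
    finally show ?thesis .
  next
    case 3
    hence "(\<Sum>y\<in>S. wt z y) = 0" by (simp add: wt_def)
    thus ?thesis using c0 by simp
  qed
qed

lemma inflation_le: "m \<le> r \<Longrightarrow> (1 + c) ^ m \<le> 3"
proof -
  assume m: "m \<le> r"
  have "(1 + c) ^ m \<le> exp c ^ m"
    using c_nonneg exp_ge_add_one_self[of c] by (intro power_mono) auto
  also have "\<dots> = exp (real m * c)" by (simp add: exp_of_nat_mult)
  also have "real m * c \<le> real r * c" using m c_nonneg by (intro mult_right_mono) auto
  also have "real r * c \<le> 1"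
    using n_large n_pos by (simp add: c_def power2_eq_square field_simps)
  finally have "(1 + c) ^ m \<le> exp 1" by simp
  thus ?thesis using exp_le by linarith
qed

text \<open>Union bound over walks. The factor 6 is 3 from the inflation of at most r weights times
  2 from the geometric sum over the lengths.\<close>

lemma prob_hit:
  assumes inv: "inv j U B" and j: "j \<le> r" and M: "1 \<le> M" "M \<le> r" and T: "finite T"
  shows "measure_pmf.prob (rand U B) {R. hit R T M z} \<le> 6 * real (card T) * real (d - 1) ^ (M - 1) / real n"
proof -
  define t where "t = real (card T) / real n"
  have t0: "t \<ge> 0" by (simp add: t_def)
  have n0: "real n > 0" using n_pos by simp
  define W where "W m = {p \<in> walks V T (Suc m) z. distinct (ends p)}" for m
  have fW: "finite (W m)" for m unfolding W_def using finite_walks[OF finite_V] by simp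
  have "measure_pmf.prob (rand U B) {R. hit R T M z} \<le>
      measure_pmf.prob (rand U B) (\<Union>m\<in>{..<M}. \<Union>p\<in>W m. {R. edges p \<subseteq> R})"
  proof (rule prob_mono_support)
    fix R assume R: "R \<in> set_pmf (rand U B)" "R \<in> {R. hit R T M z}"
    then obtain p where p: "p \<noteq> []" "length p \<le> M" "fst (hd p) = z" "chain p" "distinct (ends p)"
      "fst (snd (last p)) \<in> T" "edges p \<subseteq> R"
      unfolding hit_def by blast
    have "set (ends p) \<subseteq> \<Union>R" using p(7) Union_edges[of p] by blast
    hence "set (ends p) \<subseteq> V"
      unfolding inv_support_Union[OF inv R(1)] using inv_subset[OF inv] H0_subset by (auto simp: U0_def)
    hence "set p \<subseteq> V \<times> V" unfolding set_ends subset_iff mem_Times_iff by blast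
    moreover obtain m where "length p = Suc m" "m < M" using p(1,2) by (cases p) auto
    ultimately have "p \<in> W m" "m \<in> {..<M}"
      using p by (simp_all add: W_def walks_def)
    thus "R \<in> (\<Union>m\<in>{..<M}. \<Union>p\<in>W m. {R. edges p \<subseteq> R})" using p(7) by blast
  qed
  also have "\<dots> \<le> (\<Sum>m<M. measure_pmf.prob (rand U B) (\<Union>p\<in>W m. {R. edges p \<subseteq> R}))"
    by (intro prob_UN_le) simp
  also have "\<dots> \<le> (\<Sum>m<M. 3 * real (d - 1) ^ m * t)"
  proof (intro sum_mono)
    fix m assume m: "m \<in> {..<M}"
    have "measure_pmf.prob (rand U B) (\<Union>p\<in>W m. {R. edges p \<subseteq> R}) \<le> (\<Sum>p\<in>W m. measure_pmf.prob (rand U B) {R. edges p \<subseteq> R})"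
      by (intro prob_UN_le fW)
    also have "\<dots> \<le> (\<Sum>p\<in>W m. weight wt p)"
      using m M j by (intro sum_mono prob_edges[OF inv]) (auto simp: W_def walks_def)
    also have "\<dots> \<le> (\<Sum>p\<in>walks V T (Suc m) z. weight wt p)"
      by (intro sum_mono2 finite_walks finite_V weight_nonneg wt_nonneg) (auto simp: W_def)
    also have "\<dots> \<le> (1 + c) ^ Suc m * real (d - 1) ^ m * t"
    proof (rule walk_sum)
      show "V = {..<n} \<times> {..<d}" by (simp add: V_def)
      show "(\<Sum>y\<in>V. wt z y) \<le> 1 + c" for z
      proof -
        have "V \<inter> U0 = U0" "V \<inter> H0 = H0" using H0_subset by (auto simp: U0_def)
        hence "(\<Sum>y\<in>V. wt z y) \<le> (1 + c) * (real n / real n)"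
          by (intro wt_sum) (simp_all add: card_U0 card_H0 N_def)
        thus ?thesis using n0 by simp
      qed
      show "(\<Sum>y\<in>{y\<in>V. fst y \<in> T}. wt z y) \<le> (1 + c) * t" for z
      proof -
        have "{y\<in>V. fst y \<in> T} \<inter> U0 = {y\<in>U0. fst y \<in> T}" "{y\<in>V. fst y \<in> T} \<inter> H0 = {y\<in>H0. fst y \<in> T}"
          using H0_subset by (auto simp: U0_def)
        thus ?thesis unfolding t_def
          using card_bins_U0[OF T] card_bins_H0[OF T] by (intro wt_sum) auto
      qed
    qed (use d c_nonneg wt_nonneg t0 in auto)
    also have "\<dots> \<le> 3 * real (d - 1) ^ m * t"
      using inflation_le[of "Suc m"] m M t0 by (intro mult_right_mono) auto
    finally show "measure_pmf.prob (rand U B) (\<Union>p\<in>W m. {R. edges p \<subseteq> R}) \<le> 3 * real (d - 1) ^ m * t" .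
  qed
  also have "\<dots> = 3 * t * (\<Sum>m<M. real (d - 1) ^ m)"
    by (simp add: sum_distrib_left algebra_simps)
  also have "\<dots> \<le> 3 * t * (2 * real (d - 1) ^ (M - 1))"
    using geometric_le[of "real (d - 1)" "M - 1"] d M t0 by (intro mult_left_mono) auto
  finally show ?thesis by (simp add: t_def)
qed

end

section \<open>Cycles as closed walks\<close>

text \<open>Repeating the first step at the end lets \<open>chain\<close> express that the walk
  closes up, arriving and departing through different prevertices of the first bin; this also covers
  loops and double edges.\<close>

definition cyc :: "nat \<Rightarrow> nat \<Rightarrow> step list \<Rightarrow> bool" where
  "cyc n d s \<longleftrightarrow> s \<noteq> [] \<and> chain (s @ [hd s]) \<and> distinct (map (\<lambda>t. fst (fst t)) s) \<and> distinct (ends s) \<and>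
     set (ends s) \<subseteq> {..<n} \<times> {..<d}"

definition bins :: "pairing \<Rightarrow> nat set" where
  "bins \<alpha> = fst ` \<Union>\<alpha>"

lemma cyc_chain: "cyc n d s \<Longrightarrow> chain s"
  by (auto simp: cyc_def chain_append)

lemma cyc_close: "cyc n d s \<Longrightarrow> fst (snd (last s)) = fst (fst (hd s)) \<and> snd (last s) \<noteq> fst (hd s)"
  by (auto simp: cyc_def chain_append)

lemma cyc_rotate:
  assumes "cyc n d (a @ b)"
  shows "cyc n d (b @ a)"
proof (cases "a = [] \<or> b = []")
  case True
  thus ?thesis using assms by auto
next
  case False
  thus ?thesis using assms by (auto simp: cyc_def chain_append)
qed

lemma edges_swap: "edges (rev (map prod.swap s)) = edges s"
  by (induction s) (simp_all add: insert_commute Un_commute)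

lemma ends_swap: "ends (rev (map prod.swap s)) = rev (ends s)"
  by (induction s) simp_all

lemma tl_bins:
  "chain (s @ [t]) \<Longrightarrow> s \<noteq> [] \<Longrightarrow> map (\<lambda>t. fst (snd t)) s = map (\<lambda>t. fst (fst t)) (tl s @ [t])"
proof (induction s)
  case (Cons u s)
  show ?case
  proof (cases s)
    case Nil
    thus ?thesis using Cons by (simp add: chain_Cons)
  next
    case (Cons v s')
    thus ?thesis using Cons.IH Cons.prems by (simp add: chain_Cons)
  qed
qed simp

lemma cyc_distinct_snd:
  assumes "cyc n d s"
  shows "distinct (map (\<lambda>t. fst (snd t)) s)"
proof -
  obtain t s' where s: "s = t # s'" using assms by (cases s) (auto simp: cyc_def)
  have "map (\<lambda>t. fst (snd t)) s = map (\<lambda>t. fst (fst t)) (tl s @ [hd s])"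
    using assms by (intro tl_bins) (auto simp: cyc_def)
  thus ?thesis using assms by (simp add: s cyc_def)
qed

lemma chain_swap: "chain (rev (map prod.swap s)) = chain s"
proof (induction s)
  case (Cons t s)
  show ?case
  proof (cases s)
    case (Cons u s')
    thus ?thesis using Cons.IH
      by (auto simp: chain_append chain_Cons)
  qed simp
qed simp

lemma cyc_reflect:
  assumes "cyc n d s"
  shows "cyc n d (rev (map prod.swap s))"
proof -
  have s: "s \<noteq> []" using assms by (simp add: cyc_def)
  have l: "last (rev (map prod.swap s)) = prod.swap (hd s)" "hd (rev (map prod.swap s)) = prod.swap (last s)"
    using s by (simp_all add: last_rev hd_rev hd_map last_map)
  have "chain (rev (map prod.swap s) @ [hd (rev (map prod.swap s))])"
    unfolding chain_append chain_swap l using cyc_chain[OF assms] cyc_close[OF assms] by auto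
  moreover have "map (\<lambda>t. fst (fst t)) (rev (map prod.swap s)) = rev (map (\<lambda>t. fst (snd t)) s)"
    by (simp add: rev_map)
  ultimately show ?thesis
    using assms cyc_distinct_snd[OF assms] s unfolding cyc_def ends_swap
    by (simp only: distinct_rev set_rev rev_is_Nil_conv map_is_Nil_conv simp_thms)
qed

text \<open>A rotation suffices if some step departs from \<open>z\<close>; otherwise a step arrives
  at \<open>z\<close>, and the reversed traversal is rotated instead.\<close>

lemma cyc_start:
  assumes s: "cyc n d s" and z: "z \<in> \<Union>(edges s)"
  obtains s' where "cyc n d s'" "edges s' = edges s" "length s' = length s" "fst (hd s') = z"
proof -
  have *: "\<exists>s'. cyc n d s' \<and> edges s' = edges s \<and> length s' = length s \<and> fst (hd s') = z"
    if s: "cyc n d s" and z: "z \<in> fst ` set s" for s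
  proof -
    obtain t where t: "t \<in> set s" "z = fst t" using z by blast
    obtain a b where ab: "s = a @ t # b" using split_list[OF t(1)] by blast
    have "cyc n d ((t # b) @ a)" using s unfolding ab by (rule cyc_rotate)
    thus ?thesis using t ab by (intro exI[of _ "(t # b) @ a"]) auto
  qed
  from z have "z \<in> fst ` set s \<or> z \<in> fst ` set (rev (map prod.swap s))"
    unfolding Union_edges set_ends by (auto simp: image_image)
  thus ?thesis
  proof
    assume "z \<in> fst ` set s"
    from *[OF s this] show ?thesis using that by blast
  next
    assume "z \<in> fst ` set (rev (map prod.swap s))"
    from *[OF cyc_reflect[OF s] this] obtain s' where "cyc n d s'"
      "edges s' = edges (rev (map prod.swap s))" "length s' = length (rev (map prod.swap s))" "fst (hd s') = z"
      by blast
    thus ?thesis using that[of s'] by (simp add: edges_swap)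
  qed
qed

lemma in_edges: "t \<in> set s \<Longrightarrow> {fst t, snd t} \<in> edges s"
  unfolding edges_def case_prod_unfold by (rule imageI)

lemma edgesE:
  assumes "e \<in> edges s"
  obtains t where "t \<in> set s" "e = {fst t, snd t}"
proof -
  from assms obtain t where "e = {fst t, snd t}" "t \<in> set s"
    unfolding edges_def case_prod_unfold by (rule imageE)
  thus ?thesis by (rule that[rotated])
qed

lemma edges_subsetI: "(\<And>t. t \<in> set p \<Longrightarrow> {fst t, snd t} \<in> R) \<Longrightarrow> edges p \<subseteq> R"
  unfolding edges_def case_prod_unfold by (rule image_subsetI)

text \<open>The cut is at the first arrival in \<open>T\<close>. The start of the first step may
  itself lie in \<open>T\<close>, hence \<open>tl p\<close>.\<close>

lemma chain_split:
  assumes "chain s" "s \<noteq> []" "fst (snd (last s)) \<in> T"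
  shows "\<exists>p q. s = p @ q \<and> p \<noteq> [] \<and> hd p = hd s \<and> fst (snd (last p)) \<in> T \<and> (\<forall>t\<in>set (tl p). fst (fst t) \<notin> T)"
  using assms
proof (induction s)
  case (Cons t s)
  show ?case
  proof (cases "fst (snd t) \<in> T")
    case True
    thus ?thesis by (intro exI[of _ "[t]"] exI[of _ s]) simp
  next
    case False
    have s: "s \<noteq> []"
    proof
      assume "s = []"
      thus False using Cons.prems(3) False by simp
    qed
    hence "chain s" "fst (snd (last s)) \<in> T" using Cons.prems by (simp_all add: chain_Cons)
    from Cons.IH[OF this(1) s this(2)] obtain p q
      where p: "s = p @ q" "p \<noteq> []" "hd p = hd s" "fst (snd (last p)) \<in> T" "\<forall>t\<in>set (tl p). fst (fst t) \<notin> T"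
      by blast
    have "fst (fst (hd p)) \<notin> T" using False Cons.prems s p(3) by (simp add: chain_Cons)
    hence "\<forall>t\<in>set p. fst (fst t) \<notin> T" using p(2,5) by (cases p) auto
    thus ?thesis using p by (intro exI[of _ "t # p"] exI[of _ q]) simp
  qed
qed simp

text \<open>Pairs of \<open>F\<close> have both ends in bins of \<open>T\<close>, so before the
  first return to \<open>T\<close> the walk cannot use one of them after its first step, and the
  first step is in \<open>R\<close> by assumption. Hence this part of the walk lies in
  \<open>R\<close>.\<close>

lemma chain_hit:
  assumes s: "chain s" "s \<noteq> []" "fst (snd (last s)) \<in> T" "distinct (ends s)"
    and e: "edges s \<subseteq> F \<union> R" "{fst (hd s), snd (hd s)} \<in> R"
    and F: "\<And>g v. g \<in> F \<Longrightarrow> v \<in> g \<Longrightarrow> fst v \<in> T"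
  shows "hit R T (length s) (fst (hd s))"
proof -
  obtain p q where p: "s = p @ q" "p \<noteq> []" "hd p = hd s" "fst (snd (last p)) \<in> T" "\<forall>t\<in>set (tl p). fst (fst t) \<notin> T"
    using chain_split[OF s(1-3)] by blast
  have "{fst t, snd t} \<in> R" if "t \<in> set p" for t
  proof (cases "t = hd p")
    case True thus ?thesis using e(2) p(3) by simp
  next
    case False
    hence "t \<in> set (tl p)" using that p(2) by (cases p) auto
    hence "fst (fst t) \<notin> T" using p(5) by blast
    hence "{fst t, snd t} \<notin> F" using F[of "{fst t, snd t}" "fst t"] by blast
    moreover have "{fst t, snd t} \<in> edges s" using that p(1) by (intro in_edges) simp
    ultimately show ?thesis using e(1) by blast
  qed
  hence "edges p \<subseteq> R" by (rule edges_subsetI)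
  moreover have "chain p" "distinct (ends p)" using s p(1) by (simp_all add: chain_append)
  ultimately show ?thesis
    unfolding hit_def using p by (intro exI[of _ p]) simp
qed

lemma edges_disjoint:
  "distinct (ends s) \<Longrightarrow> e \<in> edges s \<Longrightarrow> g \<in> edges s \<Longrightarrow> v \<in> e \<Longrightarrow> v \<in> g \<Longrightarrow> e = g"
proof (induction s)
  case (Cons t s)
  have out: "v \<notin> f" if "v \<in> {fst t, snd t}" "f \<in> edges s" for f
  proof
    assume "v \<in> f"
    hence "v \<in> set (ends s)" using edges_in_ends[OF that(2)] by blast
    thus False using that(1) Cons.prems(1) by auto
  qed
  from Cons.prems(2,3) consider "e = {fst t, snd t}" "g = {fst t, snd t}" | "e = {fst t, snd t}" "g \<in> edges s"
    | "e \<in> edges s" "g = {fst t, snd t}" | "e \<in> edges s" "g \<in> edges s"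
    unfolding edges_Cons by blast
  thus ?case
  proof cases
    case 4
    thus ?thesis using Cons by simp
  qed (use out[of e] out[of g] Cons.prems(4,5) in simp_all)
qed simp

text \<open>Traversed from \<open>z\<close> along \<open>g\<close>, the cycle comes back to the bin
  of \<open>z\<close> at the latest, so \<open>chain_hit\<close> finds a return to
  \<open>T\<close>.\<close>

lemma cycle_hit:
  assumes s: "cyc n d s" and g: "g \<in> edges s" "z \<in> g" "g \<in> R" and sub: "edges s \<subseteq> F \<union> R"
    and F: "\<And>g v. g \<in> F \<Longrightarrow> v \<in> g \<Longrightarrow> fst v \<in> T" and z: "fst z \<in> T"
  shows "hit R T (length s) z"
proof -
  obtain s' where s': "cyc n d s'" "edges s' = edges s" "length s' = length s" "fst (hd s') = z"
    using cyc_start[OF s, of z] g by blast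
  have ne: "s' \<noteq> []" and di: "distinct (ends s')" using s'(1) by (auto simp: cyc_def)
  have "{fst (hd s'), snd (hd s')} \<in> edges s'" using ne by (intro in_edges) simp
  from edges_disjoint[OF di this _ _ g(2)] have *: "{fst (hd s'), snd (hd s')} = g"
    using g(1) s'(2,4) by simp
  have "hit R T (length s') (fst (hd s'))"
  proof (rule chain_hit[OF cyc_chain[OF s'(1)] ne _ di])
    show "fst (snd (last s')) \<in> T" using cyc_close[OF s'(1)] s'(4) z by simp
    show "edges s' \<subseteq> F \<union> R" using sub s'(2) by simp
    show "{fst (hd s'), snd (hd s')} \<in> R" using * g(3) by simp
  qed (rule F)
  thus ?thesis using s' by simp
qed

text \<open>The cycle contains the pair \<open>e\<close> of \<open>F\<close>, so its walk through
  \<open>R\<close> from \<open>T\<close> back to \<open>T\<close> has at least one pair less. No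
  starting prevertex is prescribed, only its bin; the saved step pays for the d choices.\<close>

lemma cycle_hit_shorter:
  assumes s: "cyc n d s" and e: "e \<in> edges s" "e \<in> F" and g: "g \<in> edges s" "g \<notin> F" and sub: "edges s \<subseteq> F \<union> R"
    and F: "\<And>g v. g \<in> F \<Longrightarrow> v \<in> g \<Longrightarrow> fst v \<in> T"
  obtains z where "z \<in> {..<n} \<times> {..<d}" "fst z \<in> T" "hit R T (length s - 1) z"
proof -
  obtain t where t: "t \<in> set s" "e = {fst t, snd t}" using edgesE[OF e(1)] .
  obtain a b where ab: "s = a @ t # b" using split_list[OF t(1)] by blast
  define q where "q = b @ a"
  have "cyc n d ((a @ [t]) @ b)" using s ab by simp
  hence "cyc n d (b @ a @ [t])" by (rule cyc_rotate)
  hence c: "cyc n d (q @ [t])" by (simp add: q_def)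
  have Eq: "edges s = edges (q @ [t])" and Lq: "length s = Suc (length q)" by (simp_all add: ab q_def Un_commute)
  have tT: "fst (fst t) \<in> T" "fst (snd t) \<in> T" using F[OF e(2)] t(2) by simp_all
  have gq: "g \<in> edges q" using g(1) unfolding Eq edges_append using t e(2) g(2) by force
  then obtain t' where "t' \<in> set q" "g = {fst t', snd t'}" by (rule edgesE)
  hence "\<exists>u\<in>set q. {fst u, snd u} \<notin> F" using g by blast
  \<comment> \<open>The first pair outside \<open>F\<close> after \<open>t\<close>. All pairs in
    between are in \<open>F\<close>, so \<open>u\<close> departs from a bin of
    \<open>T\<close>.\<close>
  from split_list_first_prop[OF this] obtain a' u b'
    where u: "q = a' @ u # b'" "{fst u, snd u} \<notin> F" "\<forall>w\<in>set a'. {fst w, snd w} \<in> F"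
    by blast
  have ch: "chain (q @ [t])" using cyc_chain[OF c] .
  have uT: "fst (fst u) \<in> T"
  proof (cases "a' = []")
    case True
    thus ?thesis using cyc_close[OF c] tT u(1) by simp
  next
    case False
    hence "{fst (last a'), snd (last a')} \<in> F" using u(3) last_in_set by blast
    hence "fst (snd (last a')) \<in> T" using F by blast
    thus ?thesis using ch False unfolding u(1) by (simp add: chain_append)
  qed
  have uV: "fst u \<in> {..<n} \<times> {..<d}"
    using c u(1) by (simp add: cyc_def)
  have h: "hit R T (length (u # b')) (fst (hd (u # b')))"
  proof (rule chain_hit[where F = F])
    have "chain q" using ch unfolding chain_append by blast
    thus "chain (u # b')" unfolding u(1) chain_append[of a'] by blast
    have "distinct (ends q)" using c by (simp add: cyc_def)
    thus "distinct (ends (u # b'))" unfolding u(1) ends_append distinct_append by blast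
    have "chain ((u # b') @ [t])" using ch unfolding u(1) append_assoc chain_append[of a'] by blast
    thus "fst (snd (last (u # b'))) \<in> T" using tT unfolding chain_append[of "u # b'"] by simp
    show sub': "edges (u # b') \<subseteq> F \<union> R" using sub unfolding Eq u(1) edges_append by blast
    have "{fst u, snd u} \<in> F \<union> R" using sub' by (simp only: edges_Cons insert_subset)
    thus "{fst (hd (u # b')), snd (hd (u # b'))} \<in> R" using u(2) by (simp only: list.sel Un_iff simp_thms)
  qed (use F in auto)
  hence "hit R T (length (u # b')) (fst u)" by simp
  hence *: "hit R T (length s - 1) (fst u)"
    by (rule hit_mono) (auto simp: Lq u(1))
  show ?thesis by (rule that[OF uV uT *])
qed

text \<open>A cycle through \<open>T\<close> either returns to \<open>T\<close> within r - 1 pairs,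
  or needs all its pairs and then ends in the single bin it came from. Summed over the d prevertices
  of each of k bins, the first case has a shorter walk and the second a smaller target, so neither
  leads to the product \<open>k\<^sup>2\<close> d (d - 1)^(r - 1).\<close>

lemma cycle_hit_own:
  assumes s: "cyc n d s" and z: "z \<in> \<Union>(edges s)" "fst z \<in> T" and R: "edges s \<subseteq> R" and r: "length s \<le> r"
  shows "hit R T (r - 1) z \<or> hit R {fst z} r z"
proof -
  obtain s' where s': "cyc n d s'" "edges s' = edges s" "length s' = length s" "fst (hd s') = z"
    using cyc_start[OF s z(1)] .
  have ne: "s' \<noteq> []" and di: "distinct (ends s')" using s'(1) by (auto simp: cyc_def)
  obtain p q where p: "s' = p @ q" "p \<noteq> []" "hd p = hd s'" "fst (snd (last p)) \<in> T"
    using chain_split[OF cyc_chain[OF s'(1)] ne, of T] cyc_close[OF s'(1)] s'(4) z(2) by auto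
  have hitp: "chain p" "distinct (ends p)" "edges p \<subseteq> R"
    using s' p(1) di R cyc_chain[OF s'(1)] by (auto simp: chain_append)
  show ?thesis
  proof (cases "length p \<le> r - 1")
    case True
    thus ?thesis unfolding hit_def using p hitp s'(4) by (intro disjI1 exI[of _ p]) auto
  next
    case False
    have "length p + length q \<le> r" "length p > 0" using r s'(3) p(1,2) by simp_all
    hence "length q = 0" using False by linarith
    hence "p = s'" using p(1) by simp
    thus ?thesis unfolding hit_def using hitp s' cyc_close[OF s'(1)] ne r by (intro disjI2 exI[of _ p]) simp
  qed
qed

text \<open>The other prevertex is the one through which the traversal starting at \<open>z\<close>
  returns.\<close>

lemma cyc_partner:
  assumes s: "cyc n d s" and z: "z \<in> \<Union>(edges s)"
  obtains x where "x \<in> \<Union>(edges s)" "fst x = fst z" "x \<noteq> z"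
proof -
  obtain s' where s': "cyc n d s'" "edges s' = edges s" "fst (hd s') = z"
    using cyc_start[OF s z] by metis
  have "snd (last s') \<in> \<Union>(edges s')" unfolding Union_edges set_ends using s'(1) by (auto simp: cyc_def)
  thus ?thesis using that cyc_close[OF s'(1)] s' by metis
qed

text \<open>In each of its bins a cycle has one prevertex for departing and one for arriving, and no
  others.\<close>

lemma cyc_two:
  assumes s: "cyc n d s" and "x \<in> \<Union>(edges s)" "y \<in> \<Union>(edges s)" "z \<in> \<Union>(edges s)"
    and b: "fst x = fst y" "fst y = fst z" and ne: "x \<noteq> y" "y \<noteq> z"
  shows "x = z"
proof -
  have 1: "u = v" if "u \<in> fst ` set s" "v \<in> fst ` set s" "fst u = fst v" for u v
  proof -
    have "inj_on (\<lambda>t. fst (fst t)) (set s)" using s by (simp add: cyc_def distinct_map)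
    thus ?thesis using that by (auto dest: inj_onD)
  qed
  have 2: "u = v" if "u \<in> snd ` set s" "v \<in> snd ` set s" "fst u = fst v" for u v
  proof -
    have "inj_on (\<lambda>t. fst (snd t)) (set s)" using cyc_distinct_snd[OF s] by (simp add: distinct_map)
    thus ?thesis using that by (auto dest: inj_onD)
  qed
  have "x \<in> fst ` set s \<or> x \<in> snd ` set s" "y \<in> fst ` set s \<or> y \<in> snd ` set s" "z \<in> fst ` set s \<or> z \<in> snd ` set s"
    using assms(2-4) unfolding Union_edges set_ends by blast+
  moreover have "\<not> (x \<in> fst ` set s \<and> y \<in> fst ` set s)" "\<not> (y \<in> fst ` set s \<and> z \<in> fst ` set s)"
    using 1[of x y] 1[of y z] b ne by argo+
  moreover have "\<not> (x \<in> snd ` set s \<and> y \<in> snd ` set s)" "\<not> (y \<in> snd ` set s \<and> z \<in> snd ` set s)"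
    using 2[of x y] 2[of y z] b ne by argo+
  ultimately have "(x \<in> fst ` set s \<and> z \<in> fst ` set s) \<or> (x \<in> snd ` set s \<and> z \<in> snd ` set s)"
    by argo
  moreover have "fst x = fst z" using b by simp
  ultimately show ?thesis using 1[of x z] 2[of x z] by argo
qed

text \<open>Follow \<open>t\<close> from a prevertex of \<open>s\<close> until the first pair
  \<open>u\<close> outside \<open>s\<close>. The preceding pair is in \<open>s\<close>, so
  \<open>s\<close> also has its second prevertex in that bin; since \<open>t\<close> has only two
  there, it is the start of \<open>u\<close>, and then \<open>u\<close> lies in \<open>s\<close>
  after all.\<close>

lemma cyc_subset:
  assumes s: "cyc n d s" and t: "cyc n d t" and sub: "edges s \<subseteq> edges t"
  shows "edges s = edges t"
proof (rule ccontr)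
  assume ne: "edges s \<noteq> edges t"
  define z where "z = fst (hd s)"
  have "hd s \<in> set s" using s by (simp add: cyc_def)
  hence z: "z \<in> \<Union>(edges s)" unfolding Union_edges set_ends z_def by blast
  hence zt: "z \<in> \<Union>(edges t)" using sub by blast
  obtain t' where t': "cyc n d t'" "edges t' = edges t" "fst (hd t') = z"
    using cyc_start[OF t zt] by blast
  have "\<exists>u\<in>set t'. {fst u, snd u} \<notin> edges s"
  proof -
    obtain g where g: "g \<in> edges t'" "g \<notin> edges s" using ne sub t'(2) by blast
    from g(1) obtain u where "u \<in> set t'" "g = {fst u, snd u}" by (rule edgesE)
    thus ?thesis using g(2) by blast
  qed
  from split_list_first_prop[OF this] obtain a u b
    where u: "t' = a @ u # b" "{fst u, snd u} \<notin> edges s" "\<forall>w\<in>set a. {fst w, snd w} \<in> edges s"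
    by blast
  have di: "distinct (ends t')" using t' by (simp add: cyc_def)
  have "a \<noteq> []"
  proof
    assume "a = []"
    hence "z = fst u" using u(1) t'(3) by simp
    moreover obtain g where g: "g \<in> edges s" "z \<in> g" using z by blast
    moreover have "{fst u, snd u} \<in> edges t'" by (simp add: u(1))
    ultimately have "g = {fst u, snd u}" using edges_disjoint[OF di, of g "{fst u, snd u}" z] sub t'(2) by blast
    thus False using g u(2) by simp
  qed
  define y where "y = snd (last a)"
  have ly: "{fst (last a), snd (last a)} \<in> edges s" using u(3) last_in_set[OF \<open>a \<noteq> []\<close>] by blast
  hence ys: "y \<in> \<Union>(edges s)" unfolding y_def by blast
  have yu: "fst y = fst (fst u)" "y \<noteq> fst u"
    using cyc_chain[OF t'(1)] \<open>a \<noteq> []\<close> unfolding u(1) y_def by (simp_all add: chain_append)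
  obtain x where x: "x \<in> \<Union>(edges s)" "fst x = fst y" "x \<noteq> y" using cyc_partner[OF s ys] .
  have ut: "{fst u, snd u} \<in> edges t'" by (simp add: u(1))
  have "x = fst u"
  proof (rule cyc_two[OF t'(1)])
    show "x \<in> \<Union>(edges t')" "y \<in> \<Union>(edges t')" using x ys sub t'(2) by blast+
    show "fst u \<in> \<Union>(edges t')" using ut by blast
  qed (use x yu in auto)
  then obtain g where g: "g \<in> edges s" "fst u \<in> g" using x by blast
  hence "g = {fst u, snd u}" using edges_disjoint[OF di _ ut, of g "fst u"] sub t'(2) by blast
  thus False using g u(2) by simp
qed

text \<open>Assigns the pairs of a cycle to the positions of its vertex list. The projection of a
  pair alone does not determine its position: the two pairs of a double edge have the same
  image.\<close>

lemma image_mset_eq_bij: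
  assumes "finite B" "finite A" "image_mset f (mset_set A) = image_mset g (mset_set B)"
  shows "\<exists>b. bij_betw b B A \<and> (\<forall>i\<in>B. f (b i) = g i)"
  using assms
proof (induction B arbitrary: A rule: finite_induct)
  case empty
  hence "mset_set A = {#}" by simp
  hence "A = {}" using empty.prems(1) by (simp add: mset_set_empty_iff)
  thus ?case by (auto simp: bij_betw_def)
next
  case (insert i B)
  have "g i \<in># image_mset f (mset_set A)" using insert by simp
  then obtain a where a: "a \<in> A" "f a = g i" using insert.prems(1) by auto
  define A' where "A' = A - {a}"
  have A: "A = insert a A'" "a \<notin> A'" "finite A'" using a insert.prems(1) by (auto simp: A'_def)
  have "image_mset f (mset_set A') = image_mset g (mset_set B)"
    using insert.prems(2) insert.hyps A a(2) by simp
  then obtain b where b: "bij_betw b B A'" "\<forall>i\<in>B. f (b i) = g i"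
    using insert.IH[OF A(3)] by blast
  have "bij_betw (b(i := a)) B A'"
    using b(1) insert.hyps by (subst bij_betw_cong[of B _ b]) auto
  hence "bij_betw (b(i := a)) (insert i B) (insert a A')"
    using insert.hyps A(2) notIn_Un_bij_betw[of i B "b(i := a)" A'] by simp
  moreover have "\<forall>j\<in>insert i B. f ((b(i := a)) j) = g j" using b(2) a(2) by simp
  ultimately show ?case unfolding A(1) by blast
qed

lemma distinct_ends_map:
  assumes "\<And>i. i \<in> set xs \<Longrightarrow> x i \<noteq> y i"
    and "\<And>i j. i \<in> set xs \<Longrightarrow> j \<in> set xs \<Longrightarrow> i \<noteq> j \<Longrightarrow> {x i, y i} \<inter> {x j, y j} = {}" and "distinct xs"
  shows "distinct (ends (map (\<lambda>i. (x i, y i)) xs))"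
  using assms
proof (induction xs)
  case (Cons i xs)
  have "x i \<notin> set (ends (map (\<lambda>i. (x i, y i)) xs)) \<and> y i \<notin> set (ends (map (\<lambda>i. (x i, y i)) xs))"
    unfolding set_ends using Cons.prems(2)[of i] Cons.prems(3) by fastforce
  thus ?case using Cons by simp
qed simp

lemma chain_map_upt:
  assumes "\<And>i. Suc i < k \<Longrightarrow> fst (y i) = fst (x (Suc i)) \<and> y i \<noteq> x (Suc i)"
  shows "chain (map (\<lambda>i. (x i, y i)) [0..<k])"
  unfolding chain_def successively_conv_nth using assms by simp

lemma cycle_steps:
  assumes "\<alpha> \<in> cycles_of_length n d k"
  obtains s where "cyc n d s" "length s = k" "edges s = \<alpha>"
proof -
  from assms obtain P vs where P: "P \<in> pairings n d" "\<alpha> \<subseteq> P" and k: "k \<ge> 1"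
    and vs: "distinct vs" "length vs = k" and pr: "projection \<alpha> = cycle_edges vs"
    unfolding cycles_of_length_def is_cycle_def by blast
  have P': "P \<in> matchings ({..<n} \<times> {..<d})" using P(1) by (simp add: pairings_def pairings_on_eq)
  have fin: "finite \<alpha>" using P(2) matchings_finite[OF P'] finite_subset by auto
  have "image_mset ((`) fst) (mset_set \<alpha>) = image_mset (\<lambda>i. {vs ! i, vs ! (Suc i mod k)}) (mset_set {..<k})"
    using pr by (simp add: projection_def cycle_edges_def vs)
  from image_mset_eq_bij[OF finite_lessThan fin this] obtain e
    where e: "bij_betw e {..<k} \<alpha>" "\<And>i. i < k \<Longrightarrow> fst ` e i = {vs ! i, vs ! (Suc i mod k)}" by auto
  have e\<alpha>: "e i \<in> \<alpha>" if "i < k" for i using e(1) that by (auto simp: bij_betw_def)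
  have "\<exists>x y. e i = {x, y} \<and> fst x = vs ! i \<and> fst y = vs ! (Suc i mod k) \<and> x \<noteq> y" if "i < k" for i
  proof -
    have "card (e i) = 2" using e\<alpha>[OF that] P(2) matchings_card[OF P'] by blast
    then obtain p q where pq: "e i = {p, q}" "p \<noteq> q" unfolding card_2_iff by blast
    hence "{fst p, fst q} = {vs ! i, vs ! (Suc i mod k)}" using e(2)[OF that] by simp
    hence "(fst p = vs ! i \<and> fst q = vs ! (Suc i mod k)) \<or> (fst p = vs ! (Suc i mod k) \<and> fst q = vs ! i)"
      by (simp add: doubleton_eq_iff)
    thus ?thesis
    proof
      assume "fst p = vs ! (Suc i mod k) \<and> fst q = vs ! i"
      thus ?thesis using pq by (intro exI[of _ q] exI[of _ p]) (simp add: insert_commute)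
    qed (use pq in \<open>intro exI[of _ p] exI[of _ q], simp\<close>)
  qed
  then obtain x y where xy: "\<And>i. i < k \<Longrightarrow> e i = {x i, y i} \<and> fst (x i) = vs ! i \<and> fst (y i) = vs ! (Suc i mod k) \<and> x i \<noteq> y i"
    by metis
  have disj: "{x i, y i} \<inter> {x j, y j} = {}" if "i < k" "j < k" "i \<noteq> j" for i j
  proof -
    have ne: "e i \<noteq> e j" using e(1) that by (auto simp: bij_betw_def inj_on_def)
    have "e i \<inter> e j = {}"
    proof (rule ccontr)
      assume "e i \<inter> e j \<noteq> {}"
      then obtain v where v: "v \<in> e i" "v \<in> e j" by blast
      have "e i \<in> P" "e j \<in> P" using e\<alpha> that P(2) by blast+
      from matchings_disjoint[OF P' this v] ne show False by blast
    qed
    thus ?thesis using xy that by simp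
  qed
  have fx: "fst (x i) = vs ! i" if "i < k" for i using xy[OF that] by blast
  have fe: "e i = {x i, y i}" if "i < k" for i using xy[OF that] by blast
  have fxy: "x i \<noteq> y i" if "i < k" for i using xy[OF that] by blast
  define s where "s = map (\<lambda>i. (x i, y i)) [0..<k]"
  have ls: "length s = k" by (simp add: s_def)
  have sne: "s \<noteq> []" using ls k by auto
  have nxt: "y i \<noteq> x j" if "i < k" "j < k" "i \<noteq> j" for i j using disj[OF that] by auto
  have hds: "hd s = (x 0, y 0)" and lasts: "last s = (x (k - 1), y (k - 1))"
    using k by (auto simp: s_def hd_map last_map)
  have Es: "edges s = \<alpha>"
  proof -
    have "edges s = (\<lambda>i. {x i, y i}) ` {..<k}"
      by (simp add: s_def edges_def image_image atLeast0LessThan)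
    also have "\<dots> = e ` {..<k}" using fe by (intro image_cong) simp_all
    finally have "edges s = e ` {..<k}" .
    thus ?thesis using e(1) by (simp add: bij_betw_def)
  qed
  have "cyc n d s"
    unfolding cyc_def
  proof (intro conjI sne)
    have "chain s"
      unfolding s_def
    proof (rule chain_map_upt)
      fix i assume i: "Suc i < k"
      show "fst (y i) = fst (x (Suc i)) \<and> y i \<noteq> x (Suc i)"
        using xy[of i] xy[of "Suc i"] nxt[of i "Suc i"] i by simp
    qed
    moreover have "fst (y (k - 1)) = fst (x 0)" using xy[of "k - 1"] xy[of 0] k by simp
    moreover have "y (k - 1) \<noteq> x 0"
    proof (cases "k = 1")
      case True
      have "x 0 \<noteq> y 0" using xy[of 0] k by simp
      thus ?thesis using True by simp
    next
      case False
      thus ?thesis using k by (intro nxt) simp_all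
    qed
    ultimately show "chain (s @ [hd s])" unfolding chain_append by (simp add: hds lasts)
    have "map (\<lambda>t. fst (fst t)) s = map (\<lambda>i. vs ! i) [0..<k]"
      by (simp add: s_def fx)
    also have "\<dots> = vs" unfolding vs(2)[symmetric] by (rule map_nth)
    finally show "distinct (map (\<lambda>t. fst (fst t)) s)" using vs(1) by simp
    show "distinct (ends s)" unfolding s_def by (rule distinct_ends_map) (use fxy disj in simp_all)
    show "set (ends s) \<subseteq> {..<n} \<times> {..<d}"
      unfolding Union_edges[symmetric] Es using P(2) matchings_Union[OF P'] by blast
  qed
  from that[OF this ls Es] show ?thesis .
qed

lemma cycle_steps_upto:
  assumes "\<alpha> \<in> cycles_upto n d r"
  obtains s where "cyc n d s" "length s \<le> r" "edges s = \<alpha>"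
proof -
  obtain k where "k \<le> r" "\<alpha> \<in> cycles_of_length n d k" using assms by (auto simp: cycles_upto_def)
  from cycle_steps[OF this(2)] obtain s where "cyc n d s" "length s = k" "edges s = \<alpha>" .
  thus ?thesis using that[of s] \<open>k \<le> r\<close> by simp
qed

lemma cyc_length: "cyc n d s \<Longrightarrow> card (edges s) = length s"
  by (rule card_edges) (simp add: cyc_def)

lemma bins_edges:
  assumes "cyc n d s"
  shows "bins (edges s) = set (map (\<lambda>t. fst (fst t)) s)"
proof -
  have "map (\<lambda>t. fst (snd t)) s = map (\<lambda>t. fst (fst t)) (tl s @ [hd s])"
    using assms by (intro tl_bins) (auto simp: cyc_def)
  hence "set (map (\<lambda>t. fst (snd t)) s) = set (map (\<lambda>t. fst (fst t)) (tl s @ [hd s]))" by simp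
  also have "\<dots> = set (map (\<lambda>t. fst (fst t)) s)"
    using assms by (cases s) (auto simp: cyc_def)
  finally have 1: "(\<lambda>t. fst (snd t)) ` set s = (\<lambda>t. fst (fst t)) ` set s" by simp
  show ?thesis unfolding bins_def Union_edges set_ends image_Un image_image using 1 by simp
qed

lemma card_bins: "cyc n d s \<Longrightarrow> card (bins (edges s)) = length s"
  by (subst bins_edges, assumption, subst distinct_card) (auto simp: cyc_def)

lemma finite_cycles_of_length [simp]: "finite (cycles_of_length n d k)"
proof (rule finite_subset)
  show "cycles_of_length n d k \<subseteq> Pow (Pow ({..<n} \<times> {..<d}))"
  proof
    fix \<alpha> assume "\<alpha> \<in> cycles_of_length n d k"
    then obtain s where "cyc n d s" "edges s = \<alpha>" by (rule cycle_steps)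
    hence "\<Union>\<alpha> \<subseteq> {..<n} \<times> {..<d}" using Union_edges[of s] by (simp add: cyc_def)
    thus "\<alpha> \<in> Pow (Pow ({..<n} \<times> {..<d}))" by blast
  qed
qed simp

lemma finite_cycles_upto [simp]: "finite (cycles_upto n d r)"
  by (simp add: cycles_upto_def)

lemma cycles_upto_antichain:
  assumes "\<alpha> \<in> cycles_upto n d r" "\<beta> \<in> cycles_upto n d r" "\<beta> \<subseteq> \<alpha>"
  shows "\<beta> = \<alpha>"
proof -
  obtain s where "cyc n d s" "length s \<le> r" "edges s = \<alpha>"
    using cycle_steps_upto[OF assms(1)] .
  moreover obtain t where "cyc n d t" "length t \<le> r" "edges t = \<beta>"
    using cycle_steps_upto[OF assms(2)] .
  ultimately have "cyc n d s" "edges s = \<alpha>" "cyc n d t" "edges t = \<beta>" by simp_all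
  thus ?thesis using cyc_subset[of n d t s] assms(3) by simp
qed

text \<open>
  A cycle of length \<open>k\<close> is traversed by at least one closed walk from each of its \<open>k\<close> bins,
  so closed walks are counted with the factor \<open>k\<close>.
\<close>

lemma cycles_of_length_count:
  assumes n: "n \<ge> 1" and d: "d \<ge> 1" and k: "k \<ge> 1"
  shows "real k * real (card (cycles_of_length n d k)) * (1 / (real n * real d)) ^ k \<le> real d * real (d - 1) ^ (k - 1)"
proof -
  define V where "V = {..<n} \<times> {..<d}"
  define w where "w = 1 / (real n * real d)"
  have fV: "finite V" by (simp add: V_def)
  \<comment> \<open>With the constant weight 1 / (n d) the row sums are 1 and a prescribed bin
    receives 1 / n, so \<open>walk_sum\<close> bounds the number of closed walks.\<close>
  have cV: "real (card V) * w = 1" using n d by (simp add: V_def w_def)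
  have w0: "w \<ge> 0" by (simp add: w_def)
  define S where "S \<alpha> = {s. cyc n d s \<and> edges s = \<alpha> \<and> length s = k}" for \<alpha>
  define J where "J = cycles_of_length n d k"
  have Ssub: "S \<alpha> \<subseteq> (\<Union>z\<in>V. walks V {fst z} k z)" for \<alpha>
  proof
    fix s assume s: "s \<in> S \<alpha>"
    hence c: "cyc n d s" "length s = k" by (simp_all add: S_def)
    have ends: "set (ends s) \<subseteq> V" using c(1) by (simp add: cyc_def V_def)
    have ne: "s \<noteq> []" using c(1) by (simp add: cyc_def)
    hence "fst (hd s) \<in> V" using ends hd_in_set[OF ne] unfolding set_ends by blast
    moreover have "set s \<subseteq> V \<times> V" using ends unfolding set_ends subset_iff mem_Times_iff by blast
    hence "s \<in> walks V {fst (fst (hd s))} k (fst (hd s))"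
      using cyc_chain[OF c(1)] cyc_close[OF c(1)] c(2) ne by (simp add: walks_def)
    ultimately show "s \<in> (\<Union>z\<in>V. walks V {fst z} k z)" by blast
  qed
  have fS: "finite (S \<alpha>)" for \<alpha>
    by (rule finite_subset[OF Ssub]) (use fV finite_walks in auto)
  have kS: "k \<le> card (S \<alpha>)" if "\<alpha> \<in> J" for \<alpha>
  proof -
    from that obtain s where s: "cyc n d s" "length s = k" "edges s = \<alpha>"
      unfolding J_def by (rule cycle_steps)
    have "bins \<alpha> \<subseteq> (\<lambda>s. fst (fst (hd s))) ` S \<alpha>"
    proof
      fix v assume "v \<in> bins \<alpha>"
      then obtain z where z: "v = fst z" "z \<in> \<Union>(edges s)"
        unfolding s(3)[symmetric] bins_def by (rule imageE)
      obtain s' where s': "cyc n d s'" "edges s' = edges s" "length s' = length s" "fst (hd s') = z"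
        using cyc_start[OF s(1) z(2)] .
      have "s' \<in> S \<alpha>" using s s' by (simp add: S_def)
      moreover have "v = fst (fst (hd s'))" using z(1) s'(4) by simp
      ultimately show "v \<in> (\<lambda>s. fst (fst (hd s))) ` S \<alpha>" by (rule rev_image_eqI)
    qed
    from order_trans[OF card_mono[OF finite_imageI[OF fS] this] card_image_le[OF fS]]
    have "card (bins \<alpha>) \<le> card (S \<alpha>)" .
    thus ?thesis unfolding s(3)[symmetric] card_bins[OF s(1)] s(2) .
  qed
  have "real k * real (card J) * w ^ k = (\<Sum>\<alpha>\<in>J. real k * w ^ k)" by simp
  also have "\<dots> \<le> (\<Sum>\<alpha>\<in>J. real (card (S \<alpha>)) * w ^ k)"
    using kS w0 by (intro sum_mono mult_right_mono) auto
  also have "\<dots> = real (\<Sum>\<alpha>\<in>J. card (S \<alpha>)) * w ^ k" by (simp add: sum_distrib_right)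
  also have "(\<Sum>\<alpha>\<in>J. card (S \<alpha>)) = card (\<Union>\<alpha>\<in>J. S \<alpha>)"
    using fS by (intro card_UN_disjoint[symmetric]) (auto simp: J_def S_def)
  also have "real (card (\<Union>\<alpha>\<in>J. S \<alpha>)) * w ^ k \<le> real (card (\<Union>z\<in>V. walks V {fst z} k z)) * w ^ k"
    using Ssub fV finite_walks w0 by (intro mult_right_mono of_nat_mono card_mono) auto
  also have "\<dots> \<le> real (\<Sum>z\<in>V. card (walks V {fst z} k z)) * w ^ k"
    using w0 fV by (intro mult_right_mono of_nat_mono card_UN_le) auto
  also have "\<dots> = (\<Sum>z\<in>V. (\<Sum>p\<in>walks V {fst z} k z. weight (\<lambda>_ _. w) p))"
  proof -
    have "weight (\<lambda>_ _. w) p = w ^ length p" for p by (induction p) auto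
    hence "(\<Sum>p\<in>walks V {fst z} k z. weight (\<lambda>_ _. w) p) = real (card (walks V {fst z} k z)) * w ^ k" for z
      by (simp add: walks_def)
    thus ?thesis by (simp add: sum_distrib_right)
  qed
  also have "\<dots> \<le> (\<Sum>z\<in>V. 1 ^ k * real (d - 1) ^ (k - 1) * (1 / real n))"
  proof (rule sum_mono)
    fix z assume z: "z \<in> V"
    have last: "(\<Sum>y\<in>{y\<in>V. fst y \<in> {fst z}}. w) \<le> 1 * (1 / real n)"
    proof -
      have "fst z < n" using z by (auto simp: V_def)
      hence "{y\<in>V. fst y \<in> {fst z}} = {fst z} \<times> {..<d}" by (auto simp: V_def)
      thus ?thesis using n d by (simp add: w_def)
    qed
    have "(\<Sum>p\<in>walks V {fst z} (Suc (k - 1)) z. weight (\<lambda>_ _. w) p) \<le> 1 ^ Suc (k - 1) * real (d - 1) ^ (k - 1) * (1 / real n)"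
      by (rule walk_sum[OF V_def d w0]) (use cV last in auto)
    thus "(\<Sum>p\<in>walks V {fst z} k z. weight (\<lambda>_ _. w) p) \<le> 1 ^ k * real (d - 1) ^ (k - 1) * (1 / real n)"
      using k by simp
  qed
  also have "\<dots> = real d * real (d - 1) ^ (k - 1)"
    using n by (simp add: V_def)
  finally show ?thesis by (simp add: J_def w_def)
qed

section \<open>Near-independence for fixed types\<close>

definition past :: "nat \<Rightarrow> nat \<Rightarrow> nat \<Rightarrow> pairing \<Rightarrow> pairing set \<Rightarrow> bool" where
  "past n d r \<alpha> S \<longleftrightarrow> (\<forall>X Y. (\<forall>\<beta>\<in>cycles_upto n d r. \<beta> \<noteq> \<alpha> \<longrightarrow> (\<beta> \<subseteq> X \<longleftrightarrow> \<beta> \<subseteq> Y)) \<longrightarrow> (X \<in> S \<longleftrightarrow> Y \<in> S))"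

lemma past_diff:
  assumes "past n d r \<alpha> S" "(X \<in> S) \<noteq> (Y \<in> S)"
  obtains \<beta> where "\<beta> \<in> cycles_upto n d r" "\<beta> \<noteq> \<alpha>" "(\<beta> \<subseteq> X \<and> \<not> \<beta> \<subseteq> Y) \<or> (\<beta> \<subseteq> Y \<and> \<not> \<beta> \<subseteq> X)"
proof -
  have "\<not> (\<forall>\<beta>\<in>cycles_upto n d r. \<beta> \<noteq> \<alpha> \<longrightarrow> (\<beta> \<subseteq> X \<longleftrightarrow> \<beta> \<subseteq> Y))"
  proof
    assume *: "\<forall>\<beta>\<in>cycles_upto n d r. \<beta> \<noteq> \<alpha> \<longrightarrow> (\<beta> \<subseteq> X \<longleftrightarrow> \<beta> \<subseteq> Y)"
    from assms(1)[unfolded past_def, THEN spec, THEN spec, THEN mp, OF *] assms(2) show False by simp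
  qed
  then obtain \<beta> where "\<beta> \<in> cycles_upto n d r" "\<beta> \<noteq> \<alpha>" "(\<beta> \<subseteq> X) \<noteq> (\<beta> \<subseteq> Y)"
    unfolding Ball_def not_all not_imp by (elim exE conjE)
  thus ?thesis using that[of \<beta>] by argo
qed

lemma bins_mem: "g \<in> \<alpha> \<Longrightarrow> v \<in> g \<Longrightarrow> fst v \<in> bins \<alpha>"
  unfolding bins_def by (rule imageI) (rule UnionI)

text \<open>Here \<open>F\<close> are the pairs of \<alpha> fixed before and \<open>e\<close> is the
  next one; \<open>R\<close> and \<open>R'\<close> are the random rest before and after. A cycle
  present in only one of the two pairings has a pair that meets \<open>Z\<close>, or one that
  contains the rematched point \<open>a\<close>, or it uses \<open>e\<close> without being contained
  in \<alpha>. In each case it contains a walk through the random part that returns to the bins of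
  \<alpha> or to that of \<open>a\<close>, since fixed pairs cannot be used outside the bins of
  \<alpha>.\<close>

lemma cycles_difference:
  assumes \<alpha>: "\<alpha> \<in> cycles_upto n d r" and \<beta>: "\<beta> \<in> cycles_upto n d r" "\<beta> \<noteq> \<alpha>"
    and F: "insert e F \<subseteq> \<alpha>" and Z: "\<And>z. z \<in> Z \<Longrightarrow> fst z \<in> bins \<alpha>"
    and R1: "\<And>g. g \<in> R \<Longrightarrow> g \<notin> insert e R' \<Longrightarrow> g \<inter> Z \<noteq> {}"
    and R2: "\<And>g. g \<in> R' \<Longrightarrow> g \<notin> R \<Longrightarrow> a \<in> g \<or> g \<inter> Z \<noteq> {}"
    and one: "(\<beta> \<subseteq> F \<union> R \<and> \<not> \<beta> \<subseteq> insert e (F \<union> R')) \<or> (\<beta> \<subseteq> insert e (F \<union> R') \<and> \<not> \<beta> \<subseteq> F \<union> R)"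
  shows "(\<exists>z\<in>Z. hit R (bins \<alpha>) r z) \<or> (\<exists>z\<in>Z. hit R' (bins \<alpha>) r z) \<or>
    (\<exists>z\<in>bins \<alpha> \<times> {..<d}. hit R' (bins \<alpha>) (r - 1) z) \<or> hit R' (insert (fst a) (bins \<alpha>)) r a"
proof -
  obtain t where t: "cyc n d t" "length t \<le> r" "edges t = \<beta>" using cycle_steps_upto[OF \<beta>(1)] .
  have FT: "fst v \<in> bins \<alpha>" if "g \<in> insert e F" "v \<in> g" for g v
    using that F bins_mem[of g \<alpha> v] by blast
  from one show ?thesis
  proof
    assume *: "\<beta> \<subseteq> F \<union> R \<and> \<not> \<beta> \<subseteq> insert e (F \<union> R')"
    then obtain g where g: "g \<in> \<beta>" "g \<notin> insert e (F \<union> R')" by blast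
    hence gR: "g \<in> R" "g \<notin> insert e R'" using * by blast+
    then obtain z where z: "z \<in> g" "z \<in> Z" using R1 by blast
    have "hit R (bins \<alpha>) (length t) z"
    proof (rule cycle_hit[OF t(1) _ z(1) gR(1)])
      show "g \<in> edges t" "edges t \<subseteq> F \<union> R" using g(1) t(3) * by auto
    qed (use FT Z z in blast)+
    thus ?thesis using hit_mono[OF _ order_refl t(2)] z(2) by blast
  next
    assume *: "\<beta> \<subseteq> insert e (F \<union> R') \<and> \<not> \<beta> \<subseteq> F \<union> R"
    then obtain g where g: "g \<in> \<beta>" "g \<notin> F \<union> R" by blast
    have sub: "edges t \<subseteq> insert e F \<union> R'" using * t(3) by blast
    consider "g = e" | "g \<in> R'" using * g by blast
    thus ?thesis
    proof cases
      case 2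
      consider "a \<in> g" | z where "z \<in> g" "z \<in> Z" using R2[OF 2] g(2) by blast
      thus ?thesis
      proof cases
        case 1
        have "hit R' (insert (fst a) (bins \<alpha>)) (length t) a"
          by (rule cycle_hit[OF t(1) _ 1 2 sub]) (use g(1) t(3) FT in blast)+
        thus ?thesis using hit_mono[OF _ order_refl t(2)] by blast
      next
        case (2 z)
        have "hit R' (bins \<alpha>) (length t) z"
          by (rule cycle_hit[OF t(1) _ 2(1) \<open>g \<in> R'\<close> sub]) (use g(1) t(3) FT Z 2(2) in blast)+
        thus ?thesis using hit_mono[OF _ order_refl t(2)] 2(2) by blast
      qed
    next
      case 1
      \<comment> \<open>Distinct cycles are incomparable, so \<beta> leaves \<alpha> somewhere, as
        \<open>cycle_hit_shorter\<close> requires.\<close>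
      have "\<not> \<beta> \<subseteq> \<alpha>" using cycles_upto_antichain[OF \<alpha> \<beta>(1)] \<beta>(2) by blast
      then obtain g' where g': "g' \<in> \<beta>" "g' \<notin> \<alpha>" by blast
      have "e \<in> edges t" "g' \<in> edges t" "g' \<notin> insert e F" using 1 g(1) g' t(3) F by auto
      from cycle_hit_shorter[OF t(1) this(1) insertI1 this(2,3) sub, of "bins \<alpha>"] FT
      obtain z where z: "z \<in> {..<n} \<times> {..<d}" "fst z \<in> bins \<alpha>" "hit R' (bins \<alpha>) (length t - 1) z" by blast
      have "z \<in> bins \<alpha> \<times> {..<d}" using z(1,2) by (simp add: mem_Times_iff)
      moreover have "hit R' (bins \<alpha>) (r - 1) z" using hit_mono[OF z(3) order_refl, of "r - 1"] t(2) by simp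
      ultimately show ?thesis by blast
    qed
  qed
qed

context types
begin

abbreviation prob_rand :: "prevertex set \<Rightarrow> prevertex set set \<Rightarrow> (pairing \<Rightarrow> bool) \<Rightarrow> real" where
  "prob_rand U B Q \<equiv> measure_pmf.prob (rand U B) {R. Q R}"

text \<open>Cost of one pair of \<alpha>: 18k each for the walks from the at most three points of
  \<open>Z\<close> before and after, 9 \<open>k\<^sup>2\<close> for the walks of r - 1 pairs from
  the bins of \<alpha>, and 6 (k + 1) for those from the rematched point. For k \<ge> 1 the sum 42k
  + 6 + 9 \<open>k\<^sup>2\<close> is at most 57 \<open>k\<^sup>2\<close>.\<close>

definition \<epsilon> :: "nat \<Rightarrow> real" where
  "\<epsilon> k = 57 * (real k)\<^sup>2 * real (d - 1) ^ (r - 1) / real n"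

lemma prob_hits:
  assumes inv: "inv j U B" and j: "j \<le> r" and M: "1 \<le> M" "M \<le> r" and T: "finite T" "card T \<le> t"
    and Z: "finite Z" "card Z \<le> m"
  shows "prob_rand U B (\<lambda>R. \<exists>z\<in>Z. hit R T M z) \<le> real m * (6 * real t * real (d - 1) ^ (M - 1) / real n)"
proof -
  have "{R. \<exists>z\<in>Z. hit R T M z} = (\<Union>z\<in>Z. {R. hit R T M z})" by blast
  hence "prob_rand U B (\<lambda>R. \<exists>z\<in>Z. hit R T M z) \<le> (\<Sum>z\<in>Z. prob_rand U B (\<lambda>R. hit R T M z))"
    using prob_UN_le[OF Z(1), of "rand U B" "\<lambda>z. {R. hit R T M z}"] by simp
  also have "\<dots> \<le> (\<Sum>z\<in>Z. 6 * real t * real (d - 1) ^ (M - 1) / real n)"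
  proof (rule sum_mono)
    fix z
    have "6 * real (card T) * real (d - 1) ^ (M - 1) / real n \<le> 6 * real t * real (d - 1) ^ (M - 1) / real n"
      using T(2) by (intro divide_right_mono mult_right_mono mult_left_mono) auto
    with prob_hit[OF inv j M T(1)] show "prob_rand U B (\<lambda>R. hit R T M z) \<le> 6 * real t * real (d - 1) ^ (M - 1) / real n"
      by (rule order_trans)
  qed
  also have "\<dots> = real (card Z) * (6 * real t * real (d - 1) ^ (M - 1) / real n)" by simp
  also have "\<dots> \<le> real m * (6 * real t * real (d - 1) ^ (M - 1) / real n)"
    using Z(2) by (intro mult_right_mono) auto
  finally show ?thesis .
qed

text \<open>Trades the d starting prevertices of a bin for the saved step; 3 / 2 is the largest
  ratio d / (d - 1), attained at d = 3.\<close>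

lemma D_pow: "r \<ge> 2 \<Longrightarrow> real d * real (d - 1) ^ (r - 2) \<le> 3 / 2 * real (d - 1) ^ (r - 1)"
proof -
  assume r2: "r \<ge> 2"
  have "real d \<le> 3 / 2 * real (d - 1)" using d by (simp add: of_nat_diff)
  hence "real d * real (d - 1) ^ (r - 2) \<le> (3 / 2 * real (d - 1)) * real (d - 1) ^ (r - 2)"
    by (intro mult_right_mono) auto
  also have "\<dots> = 3 / 2 * real (d - 1) ^ Suc (r - 2)" by simp
  also have "Suc (r - 2) = r - 1" using r2 by simp
  finally show ?thesis .
qed

lemma step_close:
  assumes inv: "inv j U B" and inv': "inv (Suc j) U' B'" and j: "Suc j \<le> r" and r2: "r \<ge> 2"
    and cp: "coupled Z C m e (rand U B) (rand U' B')" and Z3: "Z \<subseteq> {x, y, z}"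
    and \<alpha>: "\<alpha> \<in> cycles_upto n d r" "card (bins \<alpha>) = k" "k \<ge> 1" and F: "insert e F \<subseteq> \<alpha>"
    and Z: "\<And>z. z \<in> Z \<Longrightarrow> fst z \<in> bins \<alpha>" and S: "past n d r \<alpha> S"
  shows "\<bar>prob_rand U B (\<lambda>R. F \<union> R \<in> S) - prob_rand U' B' (\<lambda>R. insert e (F \<union> R) \<in> S)\<bar> \<le> \<epsilon> k"
proof -
  define A where "A = bins \<alpha>"
  have fA: "finite A" using \<alpha>(2,3) unfolding A_def by (metis card.infinite not_one_le_zero)
  have fZ: "finite Z" by (rule finite_subset[OF Z3]) simp
  have cZ: "card Z \<le> 3"
  proof -
    have "card Z \<le> card {x, y, z}" by (rule card_mono[OF _ Z3]) simp
    also have "\<dots> \<le> 3" by (simp add: card_insert_if)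
    finally show ?thesis .
  qed
  from cp obtain D :: "(pairing \<times> pairing) pmf" and f G a0
    where C: "finite C" and a0: "a0 \<in> C"
    and p: "rand U B = bind_pmf D (\<lambda>\<omega>. map_pmf (f \<omega>) (pmf_of_set C))" and p': "rand U' B' = map_pmf G D"
    and all: "\<forall>\<omega>\<in>set_pmf D. f \<omega> a0 = insert e (G \<omega>) \<and> (\<forall>a\<in>C. (e \<in> f \<omega> a \<longrightarrow> a = a0) \<and>
         (\<forall>g\<in>f \<omega> a. g \<notin> insert e (G \<omega>) \<longrightarrow> g \<inter> Z \<noteq> {}) \<and>
         (\<forall>g\<in>G \<omega>. g \<notin> f \<omega> a \<longrightarrow> a \<in> g \<or> g \<inter> Z \<noteq> {}))"
    unfolding coupled_def by (elim conjE exE)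
  define K where "K = pair_pmf D (pmf_of_set C)"
  have Cne: "C \<noteq> {}" using a0 by blast
  have pK: "rand U B = map_pmf (\<lambda>w. f (fst w) (snd w)) K"
    by (simp add: p K_def pair_pmf_def map_pmf_def bind_assoc_pmf bind_return_pmf)
  have pK': "rand U' B' = map_pmf (\<lambda>w. G (fst w)) K"
  proof -
    have "map_pmf (\<lambda>w. G (fst w)) K = map_pmf G (map_pmf fst K)" by (simp add: map_pmf_comp)
    thus ?thesis unfolding p' K_def map_fst_pair_pmf by simp
  qed
  have PK: "prob_rand U B Q = measure_pmf.prob K {w. Q (f (fst w) (snd w))}" for Q
    by (simp add: pK measure_map_pmf vimage_def)
  have PK': "prob_rand U' B' Q = measure_pmf.prob K {w. Q (G (fst w))}" for Q
    by (simp add: pK' measure_map_pmf vimage_def)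
  \<comment> \<open>The four alternatives of \<open>cycles_difference\<close>, as events on the
    common space of the coupling.\<close>
  define E1 :: "((pairing \<times> pairing) \<times> prevertex) set" where "E1 = {w. \<exists>z\<in>Z. hit (f (fst w) (snd w)) A r z}"
  define E2 :: "((pairing \<times> pairing) \<times> prevertex) set" where "E2 = {w. \<exists>z\<in>Z. hit (G (fst w)) A r z}"
  define E3 :: "((pairing \<times> pairing) \<times> prevertex) set" where "E3 = {w. \<exists>z\<in>A \<times> {..<d}. hit (G (fst w)) A (r - 1) z}"
  define E4 :: "((pairing \<times> pairing) \<times> prevertex) set" where "E4 = {w. hit (G (fst w)) (insert (fst (snd w)) A) r (snd w)}"
  have "\<bar>prob_rand U B (\<lambda>R. F \<union> R \<in> S) - prob_rand U' B' (\<lambda>R. insert e (F \<union> R) \<in> S)\<bar>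
      \<le> measure_pmf.prob K {w. (F \<union> f (fst w) (snd w) \<in> S) \<noteq> (insert e (F \<union> G (fst w)) \<in> S)}"
    unfolding PK PK' by (rule prob_coupling)
  also have "\<dots> \<le> measure_pmf.prob K (((E1 \<union> E2) \<union> E3) \<union> E4)"
  proof (rule prob_mono_support)
    fix w assume w: "w \<in> set_pmf K" and ne: "w \<in> {w. (F \<union> f (fst w) (snd w) \<in> S) \<noteq> (insert e (F \<union> G (fst w)) \<in> S)}"
    have "set_pmf K = set_pmf D \<times> C" unfolding K_def set_pair_pmf set_pmf_of_set[OF Cne C] ..
    hence w': "fst w \<in> set_pmf D" "snd w \<in> C" using w by (simp_all add: mem_Times_iff)
    define R R' where "R = f (fst w) (snd w)" and "R' = G (fst w)"
    note all' = bspec[OF bspec[OF all w'(1), THEN conjunct2] w'(2), THEN conjunct2, folded R_def R'_def]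
    have R1: "g \<in> R \<Longrightarrow> g \<notin> insert e R' \<Longrightarrow> g \<inter> Z \<noteq> {}" for g
      using bspec[OF all'[THEN conjunct1], of g] by (rule mp)
    have R2: "g \<in> R' \<Longrightarrow> g \<notin> R \<Longrightarrow> snd w \<in> g \<or> g \<inter> Z \<noteq> {}" for g
      using bspec[OF all'[THEN conjunct2], of g] by (rule mp)
    have "(F \<union> R \<in> S) \<noteq> (insert e (F \<union> R') \<in> S)" using ne by (simp add: R_def R'_def)
    then obtain \<beta> where \<beta>: "\<beta> \<in> cycles_upto n d r" "\<beta> \<noteq> \<alpha>"
      "(\<beta> \<subseteq> F \<union> R \<and> \<not> \<beta> \<subseteq> insert e (F \<union> R')) \<or> (\<beta> \<subseteq> insert e (F \<union> R') \<and> \<not> \<beta> \<subseteq> F \<union> R)"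
      by (rule past_diff[OF S])
    have "(\<exists>z\<in>Z. hit R A r z) \<or> (\<exists>z\<in>Z. hit R' A r z) \<or>
      (\<exists>z\<in>A \<times> {..<d}. hit R' A (r - 1) z) \<or> hit R' (insert (fst (snd w)) A) r (snd w)"
      unfolding A_def by (rule cycles_difference[OF \<alpha>(1) \<beta>(1,2) F Z R1 R2 \<beta>(3)])
    thus "w \<in> ((E1 \<union> E2) \<union> E3) \<union> E4"
      unfolding E1_def E2_def E3_def E4_def R_def R'_def Un_iff mem_Collect_eq by argo
  qed
  also have "\<dots> \<le> measure_pmf.prob K E1 + measure_pmf.prob K E2 + measure_pmf.prob K E3 + measure_pmf.prob K E4"
  proof -
    have "measure_pmf.prob K (((E1 \<union> E2) \<union> E3) \<union> E4) \<le> measure_pmf.prob K ((E1 \<union> E2) \<union> E3) + measure_pmf.prob K E4"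
      by (intro measure_Un_le) auto
    moreover have "measure_pmf.prob K ((E1 \<union> E2) \<union> E3) \<le> measure_pmf.prob K (E1 \<union> E2) + measure_pmf.prob K E3"
      by (intro measure_Un_le) auto
    moreover have "measure_pmf.prob K (E1 \<union> E2) \<le> measure_pmf.prob K E1 + measure_pmf.prob K E2"
      by (intro measure_Un_le) auto
    ultimately show ?thesis by linarith
  qed
  also have "measure_pmf.prob K E1 \<le> real 3 * (6 * real k * real (d - 1) ^ (r - 1) / real n)"
    unfolding E1_def PK[symmetric, of "\<lambda>R. \<exists>z\<in>Z. hit R A r z"]
    using j r \<alpha>(2) by (intro prob_hits[OF inv _ _ _ fA _ fZ cZ]) (auto simp: A_def)
  also have "measure_pmf.prob K E2 \<le> real 3 * (6 * real k * real (d - 1) ^ (r - 1) / real n)"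
    unfolding E2_def PK'[symmetric, of "\<lambda>R. \<exists>z\<in>Z. hit R A r z"]
    using j r \<alpha>(2) by (intro prob_hits[OF inv' _ _ _ fA _ fZ cZ]) (auto simp: A_def)
  also have "measure_pmf.prob K E3 \<le> real (k * d) * (6 * real k * real (d - 1) ^ (r - 1 - 1) / real n)"
    unfolding E3_def PK'[symmetric, of "\<lambda>R. \<exists>z\<in>A \<times> {..<d}. hit R A (r - 1) z"]
    using j r2 \<alpha>(2) fA by (intro prob_hits[OF inv' _ _ _ fA]) (auto simp: A_def)
  also have "measure_pmf.prob K E4 \<le> 6 * real (k + 1) * real (d - 1) ^ (r - 1) / real n"
  proof -
    \<comment> \<open>The rematched point is independent of the rest, so it can be drawn first; then
      \<open>prob_hit\<close> applies with the bin of this fixed point added to the target.\<close>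
    have "K = bind_pmf (pmf_of_set C) (\<lambda>a. map_pmf (\<lambda>\<omega>. (\<omega>, a)) D)"
      unfolding K_def pair_pmf_def map_pmf_def by (rule bind_commute_pmf)
    moreover have "measure_pmf.prob (map_pmf (\<lambda>\<omega>. (\<omega>, a)) D) E4 \<le> 6 * real (k + 1) * real (d - 1) ^ (r - 1) / real n" for a
    proof -
      have "measure_pmf.prob (map_pmf (\<lambda>\<omega>. (\<omega>, a)) D) E4 = prob_rand U' B' (\<lambda>R. hit R (insert (fst a) A) r a)"
        by (simp add: p' measure_map_pmf vimage_def E4_def)
      also have "\<dots> \<le> 6 * real (card (insert (fst a) A)) * real (d - 1) ^ (r - 1) / real n"
        using j r fA by (intro prob_hit[OF inv']) auto
      also have "\<dots> \<le> 6 * real (k + 1) * real (d - 1) ^ (r - 1) / real n"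
        using fA \<alpha>(2) by (intro divide_right_mono mult_right_mono mult_left_mono of_nat_mono)
          (auto simp: A_def card_insert_if)
      finally show ?thesis .
    qed
    ultimately show ?thesis by (simp only:) (rule prob_bind_le)
  qed
  also have "real 3 * (6 * real k * real (d - 1) ^ (r - 1) / real n) + real 3 * (6 * real k * real (d - 1) ^ (r - 1) / real n) +
      real (k * d) * (6 * real k * real (d - 1) ^ (r - 1 - 1) / real n) + 6 * real (k + 1) * real (d - 1) ^ (r - 1) / real n \<le> \<epsilon> k"
  proof -
    define P where "P = real (d - 1) ^ (r - 1) / real n"
    have P0: "P \<ge> 0" by (simp add: P_def)
    have k1: "real k \<ge> 1" using \<alpha>(3) by simp
    have kk: "real k * 1 \<le> real k * real k" using k1 by (intro mult_left_mono) auto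
    have "real (k * d) * (6 * real k * real (d - 1) ^ (r - 1 - 1) / real n) =
        6 * (real k)\<^sup>2 * (real d * real (d - 1) ^ (r - 2)) / real n"
      by (simp add: power2_eq_square numeral_2_eq_2)
    also have "\<dots> \<le> 6 * (real k)\<^sup>2 * (3 / 2 * real (d - 1) ^ (r - 1)) / real n"
      using D_pow[OF r2] by (intro divide_right_mono mult_left_mono) auto
    also have "\<dots> = 9 * (real k)\<^sup>2 * P" by (simp add: P_def)
    finally have 3: "real (k * d) * (6 * real k * real (d - 1) ^ (r - 1 - 1) / real n) \<le> 9 * (real k)\<^sup>2 * P" .
    have "42 * real k + 6 + 9 * (real k)\<^sup>2 \<le> 57 * (real k)\<^sup>2"
      using kk k1 unfolding power2_eq_square by linarith
    hence 4: "(42 * real k + 6 + 9 * (real k)\<^sup>2) * P \<le> 57 * (real k)\<^sup>2 * P"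
      using P0 by (intro mult_right_mono)
    have 5: "(42 * real k + 6 + 9 * (real k)\<^sup>2) * P = 18 * real k * P + 18 * real k * P + 9 * (real k)\<^sup>2 * P + (6 * real k + 6) * P"
      by (simp add: algebra_simps)
    have 6: "real 3 * (6 * real k * real (d - 1) ^ (r - 1) / real n) = 18 * real k * P"
      by (simp add: P_def)
    have 7: "6 * real (k + 1) * real (d - 1) ^ (r - 1) / real n = (6 * real k + 6) * P"
      by (simp add: P_def algebra_simps)
    have 8: "\<epsilon> k = 57 * (real k)\<^sup>2 * P"
      by (simp add: P_def \<epsilon>_def)
    show ?thesis unfolding 6 7 8 using 3 4 5 by linarith
  qed
  finally show ?thesis by simp
qed

end

section \<open>Conditioning on a whole cycle at fixed types\<close>

context types
begin

definition bin :: "nat \<Rightarrow> prevertex set" where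
  "bin v = {v} \<times> \<tau> v"

text \<open>For each remaining step in the Hamiltonian part, the block of its arriving prevertex is
  still an original bin, and none of the remaining steps before it touches this bin. This puts the
  other element of the block in a bin of the cycle and shows that the pair is not itself a block.
  The departing prevertex may lie in a merged block.\<close>

definition ready :: "prevertex set \<Rightarrow> prevertex set set \<Rightarrow> step list \<Rightarrow> bool" where
  "ready U B p \<longleftrightarrow> distinct (ends p) \<and>
     (\<forall>t\<in>set p. (fst t \<in> U \<and> snd t \<in> U) \<or> (fst t \<in> \<Union>B \<and> snd t \<in> \<Union>B \<and> bin (fst (snd t)) \<in> B \<and> fst (fst t) \<noteq> fst (snd t))) \<and>
     sorted_wrt (\<lambda>s t. snd t \<in> H0 \<longrightarrow> fst (fst s) \<noteq> fst (snd t) \<and> fst (snd s) \<noteq> fst (snd t)) p"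

lemma mem_bin: "x \<in> H0 \<Longrightarrow> x \<in> bin (fst x)"
  by (cases x) (simp add: H0_def bin_def)

lemma bin_fst: "x \<in> bin v \<Longrightarrow> fst x = v"
  by (auto simp: bin_def)

text \<open>A Hamiltonian step only alters the two blocks that contain its own prevertices. The bins
  at which later Hamiltonian steps arrive contain neither, so they are still intact blocks.\<close>

lemma ready_step:
  assumes inv: "inv j U B" and j: "j \<le> 2 * r" and rd: "ready U B (t # p)"
  obtains Z C m U' B' where "coupled Z C m {fst t, snd t} (rand U B) (rand U' B')" "inv (Suc j) U' B'"
    "1 / real m \<le> wt (fst t) (snd t)" "1 / real m \<ge> wt (fst t) (snd t) / (1 + c)"
    "ready U' B' p" "Z \<subseteq> {fst t, snd t, mate B (snd t)}" "\<forall>z\<in>Z. fst z \<in> {fst (fst t), fst (snd t)}"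
proof -
  define x y where "x = fst t" and "y = snd t"
  have xy: "x \<noteq> y" and dp: "distinct (ends p)" and notin: "x \<notin> set (ends p)" "y \<notin> set (ends p)"
    using rd by (auto simp: ready_def x_def y_def)
  have c1: "(x \<in> U \<and> y \<in> U) \<or> (x \<in> \<Union>B \<and> y \<in> \<Union>B \<and> bin (fst y) \<in> B \<and> fst x \<noteq> fst y)"
    using rd unfolding ready_def by (simp add: x_def y_def)
  have cp: "(fst s \<in> U \<and> snd s \<in> U) \<or> (fst s \<in> \<Union>B \<and> snd s \<in> \<Union>B \<and> bin (fst (snd s)) \<in> B \<and> fst (fst s) \<noteq> fst (snd s))" if "s \<in> set p" for s
    using rd that unfolding ready_def by (simp only: list.set insert_iff ball_simps simp_thms)
  have srt: "sorted_wrt (\<lambda>s t. snd t \<in> H0 \<longrightarrow> fst (fst s) \<noteq> fst (snd t) \<and> fst (snd s) \<noteq> fst (snd t)) p"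
    and srt1: "\<And>s. s \<in> set p \<Longrightarrow> snd s \<in> H0 \<Longrightarrow> fst x \<noteq> fst (snd s) \<and> fst y \<noteq> fst (snd s)"
    using rd unfolding ready_def by (simp_all add: x_def y_def)
  have sp: "fst s \<noteq> x" "fst s \<noteq> y" "snd s \<noteq> x" "snd s \<noteq> y" if "s \<in> set p" for s
    using notin that unfolding set_ends by (metis UnI1 UnI2 imageI)+
  note M = inv_matching[OF inv]
  have my: "mate B y \<in> bin (fst y) \<and> y \<in> bin (fst y) \<and> bin (fst y) = {y, mate B y}" if "y \<in> \<Union>B" "bin (fst y) \<in> B"
  proof -
    have yb: "y \<in> bin (fst y)" using that(1) inv_subset(2)[OF inv] by (intro mem_bin) blast
    have m: "{y, mate B y} \<in> B" using mate_in[OF M that(1)] .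
    have "bin (fst y) = {y, mate B y}" by (rule matchings_disjoint[OF M that(2) m yb]) simp
    thus ?thesis by simp
  qed
  have nb: "(x \<in> U \<and> y \<in> U) \<or> (x \<in> \<Union>B \<and> y \<in> \<Union>B \<and> {x, y} \<notin> B)"
  proof (cases "x \<in> U \<and> y \<in> U")
    case False
    hence H: "x \<in> \<Union>B" "y \<in> \<Union>B" "bin (fst y) \<in> B" "fst x \<noteq> fst y" using c1 by blast+
    have "{x, y} \<notin> B"
    proof
      assume "{x, y} \<in> B"
      from matchings_disjoint[OF M this H(3), of y] my[OF H(2,3)] have "x \<in> bin (fst y)" by blast
      thus False using bin_fst H(4) by blast
    qed
    thus ?thesis using H by blast
  qed blast
  obtain Z C m U' B' where S: "coupled Z C m {x, y} (rand U B) (rand U' B')" "inv (Suc j) U' B'"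
    "1 / real m \<le> wt x y" "1 / real m \<ge> wt x y / (1 + c)"
    "U' \<union> \<Union>B' = U \<union> \<Union>B - {x, y}" "C \<subseteq> U \<union> \<Union>B" "Z \<subseteq> {x, y, mate B y}"
    and I: "if x \<in> U \<and> y \<in> U then U' = U - {x, y} \<and> B' = B \<and> Z = {x, y} else U' = U \<and>
        B' = insert {mate B y, mate B x} (B - {{y, mate B y}} - {{x, mate B x}})"
    by (rule pair_step[OF inv j xy nb])
  have Zb: "fst z \<in> {fst x, fst y}" if "z \<in> Z" for z
  proof (cases "x \<in> U \<and> y \<in> U")
    case True
    hence "Z = {x, y}" using I by simp
    thus ?thesis using that by blast
  next
    case False
    hence "y \<in> \<Union>B" "bin (fst y) \<in> B" using c1 by blast+
    hence "fst (mate B y) = fst y" using my bin_fst by blast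
    thus ?thesis using that S(7) by auto
  qed
  have "(fst s \<in> U' \<and> snd s \<in> U') \<or> (fst s \<in> \<Union>B' \<and> snd s \<in> \<Union>B' \<and> bin (fst (snd s)) \<in> B' \<and> fst (fst s) \<noteq> fst (snd s))"
    if s: "s \<in> set p" for s
  proof (cases "x \<in> U \<and> y \<in> U")
    case True
    hence UB: "U' = U - {x, y}" "B' = B" using I by simp_all
    show ?thesis using cp[OF s] sp[OF s] unfolding UB by blast
  next
    case False
    hence UB: "U' = U" "B' = insert {mate B y, mate B x} (B - {{y, mate B y}} - {{x, mate B x}})" using I by simp_all
    have Hx: "x \<in> \<Union>B" "y \<in> \<Union>B" "bin (fst y) \<in> B" using False c1 by blast+
    from cp[OF s] show ?thesis
    proof
      assume "fst s \<in> U \<and> snd s \<in> U"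
      thus ?thesis using UB by blast
    next
      assume H: "fst s \<in> \<Union>B \<and> snd s \<in> \<Union>B \<and> bin (fst (snd s)) \<in> B \<and> fst (fst s) \<noteq> fst (snd s)"
      have inB': "w \<in> \<Union>B'" if "w \<in> \<Union>B" "w \<noteq> x" "w \<noteq> y" for w
      proof -
        have "w \<in> U' \<union> \<Union>B'" unfolding S(5) using that by blast
        moreover have "w \<notin> U'" unfolding UB(1) using inv_disjoint[OF inv, of w] that(1) by blast
        ultimately show ?thesis by blast
      qed
      have sH: "snd s \<in> H0" using H inv_subset(2)[OF inv] by blast
      have "x \<notin> bin (fst (snd s))" "y \<notin> bin (fst (snd s))" using srt1[OF s sH] bin_fst by blast+
      hence "bin (fst (snd s)) \<noteq> {y, mate B y}" "bin (fst (snd s)) \<noteq> {x, mate B x}" by blast+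
      hence "bin (fst (snd s)) \<in> B'" unfolding UB(2) using H by blast
      thus ?thesis using inB' H sp[OF s] by blast
    qed
  qed
  hence "ready U' B' p" unfolding ready_def using dp srt by blast
  from that[of Z C m U' B', folded x_def y_def, OF S(1-4) this S(7)] Zb show ?thesis by blast
qed

text \<open>Multiplying the exact conditional probabilities gives the probability \<open>w\<close>
  of the pairs, and adding up the errors of \<open>step_close\<close> compares the unconditioned law
  with the conditioned one. The pairs \<open>F\<close> fixed earlier are kept in the pairing, so
  that \<open>S\<close> is always tested on the whole of it.\<close>

lemma run:
  assumes "inv j U B" "j + length p \<le> r" "r \<ge> 2" "ready U B p" "F \<union> edges p \<subseteq> \<alpha>"
    and \<alpha>: "\<alpha> \<in> cycles_upto n d r" "card (bins \<alpha>) = k" "k \<ge> 1"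
  shows "\<exists>w U' B'. inv (j + length p) U' B' \<and> w \<le> weight wt p \<and> w \<ge> weight wt p / (1 + c) ^ length p \<and> w \<ge> 0 \<and>
     (\<forall>S. prob_rand U B (\<lambda>R. edges p \<subseteq> R \<and> R \<in> S) = w * prob_rand U' B' (\<lambda>R. edges p \<union> R \<in> S)) \<and>
     (\<forall>S. past n d r \<alpha> S \<longrightarrow> \<bar>prob_rand U B (\<lambda>R. F \<union> R \<in> S) - prob_rand U' B' (\<lambda>R. F \<union> edges p \<union> R \<in> S)\<bar> \<le> real (length p) * \<epsilon> k)"
  using assms(1,2,4,5)
proof (induction p arbitrary: j U B F)
  case Nil
  thus ?case by (intro exI[of _ 1] exI[of _ U] exI[of _ B]) simp
next
  case (Cons t p)
  define e where "e = {fst t, snd t}"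
  have j: "j \<le> 2 * r" "Suc j \<le> r" "Suc j + length p \<le> r" using Cons.prems(2) by simp_all
  obtain Z C m U1 B1 where S: "coupled Z C m e (rand U B) (rand U1 B1)" "inv (Suc j) U1 B1"
    "1 / real m \<le> wt (fst t) (snd t)" "1 / real m \<ge> wt (fst t) (snd t) / (1 + c)"
    "ready U1 B1 p" "Z \<subseteq> {fst t, snd t, mate B (snd t)}" and Zb: "\<forall>z\<in>Z. fst z \<in> {fst (fst t), fst (snd t)}"
    unfolding e_def by (rule ready_step[OF Cons.prems(1) j(1) Cons.prems(3)])
  have e\<alpha>: "e \<in> \<alpha>" and F1: "insert e F \<subseteq> \<alpha>" and F1p: "insert e F \<union> edges p \<subseteq> \<alpha>"
    using Cons.prems(4) by (simp_all add: e_def)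
  have Zb': "fst z \<in> bins \<alpha>" if "z \<in> Z" for z
    using bspec[OF Zb that] bins_mem[OF e\<alpha>, of "fst t"] bins_mem[OF e\<alpha>, of "snd t"]
    unfolding e_def by (elim insertE) simp_all
  have enp: "e \<notin> edges p"
  proof
    assume "e \<in> edges p"
    hence "fst t \<in> set (ends p)" using edges_in_ends[of e p] unfolding e_def by blast
    thus False using Cons.prems(3) by (simp add: ready_def)
  qed
  from Cons.IH[OF S(2) j(3) S(5) F1p] obtain w U' B' where IH:
     "inv (Suc j + length p) U' B'" "w \<le> weight wt p" "w \<ge> weight wt p / (1 + c) ^ length p" "w \<ge> 0"
     "\<And>S. prob_rand U1 B1 (\<lambda>R. edges p \<subseteq> R \<and> R \<in> S) = w * prob_rand U' B' (\<lambda>R. edges p \<union> R \<in> S)"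
     "\<And>S. past n d r \<alpha> S \<Longrightarrow> \<bar>prob_rand U1 B1 (\<lambda>R. insert e F \<union> R \<in> S) - prob_rand U' B' (\<lambda>R. insert e F \<union> edges p \<union> R \<in> S)\<bar> \<le> real (length p) * \<epsilon> k"
    by blast
  have c0: "1 + c > 0" using c_nonneg by linarith
  show ?case
  proof (intro exI[of _ "1 / real m * w"] exI[of _ U'] exI[of _ B'] conjI allI impI)
    show "inv (j + length (t # p)) U' B'" using IH(1) by simp
    show "1 / real m * w \<le> weight wt (t # p)"
      unfolding weight_Cons using S(3) IH(2,4) wt_nonneg by (intro mult_mono) auto
    show "weight wt (t # p) / (1 + c) ^ length (t # p) \<le> 1 / real m * w"
    proof -
      have "(wt (fst t) (snd t) / (1 + c)) * (weight wt p / (1 + c) ^ length p) \<le> 1 / real m * w"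
        using S(4) IH(3) wt_nonneg weight_nonneg[OF wt_nonneg] c0 by (intro mult_mono) auto
      thus ?thesis by simp
    qed
    show "0 \<le> 1 / real m * w" using IH(4) by simp
  next
    fix S'
    have "prob_rand U B (\<lambda>R. edges (t # p) \<subseteq> R \<and> R \<in> S') =
        prob_rand U B (\<lambda>R. e \<in> R \<and> R \<in> {R. edges p \<subseteq> R \<and> R \<in> S'})"
      by (intro arg_cong[where f = "measure_pmf.prob (rand U B)"] Collect_cong) (simp add: e_def)
    also have "\<dots> = 1 / real m * prob_rand U1 B1 (\<lambda>R. insert e R \<in> {R. edges p \<subseteq> R \<and> R \<in> S'})"
      by (rule coupled_prob[OF S(1)])
    also have "prob_rand U1 B1 (\<lambda>R. insert e R \<in> {R. edges p \<subseteq> R \<and> R \<in> S'}) =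
        prob_rand U1 B1 (\<lambda>R. edges p \<subseteq> R \<and> R \<in> {R. insert e R \<in> S'})"
      using enp by (intro arg_cong[where f = "measure_pmf.prob (rand U1 B1)"] Collect_cong) (simp add: subset_insert)
    also have "\<dots> = w * prob_rand U' B' (\<lambda>R. edges p \<union> R \<in> {R. insert e R \<in> S'})"
      by (rule IH(5))
    finally show "prob_rand U B (\<lambda>R. edges (t # p) \<subseteq> R \<and> R \<in> S') =
        1 / real m * w * prob_rand U' B' (\<lambda>R. edges (t # p) \<union> R \<in> S')"
      by (simp add: e_def)
  next
    fix S' assume past: "past n d r \<alpha> S'"
    have "\<bar>prob_rand U B (\<lambda>R. F \<union> R \<in> S') - prob_rand U1 B1 (\<lambda>R. insert e (F \<union> R) \<in> S')\<bar> \<le> \<epsilon> k"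
      by (rule step_close[OF Cons.prems(1) S(2) j(2) assms(3) S(1,6) \<alpha> F1 Zb' past])
    moreover have "\<bar>prob_rand U1 B1 (\<lambda>R. insert e (F \<union> R) \<in> S') - prob_rand U' B' (\<lambda>R. F \<union> edges (t # p) \<union> R \<in> S')\<bar> \<le> real (length p) * \<epsilon> k"
      using IH(6)[OF past] by (simp add: e_def)
    ultimately show "\<bar>prob_rand U B (\<lambda>R. F \<union> R \<in> S') - prob_rand U' B' (\<lambda>R. F \<union> edges (t # p) \<union> R \<in> S')\<bar> \<le> real (length (t # p)) * \<epsilon> k"
      by (simp add: algebra_simps)
  qed
qed

text \<open>The bin in which a step arrives is the one from which the next step departs, so no
  earlier step has met it. The exception is the last step, which returns to the first bin; it is
  harmless because it belongs to the uniform part.\<close>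

lemma ready_cycle:
  assumes s: "cyc n d (q @ [t])" and con: "\<And>u. u \<in> set (q @ [t]) \<Longrightarrow> (fst u \<in> U0 \<and> snd u \<in> U0) \<or> (fst u \<in> H0 \<and> snd u \<in> H0)"
    and t: "snd t \<in> U0"
  shows "ready U0 B0 (q @ [t])"
proof -
  define s' where "s' = q @ [t]"
  define k where "k = length q"
  have len: "length s' = Suc k" by (simp add: s'_def k_def)
  have lastU: "snd (s' ! k) \<in> U0" using t by (simp add: s'_def k_def)
  have ch: "fst (snd (s' ! i)) = fst (fst (s' ! Suc i))" if "i < k" for i
    using successively_nth[OF cyc_chain[OF s, folded s'_def, unfolded chain_def], of i] that len by simp
  have di: "distinct (map (\<lambda>t. fst (fst t)) s')" "distinct (map (\<lambda>t. fst (snd t)) s')"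
    using s cyc_distinct_snd[OF s] by (simp_all only: s'_def cyc_def simp_thms)
  have ne1: "fst (fst (s' ! i)) \<noteq> fst (snd (s' ! j))" if "i \<le> j" "j < Suc k" "snd (s' ! j) \<in> H0" for i j
  proof -
    have "snd (s' ! k) \<notin> H0" using lastU unfolding U0_def by simp
    hence "j \<noteq> k" using that(3) by metis
    hence j: "j < k" using that(2) by simp
    have "fst (fst (s' ! i)) \<noteq> fst (fst (s' ! Suc j))"
      using di(1) that(1) j len nth_eq_iff_index_eq[OF di(1), of i "Suc j"] by simp
    thus ?thesis using ch[OF j] by simp
  qed
  have ne2: "fst (snd (s' ! i)) \<noteq> fst (snd (s' ! j))" if "i < j" "j < Suc k" for i j
    using that len nth_eq_iff_index_eq[OF di(2), of i j] by simp
  have "sorted_wrt (\<lambda>s t. snd t \<in> H0 \<longrightarrow> fst (fst s) \<noteq> fst (snd t) \<and> fst (snd s) \<noteq> fst (snd t)) s'"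
    unfolding sorted_wrt_iff_nth_less len using ne1 ne2 by (simp add: less_imp_le)
  moreover have "(fst u \<in> U0 \<and> snd u \<in> U0) \<or> (fst u \<in> \<Union>B0 \<and> snd u \<in> \<Union>B0 \<and> bin (fst (snd u)) \<in> B0 \<and> fst (fst u) \<noteq> fst (snd u))"
    if u: "u \<in> set s'" for u
  proof -
    consider "fst u \<in> U0 \<and> snd u \<in> U0" | "fst u \<in> H0" "snd u \<in> H0" using con[of u] u unfolding s'_def by blast
    thus ?thesis
    proof cases
      case 2
      obtain i where i: "i < Suc k" "u = s' ! i" using u[unfolded in_set_conv_nth len] by blast
      have "fst (fst u) \<noteq> fst (snd u)" using ne1[of i i] i 2 by simp
      moreover have "bin (fst (snd u)) \<in> B0"
      proof -
        have "h = 2" using inv_h[OF inv_start, of "snd u"] 2(2) unfolding Union_B0 by blast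
        hence h0: "h \<noteq> 0" by simp
        have "fst (snd u) < n" using 2(2) by (auto simp: H0_def)
        thus ?thesis unfolding bin_def B0_image[OF h0] by (intro imageI) simp
      qed
      ultimately show ?thesis using 2 unfolding Union_B0 by blast
    qed blast
  qed
  moreover have "distinct (ends s')" using s unfolding cyc_def s'_def by blast
  ultimately show ?thesis unfolding ready_def s'_def by blast
qed

text \<open>The cycle has two prevertices in each of its bins, and these are then all the
  Hamiltonian ones there, so the bins of the cycle are closed under the Hamiltonian matching. As
  there are fewer than n of them, irreducibility is violated.\<close>

lemma all_H_zero:
  assumes s: "cyc n d s" and H: "\<And>t. t \<in> set s \<Longrightarrow> fst t \<in> H0 \<and> snd t \<in> H0" and k: "length s < n"
  shows "prob_rand U0 B0 (\<lambda>R. edges s \<subseteq> R) = 0"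
proof (rule prob_zero_support)
  fix R assume R: "R \<in> set_pmf (rand U0 B0)"
  show "R \<notin> {R. edges s \<subseteq> R}"
  proof
    assume "R \<in> {R. edges s \<subseteq> R}"
    hence sub: "edges s \<subseteq> R" by simp
    obtain Q M where QM: "Q \<in> matchings U0" "M \<in> ham B0" "R = Q \<union> M" using inv_support[OF inv_start R] .
    have ends: "set (ends s) \<subseteq> H0" unfolding set_ends using H by blast
    have sM: "edges s \<subseteq> M"
    proof (rule edges_subsetI)
      fix t assume t: "t \<in> set s"
      have "fst t \<notin> U0" using H[OF t] unfolding U0_def by blast
      hence "{fst t, snd t} \<notin> Q" using matchings_mem[OF QM(1)] by blast
      thus "{fst t, snd t} \<in> M" using in_edges[OF t] sub QM(3) by blast
    qed
    have sne: "s \<noteq> []" using s by (simp add: cyc_def)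
    have x0: "fst (hd s) \<in> H0" using H hd_in_set[OF sne] by blast
    have h2: "h = 2" using inv_h[OF inv_start, of "fst (hd s)"] x0 unfolding Union_B0 by blast
    hence h0: "h \<noteq> 0" by simp
    define A where "A = bins (edges s)"
    define S where "S = bin ` A"
    have fA: "finite A" unfolding A_def bins_edges[OF s] by simp
    have cA: "card A = length s" unfolding A_def by (rule card_bins[OF s])
    have An: "A \<subseteq> {..<n}"
    proof
      fix v assume "v \<in> A"
      then obtain z where "v = fst z" "z \<in> set (ends s)" unfolding A_def bins_def Union_edges by (rule imageE)
      thus "v \<in> {..<n}" using ends H0_subset unfolding V_def by (auto simp: mem_Times_iff)
    qed
    have SB: "S \<subseteq> B0" unfolding S_def B0_image[OF h0] bin_def using An by (rule image_mono)
    have cS: "card (\<Union>S) \<le> card (set (ends s))"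
    proof -
      have "card (\<Union>S) \<le> (\<Sum>v\<in>A. card (bin v))" unfolding S_def by (rule card_UN_le[OF fA])
      also have "\<dots> = (\<Sum>v\<in>A. 2)"
        using An \<tau> h2 by (intro sum.cong refl) (auto simp: bin_def card_cartesian_product)
      also have "\<dots> = 2 * length s" using cA by simp
      also have "\<dots> = card (set (ends s))"
      proof -
        have "length (ends s) = 2 * length s" by (induction s) auto
        thus ?thesis using s distinct_card[of "ends s"] by (simp add: cyc_def)
      qed
      finally show ?thesis .
    qed
    have sub1: "set (ends s) \<subseteq> \<Union>S"
    proof
      fix z assume z: "z \<in> set (ends s)"
      hence "fst z \<in> A" unfolding A_def bins_def Union_edges by (rule imageI)
      moreover have "z \<in> bin (fst z)" using ends z by (intro mem_bin) blast
      ultimately show "z \<in> \<Union>S" unfolding S_def by blast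
    qed
    have "finite (\<Union>S)" using finite_subset[of "\<Union>S" H0] SB Union_B0 finite_H0 by blast
    from card_seteq[OF this sub1 cS] have eq: "\<Union>S = \<Union>(edges s)" unfolding Union_edges by simp
    have "S = B0"
    proof (rule ham_irreducible[OF QM(2) SB])
      show "S \<noteq> {}" using cA sne fA unfolding S_def by auto
      fix g assume g: "g \<in> M" "g \<inter> \<Union>S \<noteq> {}"
      then obtain v f where v: "v \<in> g" "v \<in> f" "f \<in> edges s" unfolding eq by blast
      have "g = f" using matchings_disjoint[OF ham_matchings[OF QM(2)] g(1) _ v(1,2)] v(3) sM by blast
      thus "g \<subseteq> \<Union>S" unfolding eq using v(3) by blast
    qed
    moreover have "card S \<le> length s" unfolding S_def cA[symmetric] by (rule card_image_le[OF fA])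
    ultimately show False using card_B0[OF h2] k by simp
  qed
qed

text \<open>
  The approximate probability of the cycle \<open>edges s\<close> for a fixed choice \<open>\<tau>\<close> of the types. A short
  cycle cannot consist of pairs of the Hamiltonian cycle only, which gives the correction term of \<open>\<mu>\<close>.
\<close>

definition approx :: "step list \<Rightarrow> real" where
  "approx s = (if h = 2 \<and> (\<forall>t\<in>set s. fst t \<in> H0 \<and> snd t \<in> H0) then 0 else weight wt s / (1 + c) ^ length s)"

lemma weight_zero: "t \<in> set s \<Longrightarrow> w (fst t) (snd t) = 0 \<Longrightarrow> weight w s = 0"
  by (induction s) auto

lemma weight_append: "weight w (a @ b) = weight w a * weight w b"
  by (simp add: weight_def)

text \<open>A cycle with a pair of mixed type or with Hamiltonian pairs only has probability 0. Any
  other one can be rotated so as to end with a pair of the uniform part, and then \<open>run\<close>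
  applies.\<close>

lemma fixed_types:
  assumes s: "cyc n d s" "length s = k" "k \<le> r" and r2: "r \<ge> 2" and \<alpha>: "edges s = \<alpha>" "\<alpha> \<in> cycles_upto n d r"
  shows "past n d r \<alpha> S \<Longrightarrow> \<bar>prob_rand U0 B0 (\<lambda>R. \<alpha> \<subseteq> R \<and> R \<in> S) - prob_rand U0 B0 (\<lambda>R. \<alpha> \<subseteq> R) * prob_rand U0 B0 (\<lambda>R. R \<in> S)\<bar>
      \<le> prob_rand U0 B0 (\<lambda>R. \<alpha> \<subseteq> R) * (real k * \<epsilon> k)" (is "_ \<Longrightarrow> ?A")
    and "approx s \<le> prob_rand U0 B0 (\<lambda>R. \<alpha> \<subseteq> R)" "prob_rand U0 B0 (\<lambda>R. \<alpha> \<subseteq> R) \<le> (1 + c) ^ k * approx s"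
proof -
  have c0: "1 + c > 0" using c_nonneg by linarith
  have sne: "s \<noteq> []" using s(1) by (simp add: cyc_def)
  have k1: "k \<ge> 1" using sne s(2) by (cases s) auto
  have ab: "approx s \<ge> 0" unfolding approx_def using weight_nonneg[OF wt_nonneg] c0 by simp
  have zero: "?A" if "prob_rand U0 B0 (\<lambda>R. \<alpha> \<subseteq> R) = 0"
  proof -
    have "prob_rand U0 B0 (\<lambda>R. \<alpha> \<subseteq> R \<and> R \<in> S) \<le> prob_rand U0 B0 (\<lambda>R. \<alpha> \<subseteq> R)"
      by (intro measure_pmf.finite_measure_mono) auto
    thus ?thesis using that measure_nonneg[of "measure_pmf (rand U0 B0)" "{R. \<alpha> \<subseteq> R \<and> R \<in> S}"] by simp
  qed
  have "(past n d r \<alpha> S \<longrightarrow> ?A) \<and> approx s \<le> prob_rand U0 B0 (\<lambda>R. \<alpha> \<subseteq> R) \<and> prob_rand U0 B0 (\<lambda>R. \<alpha> \<subseteq> R) \<le> (1 + c) ^ k * approx s"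
  proof (cases "\<forall>t\<in>set s. (fst t \<in> U0 \<and> snd t \<in> U0) \<or> (fst t \<in> H0 \<and> snd t \<in> H0)")
    case False
    then obtain t where t: "t \<in> set s" "\<not> ((fst t \<in> U0 \<and> snd t \<in> U0) \<or> (fst t \<in> H0 \<and> snd t \<in> H0))" by blast
    have "\<not> (fst t \<in> U0 \<and> snd t \<in> U0)" "\<not> (fst t \<in> H0 \<and> snd t \<in> H0)" using t(2) by blast+
    hence "wt (fst t) (snd t) = 0" unfolding wt_def by (simp only: if_False)
    hence w0: "weight wt s = 0" by (rule weight_zero[OF t(1)])
    have "prob_rand U0 B0 (\<lambda>R. edges s \<subseteq> R) \<le> weight wt s"
      using s by (intro prob_edges[OF inv_start]) (auto simp: cyc_def)
    hence p0: "prob_rand U0 B0 (\<lambda>R. \<alpha> \<subseteq> R) = 0" unfolding \<alpha>(1) w0 using measure_nonneg by (rule antisym)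
    thus ?thesis using zero by (simp add: approx_def w0)
  next
    case con: True
    show ?thesis
    proof (cases "\<forall>t\<in>set s. fst t \<in> H0 \<and> snd t \<in> H0")
      case True
      have "r < n" using n_ge r by linarith
      hence p0: "prob_rand U0 B0 (\<lambda>R. \<alpha> \<subseteq> R) = 0"
        using all_H_zero[OF s(1)] True s(2,3) \<alpha>(1) by simp
      have x0: "fst (hd s) \<in> H0" using True hd_in_set[OF sne] by blast
      have h2: "h = 2" using inv_h[OF inv_start, of "fst (hd s)"] x0 unfolding Union_B0 by blast
      have "approx s = 0" unfolding approx_def by (rule if_P) (use h2 True in blast)
      thus ?thesis using zero[OF p0] p0 by simp
    next
      case False
      then obtain t where t: "t \<in> set s" "fst t \<in> U0" "snd t \<in> U0" using con by blast
      obtain a b where abt: "s = a @ t # b" using split_list[OF t(1)] by blast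
      have "cyc n d ((a @ [t]) @ b)" using s(1) unfolding abt by simp
      hence cy: "cyc n d ((b @ a) @ [t])" using cyc_rotate by fastforce
      define p where "p = (b @ a) @ [t]"
      have pe: "edges p = \<alpha>" "length p = k" "set p = set s" "weight wt p = weight wt s"
        unfolding p_def using \<alpha>(1) s(2) by (auto simp: abt weight_append)
      have rd: "ready U0 B0 p" unfolding p_def
      proof (rule ready_cycle[OF cy])
        fix u assume "u \<in> set ((b @ a) @ [t])"
        hence "u \<in> set s" using pe(3) unfolding p_def by blast
        thus "(fst u \<in> U0 \<and> snd u \<in> U0) \<or> (fst u \<in> H0 \<and> snd u \<in> H0)" by (rule bspec[OF con])
      qed (rule t(3))
      have cb: "card (bins \<alpha>) = k" using card_bins[OF s(1)] \<alpha>(1) s(2) by simp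
      from run[OF inv_start _ r2 rd _ \<alpha>(2) cb k1, of "{}"] obtain w U' B' where w:
        "w \<le> weight wt p" "w \<ge> weight wt p / (1 + c) ^ k" "w \<ge> 0"
        "\<And>S. prob_rand U0 B0 (\<lambda>R. \<alpha> \<subseteq> R \<and> R \<in> S) = w * prob_rand U' B' (\<lambda>R. \<alpha> \<union> R \<in> S)"
        "\<And>S. past n d r \<alpha> S \<Longrightarrow> \<bar>prob_rand U0 B0 (\<lambda>R. R \<in> S) - prob_rand U' B' (\<lambda>R. \<alpha> \<union> R \<in> S)\<bar> \<le> real k * \<epsilon> k"
        using s(3) by (simp only: pe Un_empty_left order_refl add_0 simp_thms) blast
      have pw: "prob_rand U0 B0 (\<lambda>R. \<alpha> \<subseteq> R) = w" using w(4)[of UNIV] by simp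
      have ap: "approx s = weight wt s / (1 + c) ^ k" unfolding approx_def s(2) by (rule if_not_P) (use False in blast)
      have "?A" if "past n d r \<alpha> S"
      proof -
        have "\<bar>w * prob_rand U' B' (\<lambda>R. \<alpha> \<union> R \<in> S) - w * prob_rand U0 B0 (\<lambda>R. R \<in> S)\<bar> =
            w * \<bar>prob_rand U0 B0 (\<lambda>R. R \<in> S) - prob_rand U' B' (\<lambda>R. \<alpha> \<union> R \<in> S)\<bar>"
          using w(3) by (simp add: abs_mult abs_minus_commute flip: right_diff_distrib)
        also have "\<dots> \<le> w * (real k * \<epsilon> k)" using w(5)[OF that] w(3) by (rule mult_left_mono)
        finally show ?thesis unfolding pw w(4) .
      qed
      thus ?thesis unfolding pw ap using w(1,2) c0 by (simp add: pe)
    qed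
  qed
  thus "past n d r \<alpha> S \<Longrightarrow> ?A" "approx s \<le> prob_rand U0 B0 (\<lambda>R. \<alpha> \<subseteq> R)"
    "prob_rand U0 B0 (\<lambda>R. \<alpha> \<subseteq> R) \<le> (1 + c) ^ k * approx s" by blast+
qed

end

section \<open>Changing the types inside a set of bins\<close>

context types
begin

lemma U0_subset: "U0 \<subseteq> V"
  unfolding U0_def by (rule Diff_subset)

lemma support_subset: "R \<in> set_pmf (rand U0 B0) \<Longrightarrow> \<Union>R \<subseteq> V"
  using inv_support_Union[OF inv_start, of R] U0_subset H0_subset unfolding Union_B0 by simp

text \<open>The terms 9 \<open>k\<^sup>2\<close> and 6 k d belong to the two alternatives in
  \<open>near_cycle\<close>: k d starting points aim at k bins with r - 1 pairs, or each at its own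
  bin with r pairs.\<close>

definition touch :: "nat \<Rightarrow> real" where
  "touch k = (9 * (real k)\<^sup>2 + 6 * real k * real d) * real (d - 1) ^ (r - 1) / real n"

text \<open>Implied by the presence of a short cycle through a bin of \<open>A\<close>, by
  \<open>cycle_hit_own\<close>, and stated in terms of \<open>hit\<close> so that
  \<open>prob_hit\<close> applies.\<close>

definition near_cycle :: "nat set \<Rightarrow> pairing \<Rightarrow> bool" where
  "near_cycle A R \<longleftrightarrow> (\<exists>z\<in>A \<times> {..<d}. hit R A (r - 1) z) \<or> (\<exists>z\<in>A \<times> {..<d}. hit R {fst z} r z)"

lemma prob_near_cycle:
  assumes A: "finite A" "card A = k" and r2: "r \<ge> 2"
  shows "prob_rand U0 B0 (near_cycle A) \<le> touch k"
proof -
  define P where "P = real (d - 1) ^ (r - 1) / real n"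
  have "{R. near_cycle A R} = {R. \<exists>z\<in>A \<times> {..<d}. hit R A (r - 1) z} \<union> (\<Union>z\<in>A \<times> {..<d}. {R. hit R {fst z} r z})"
    unfolding near_cycle_def by blast
  hence "prob_rand U0 B0 (near_cycle A) \<le> prob_rand U0 B0 (\<lambda>R. \<exists>z\<in>A \<times> {..<d}. hit R A (r - 1) z)
      + measure_pmf.prob (rand U0 B0) (\<Union>z\<in>A \<times> {..<d}. {R. hit R {fst z} r z})"
    by (simp only:) (intro measure_Un_le, auto)
  also have "prob_rand U0 B0 (\<lambda>R. \<exists>z\<in>A \<times> {..<d}. hit R A (r - 1) z) \<le> real (k * d) * (6 * real k * real (d - 1) ^ (r - 1 - 1) / real n)"
    using r2 A by (intro prob_hits[OF inv_start]) auto
  also have "real (k * d) * (6 * real k * real (d - 1) ^ (r - 1 - 1) / real n) =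
        6 * (real k)\<^sup>2 * (real d * real (d - 1) ^ (r - 2)) / real n"
    by (simp add: power2_eq_square numeral_2_eq_2)
  also have "\<dots> \<le> 6 * (real k)\<^sup>2 * (3 / 2 * real (d - 1) ^ (r - 1)) / real n"
    using D_pow[OF r2] by (intro divide_right_mono mult_left_mono) auto
  also have "\<dots> = 9 * (real k)\<^sup>2 * P" by (simp add: P_def)
  also have "measure_pmf.prob (rand U0 B0) (\<Union>z\<in>A \<times> {..<d}. {R. hit R {fst z} r z}) \<le>
      (\<Sum>z\<in>A \<times> {..<d}. prob_rand U0 B0 (\<lambda>R. hit R {fst z} r z))"
    using A by (intro prob_UN_le) simp
  also have "\<dots> \<le> (\<Sum>z\<in>A \<times> {..<d}. 6 * P)"
  proof (rule sum_mono)
    fix z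
    show "prob_rand U0 B0 (\<lambda>R. hit R {fst z} r z) \<le> 6 * P"
      using prob_hit[OF inv_start _ _ _ , of r "{fst z}" z] r by (simp add: P_def)
  qed
  also have "\<dots> = 6 * real k * real d * P" using A by (simp add: card_cartesian_product)
  finally show ?thesis by (simp add: touch_def P_def algebra_simps add_divide_distrib)
qed

lemma near_cycleI:
  assumes "\<beta> \<in> cycles_upto n d r" "\<beta> \<subseteq> R" "g \<in> \<beta>" "z \<in> g" "fst z \<in> A"
  shows "near_cycle A R"
proof -
  obtain t where t: "cyc n d t" "length t \<le> r" "edges t = \<beta>" using cycle_steps_upto[OF assms(1)] .
  have z: "z \<in> \<Union>(edges t)" unfolding t(3) using assms(3,4) by blast
  hence "z \<in> {..<n} \<times> {..<d}" using t(1) unfolding Union_edges cyc_def by blast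
  hence zA: "z \<in> A \<times> {..<d}" using assms(5) by (simp add: mem_Times_iff)
  have "hit R A (r - 1) z \<or> hit R {fst z} r z"
    by (rule cycle_hit_own[OF t(1) z assms(5) _ t(2)]) (use assms(2) t(3) in simp)
  thus ?thesis unfolding near_cycle_def using zA by blast
qed

end

lemma subset_bij:
  assumes "finite X" "S \<subseteq> X" "S' \<subseteq> X" "card S = card S'"
  shows "\<exists>\<pi>. bij_betw \<pi> X X \<and> \<pi> ` S = S'"
proof -
  have fin: "finite S" "finite S'" using assms finite_subset by blast+
  obtain f where f: "bij_betw f S S'" using finite_same_card_bij[OF fin assms(4)] by blast
  have "card (X - S) = card (X - S')" using assms fin by (simp add: card_Diff_subset)
  then obtain g where g: "bij_betw g (X - S) (X - S')" using finite_same_card_bij[of "X - S" "X - S'"] assms(1) by blast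
  define \<pi> where "\<pi> x = (if x \<in> S then f x else g x)" for x
  have 1: "bij_betw \<pi> S S'" using f by (subst bij_betw_cong[of S _ f]) (simp_all add: \<pi>_def)
  have 2: "bij_betw \<pi> (X - S) (X - S')" using g by (subst bij_betw_cong[of "X - S" _ g]) (simp_all add: \<pi>_def)
  have "bij_betw \<pi> (S \<union> (X - S)) (S' \<union> (X - S'))" by (rule bij_betw_combine[OF 1 2]) blast
  moreover have "S \<union> (X - S) = X" "S' \<union> (X - S') = X" using assms by blast+
  ultimately show ?thesis using 1 by (metis bij_betw_imp_surj_on)
qed

text \<open>Types matter only up to names: permuting the prevertices inside each bin of
  \<open>A\<close> carries one choice of types to the other, and both laws are uniform.\<close>

lemma relabel:
  assumes T: "types n d h r \<tau>" and T': "types n d h r \<tau>'" and agree: "\<And>v. v < n \<Longrightarrow> v \<notin> A \<Longrightarrow> \<tau> v = \<tau>' v"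
  obtains \<rho> where "inj_on \<rho> ({..<n} \<times> {..<d})" "\<And>x. fst (\<rho> x) = fst x" "\<And>x. fst x \<notin> A \<Longrightarrow> \<rho> x = x"
    "map_pmf ((`) ((`) \<rho>)) (rand (types.U0 n d \<tau>) (types.B0 n h \<tau>)) = rand (types.U0 n d \<tau>') (types.B0 n h \<tau>')"
proof -
  interpret t: types n d h r \<tau> by (rule T)
  interpret t': types n d h r \<tau>' by (rule T')
  have "\<exists>\<pi>. v < n \<longrightarrow> bij_betw \<pi> {..<d} {..<d} \<and> \<pi> ` \<tau> v = \<tau>' v \<and> (v \<notin> A \<longrightarrow> \<pi> = id)" for v
  proof (cases "v \<in> A")
    case True
    show ?thesis using subset_bij[of "{..<d}" "\<tau> v" "\<tau>' v"] t.\<tau>[of v] t'.\<tau>[of v] True by auto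
  next
    case False
    thus ?thesis using agree[of v] by (intro exI[of _ id]) (simp add: bij_betw_def)
  qed
  then obtain \<pi> where \<pi>: "\<And>v. v < n \<Longrightarrow> bij_betw (\<pi> v) {..<d} {..<d}" "\<And>v. v < n \<Longrightarrow> \<pi> v ` \<tau> v = \<tau>' v"
    "\<And>v. v < n \<Longrightarrow> v \<notin> A \<Longrightarrow> \<pi> v = id" by metis
  define \<rho> where "\<rho> x = (if fst x < n then (fst x, \<pi> (fst x) (snd x)) else x)" for x :: prevertex
  have fst\<rho>: "fst (\<rho> x) = fst x" for x by (simp add: \<rho>_def)
  have id\<rho>: "\<rho> x = x" if "fst x \<notin> A" for x using \<pi>(3)[of "fst x"] that by (simp add: \<rho>_def)
  have inj: "inj_on \<rho> ({..<n} \<times> {..<d})"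
  proof (rule inj_onI)
    fix x y assume xy: "x \<in> {..<n} \<times> {..<d}" "y \<in> {..<n} \<times> {..<d}" "\<rho> x = \<rho> y"
    have f: "fst x = fst y" using xy(3) fst\<rho> by metis
    have l: "fst x < n" "snd x < d" "snd y < d" using xy(1,2) by (auto simp: mem_Times_iff)
    have "\<pi> (fst x) (snd x) = \<pi> (fst x) (snd y)" using xy(3) f l by (simp add: \<rho>_def)
    hence "snd x = snd y" using \<pi>(1)[OF l(1)] l by (auto simp: bij_betw_def dest: inj_onD)
    thus "x = y" using f by (simp add: prod_eq_iff)
  qed
  have img: "\<rho> ` Sigma {..<n} S = Sigma {..<n} (\<lambda>v. \<pi> v ` S v)" for S
  proof -
    have "\<rho> ` Sigma {..<n} S = (\<lambda>x. (fst x, \<pi> (fst x) (snd x))) ` Sigma {..<n} S"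
      by (intro image_cong) (auto simp: \<rho>_def)
    also have "\<dots> = Sigma {..<n} (\<lambda>v. \<pi> v ` S v)" by force
    finally show ?thesis .
  qed
  have U: "\<rho> ` t.U0 = t'.U0"
  proof -
    have "\<pi> v ` ({..<d} - \<tau> v) = {..<d} - \<tau>' v" if v: "v < n" for v
    proof -
      have "\<pi> v ` ({..<d} - \<tau> v) = \<pi> v ` {..<d} - \<pi> v ` \<tau> v"
        using inj_on_image_set_diff[of "\<pi> v" "{..<d}" "{..<d}" "\<tau> v"] \<pi>(1)[OF v] t.\<tau>[OF v] by (auto simp: bij_betw_def)
      thus ?thesis using \<pi>(1,2)[OF v] by (simp add: bij_betw_def)
    qed
    thus ?thesis unfolding t.U0_Sigma t'.U0_Sigma img by (intro Sigma_cong) simp_all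
  qed
  have B: "(`) \<rho> ` t.B0 = t'.B0"
  proof (cases "h = 0")
    case True
    show ?thesis unfolding t.B0_empty[OF True] t'.B0_empty[OF True] by simp
  next
    case False
    have "\<rho> ` ({v} \<times> \<tau> v) = {v} \<times> \<tau>' v" if v: "v < n" for v
    proof -
      have "\<rho> ` ({v} \<times> \<tau> v) = {v} \<times> \<pi> v ` \<tau> v" using v by (force simp: \<rho>_def)
      thus ?thesis using \<pi>(2)[OF v] by simp
    qed
    thus ?thesis unfolding t.B0_image[OF False] t'.B0_image[OF False] image_image by (intro image_cong) simp_all
  qed
  have UV: "t.U0 \<union> \<Union>t.B0 \<subseteq> {..<n} \<times> {..<d}"
    using t.U0_subset t.H0_subset unfolding t.Union_B0 t.V_def by simp
  have "map_pmf ((`) ((`) \<rho>)) (rand t.U0 t.B0) = rand t'.U0 t'.B0"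
    unfolding U[symmetric] B[symmetric]
    using t.inv_finite[OF t.inv_start] t.inv_nonempty[OF t.inv_start]
    by (intro map_pmf_rand inj_on_subset[OF inj UV]) simp_all
  from that[OF inj fst\<rho> id\<rho> this] show ?thesis .
qed

text \<open>The relabelling takes place in the other bins only, so it fixes every pair of
  \<alpha>.\<close>

lemma prob_cycle_agree:
  assumes T: "types n d h r \<tau>" and T': "types n d h r \<tau>'" and agree: "\<And>v. v < n \<Longrightarrow> v \<in> bins \<alpha> \<Longrightarrow> \<tau> v = \<tau>' v"
    and \<alpha>: "\<Union>\<alpha> \<subseteq> {..<n} \<times> {..<d}"
  shows "measure_pmf.prob (rand (types.U0 n d \<tau>) (types.B0 n h \<tau>)) {R. \<alpha> \<subseteq> R} =
    measure_pmf.prob (rand (types.U0 n d \<tau>') (types.B0 n h \<tau>')) {R. \<alpha> \<subseteq> R}"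
proof -
  interpret t: types n d h r \<tau> by (rule T)
  obtain \<rho> where \<rho>: "inj_on \<rho> ({..<n} \<times> {..<d})" "\<And>x. fst (\<rho> x) = fst x" "\<And>x. fst x \<notin> - bins \<alpha> \<Longrightarrow> \<rho> x = x"
    "map_pmf ((`) ((`) \<rho>)) (rand (types.U0 n d \<tau>) (types.B0 n h \<tau>)) = rand (types.U0 n d \<tau>') (types.B0 n h \<tau>')"
    by (rule relabel[OF T T', of "- bins \<alpha>"]) (use agree in auto)
  have fix\<alpha>: "\<rho> ` g = g" if "g \<in> \<alpha>" for g
  proof -
    have "\<rho> v = v" if "v \<in> g" for v using \<rho>(3)[of v] bins_mem[OF \<open>g \<in> \<alpha>\<close> that] by simp
    thus ?thesis by simp
  qed
  have "measure_pmf.prob (rand (types.U0 n d \<tau>') (types.B0 n h \<tau>')) {R. \<alpha> \<subseteq> R} =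
      measure_pmf.prob (rand t.U0 t.B0) {R. \<alpha> \<subseteq> (`) \<rho> ` R}"
    unfolding \<rho>(4)[symmetric] measure_map_pmf vimage_def by simp
  also have "\<dots> = measure_pmf.prob (rand t.U0 t.B0) {R. \<alpha> \<subseteq> R}"
  proof (rule measure_pmf.finite_measure_eq_AE; (intro AE_pmfI)?)
    fix R assume R: "R \<in> set_pmf (rand t.U0 t.B0)"
    have RV: "g \<subseteq> {..<n} \<times> {..<d}" if "g \<in> R" for g
      using t.support_subset[OF R] that unfolding t.V_def by blast
    have "\<alpha> \<subseteq> (`) \<rho> ` R \<longleftrightarrow> \<alpha> \<subseteq> R"
    proof
      assume *: "\<alpha> \<subseteq> (`) \<rho> ` R"
      show "\<alpha> \<subseteq> R"
      proof
        fix g assume g: "g \<in> \<alpha>"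
        then obtain g0 where g0: "g = \<rho> ` g0" "g0 \<in> R" using * by blast
        have "g \<subseteq> {..<n} \<times> {..<d}" using \<alpha> g by blast
        hence "g = g0" using inj_on_image_eq_iff[OF \<rho>(1) _ RV[OF g0(2)], of g] fix\<alpha>[OF g] g0(1) by simp
        thus "g \<in> R" using g0(2) by simp
      qed
    next
      assume *: "\<alpha> \<subseteq> R"
      show "\<alpha> \<subseteq> (`) \<rho> ` R"
      proof
        fix g assume g: "g \<in> \<alpha>"
        hence "g = \<rho> ` g" "g \<in> R" using fix\<alpha>[OF g] * by auto
        thus "g \<in> (`) \<rho> ` R" by (rule image_eqI)
      qed
    qed
    thus "(R \<in> {R. \<alpha> \<subseteq> (`) \<rho> ` R}) = (R \<in> {R. \<alpha> \<subseteq> R})" by simp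
  qed auto
  finally show ?thesis ..
qed

text \<open>Relabelling inside \<open>A\<close> changes only pairs that touch \<open>A\<close>. So a
  cycle that appears or disappears passes through \<open>A\<close> in one of the two pairings, and
  the factor 2 stands for the two laws.\<close>

lemma prob_past_agree:
  assumes T: "types n d h r \<tau>" and T': "types n d h r \<tau>'" and agree: "\<And>v. v < n \<Longrightarrow> v \<notin> A \<Longrightarrow> \<tau> v = \<tau>' v"
    and A: "finite A" "card A = k" and r2: "r \<ge> 2" and S: "past n d r \<alpha> S"
  shows "\<bar>measure_pmf.prob (rand (types.U0 n d \<tau>) (types.B0 n h \<tau>)) {R. R \<in> S} -
    measure_pmf.prob (rand (types.U0 n d \<tau>') (types.B0 n h \<tau>')) {R. R \<in> S}\<bar> \<le> 2 * types.touch n d r k"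
proof -
  interpret t: types n d h r \<tau> by (rule T)
  interpret t': types n d h r \<tau>' by (rule T')
  obtain \<rho> where \<rho>: "inj_on \<rho> ({..<n} \<times> {..<d})" "\<And>x. fst (\<rho> x) = fst x" "\<And>x. fst x \<notin> A \<Longrightarrow> \<rho> x = x"
    "map_pmf ((`) ((`) \<rho>)) (rand (types.U0 n d \<tau>) (types.B0 n h \<tau>)) = rand (types.U0 n d \<tau>') (types.B0 n h \<tau>')"
    by (rule relabel[OF T T', of A]) (use agree in auto)
  have out: "\<rho> ` g = g" if "\<And>v. v \<in> g \<Longrightarrow> fst v \<notin> A" for g
  proof -
    have "\<rho> v = v" if "v \<in> g" for v using \<rho>(3)[of v] \<open>\<And>v. v \<in> g \<Longrightarrow> fst v \<notin> A\<close>[OF that] by simp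
    thus ?thesis by simp
  qed
  have P': "measure_pmf.prob (rand t'.U0 t'.B0) {R. Q R} = measure_pmf.prob (rand t.U0 t.B0) {R. Q ((`) \<rho> ` R)}" for Q
    unfolding \<rho>(4)[symmetric] measure_map_pmf vimage_def by simp
  have "\<bar>measure_pmf.prob (rand t.U0 t.B0) {R. R \<in> S} - measure_pmf.prob (rand t'.U0 t'.B0) {R. R \<in> S}\<bar>
      \<le> measure_pmf.prob (rand t.U0 t.B0) {R. (R \<in> S) \<noteq> ((`) \<rho> ` R \<in> S)}"
    unfolding P' by (rule prob_coupling)
  also have "\<dots> \<le> measure_pmf.prob (rand t.U0 t.B0) ({R. t.near_cycle A R} \<union> {R. t.near_cycle A ((`) \<rho> ` R)})"
  proof (intro measure_pmf.finite_measure_mono subsetI)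
    fix R assume "R \<in> {R. (R \<in> S) \<noteq> ((`) \<rho> ` R \<in> S)}"
    hence "(R \<in> S) \<noteq> ((`) \<rho> ` R \<in> S)" by simp
    then obtain \<beta> where \<beta>: "\<beta> \<in> cycles_upto n d r" "\<beta> \<noteq> \<alpha>"
      "(\<beta> \<subseteq> R \<and> \<not> \<beta> \<subseteq> (`) \<rho> ` R) \<or> (\<beta> \<subseteq> (`) \<rho> ` R \<and> \<not> \<beta> \<subseteq> R)" by (rule past_diff[OF S])
    have "t.near_cycle A R \<or> t.near_cycle A ((`) \<rho> ` R)"
      using \<beta>(3)
    proof
      assume *: "\<beta> \<subseteq> R \<and> \<not> \<beta> \<subseteq> (`) \<rho> ` R"
      then obtain g where g: "g \<in> \<beta>" "g \<notin> (`) \<rho> ` R" by blast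
      have "\<exists>z\<in>g. fst z \<in> A"
      proof (rule ccontr)
        assume "\<not> (\<exists>z\<in>g. fst z \<in> A)"
        hence "g = \<rho> ` g" using out[of g] by simp
        moreover have "g \<in> R" using g * by blast
        ultimately have "g \<in> (`) \<rho> ` R" by (rule image_eqI)
        thus False using g(2) by simp
      qed
      then obtain z where "z \<in> g" "fst z \<in> A" by blast
      from t.near_cycleI[OF \<beta>(1) _ g(1) this] * show ?thesis by blast
    next
      assume *: "\<beta> \<subseteq> (`) \<rho> ` R \<and> \<not> \<beta> \<subseteq> R"
      then obtain g where g: "g \<in> \<beta>" "g \<notin> R" by blast
      then obtain g0 where g0: "g = \<rho> ` g0" "g0 \<in> R" using * by blast
      have "\<exists>z\<in>g. fst z \<in> A"
      proof (rule ccontr)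
        assume na: "\<not> (\<exists>z\<in>g. fst z \<in> A)"
        have "fst v \<notin> A" if "v \<in> g0" for v
        proof -
          have "\<rho> v \<in> g" unfolding g0(1) using that by (rule imageI)
          hence "fst (\<rho> v) \<notin> A" using na by blast
          thus ?thesis using \<rho>(2) by simp
        qed
        hence "g = g0" using out[of g0] g0(1) by simp
        thus False using g(2) g0(2) by simp
      qed
      then obtain z where "z \<in> g" "fst z \<in> A" by blast
      from t.near_cycleI[OF \<beta>(1) _ g(1) this] * show ?thesis by blast
    qed
    thus "R \<in> {R. t.near_cycle A R} \<union> {R. t.near_cycle A ((`) \<rho> ` R)}" by simp
  qed simp
  also have "\<dots> \<le> measure_pmf.prob (rand t.U0 t.B0) {R. t.near_cycle A R} + measure_pmf.prob (rand t.U0 t.B0) {R. t.near_cycle A ((`) \<rho> ` R)}"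
    by (intro measure_Un_le) auto
  also have "measure_pmf.prob (rand t.U0 t.B0) {R. t.near_cycle A ((`) \<rho> ` R)} = measure_pmf.prob (rand t'.U0 t'.B0) {R. t.near_cycle A R}"
    using P'[of "t.near_cycle A"] by simp
  also have "\<dots> \<le> t.touch k"
    using t'.prob_near_cycle[OF A r2] by simp
  also have "measure_pmf.prob (rand t.U0 t.B0) {R. t.near_cycle A R} \<le> t.touch k"
    by (rule t.prob_near_cycle[OF A r2])
  finally show ?thesis by simp
qed

text \<open>Two independent samples agree in law with the pair obtained by exchanging some coordinates.\<close>

lemma exchange_sum:
  fixes f g :: "'a \<Rightarrow> real"
  assumes \<Theta>: "finite \<Theta>" and mix: "\<And>a b. a \<in> \<Theta> \<Longrightarrow> b \<in> \<Theta> \<Longrightarrow> mix a b \<in> \<Theta>"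
    and invol: "\<And>a b. a \<in> \<Theta> \<Longrightarrow> b \<in> \<Theta> \<Longrightarrow> mix (mix a b) (mix b a) = a"
    and f: "\<And>a b. a \<in> \<Theta> \<Longrightarrow> b \<in> \<Theta> \<Longrightarrow> f (mix a b) = f a" "\<And>a. a \<in> \<Theta> \<Longrightarrow> f a \<ge> 0"
    and g: "\<And>a b. a \<in> \<Theta> \<Longrightarrow> b \<in> \<Theta> \<Longrightarrow> \<bar>g b - g (mix a b)\<bar> \<le> \<delta>"
  shows "\<bar>(\<Sum>a\<in>\<Theta>. f a) * (\<Sum>b\<in>\<Theta>. g b) - real (card \<Theta>) * (\<Sum>a\<in>\<Theta>. f a * g a)\<bar> \<le> \<delta> * real (card \<Theta>) * (\<Sum>a\<in>\<Theta>. f a)"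
proof -
  have "(\<Sum>x\<in>\<Theta> \<times> \<Theta>. f (mix (fst x) (snd x)) * g (mix (fst x) (snd x))) = (\<Sum>x\<in>\<Theta> \<times> \<Theta>. f (fst x) * g (fst x))"
    by (rule sum.reindex_bij_witness[where i = "\<lambda>x. (mix (fst x) (snd x), mix (snd x) (fst x))"
          and j = "\<lambda>x. (mix (fst x) (snd x), mix (snd x) (fst x))"]) (auto simp: mix invol)
  also have "\<dots> = (\<Sum>a\<in>\<Theta>. \<Sum>b\<in>\<Theta>. f a * g a)"
    by (subst sum.cartesian_product) (simp add: case_prod_unfold)
  also have "\<dots> = real (card \<Theta>) * (\<Sum>a\<in>\<Theta>. f a * g a)"
    by (simp add: sum_distrib_left)
  finally have 1: "real (card \<Theta>) * (\<Sum>a\<in>\<Theta>. f a * g a) = (\<Sum>x\<in>\<Theta> \<times> \<Theta>. f (mix (fst x) (snd x)) * g (mix (fst x) (snd x)))" ..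
  have 2: "(\<Sum>a\<in>\<Theta>. f a) * (\<Sum>b\<in>\<Theta>. g b) = (\<Sum>x\<in>\<Theta> \<times> \<Theta>. f (fst x) * g (snd x))"
    unfolding sum_product by (subst sum.cartesian_product) (simp add: case_prod_unfold)
  have "\<bar>(\<Sum>x\<in>\<Theta> \<times> \<Theta>. f (fst x) * g (snd x)) - (\<Sum>x\<in>\<Theta> \<times> \<Theta>. f (mix (fst x) (snd x)) * g (mix (fst x) (snd x)))\<bar>
      = \<bar>\<Sum>x\<in>\<Theta> \<times> \<Theta>. f (fst x) * g (snd x) - f (mix (fst x) (snd x)) * g (mix (fst x) (snd x))\<bar>"
    by (simp add: sum_subtractf)
  also have "\<dots> \<le> (\<Sum>x\<in>\<Theta> \<times> \<Theta>. \<bar>f (fst x) * g (snd x) - f (mix (fst x) (snd x)) * g (mix (fst x) (snd x))\<bar>)"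
    by (rule sum_abs)
  also have "\<dots> \<le> (\<Sum>x\<in>\<Theta> \<times> \<Theta>. f (fst x) * \<delta>)"
  proof (rule sum_mono)
    fix x assume "x \<in> \<Theta> \<times> \<Theta>"
    hence x: "fst x \<in> \<Theta>" "snd x \<in> \<Theta>" by auto
    have "\<bar>f (fst x) * g (snd x) - f (mix (fst x) (snd x)) * g (mix (fst x) (snd x))\<bar> = f (fst x) * \<bar>g (snd x) - g (mix (fst x) (snd x))\<bar>"
      using f x by (simp add: abs_mult flip: right_diff_distrib)
    also have "\<dots> \<le> f (fst x) * \<delta>" using g f x by (intro mult_left_mono) auto
    finally show "\<bar>f (fst x) * g (snd x) - f (mix (fst x) (snd x)) * g (mix (fst x) (snd x))\<bar> \<le> f (fst x) * \<delta>" .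
  qed
  also have "\<dots> = (\<Sum>a\<in>\<Theta>. \<Sum>b\<in>\<Theta>. f a * \<delta>)"
    by (subst sum.cartesian_product) (simp add: case_prod_unfold)
  also have "\<dots> = \<delta> * real (card \<Theta>) * (\<Sum>a\<in>\<Theta>. f a)"
    by (simp add: sum_distrib_left sum_distrib_right algebra_simps)
  finally show ?thesis unfolding 1 2 .
qed

section \<open>Averaging over the reorderings\<close>

definition perms :: "nat \<Rightarrow> (nat \<Rightarrow> nat) set" where
  "perms d = {\<pi>. \<pi> permutes {..<d}}"

lemma finite_perms [simp]: "finite (perms d)"
  by (simp add: perms_def finite_permutations)

lemma perms_nonempty [simp]: "perms d \<noteq> {}"
  unfolding perms_def using permutes_id by blast

lemma card_perms_pos: "card (perms d) > 0"
  by (simp add: card_gt_0_iff)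

text \<open>\<open>f True\<close> and \<open>f False\<close> are the values at the images of the last two elements and elsewhere.\<close>

definition val :: "(bool \<Rightarrow> real) \<Rightarrow> nat \<Rightarrow> nat \<Rightarrow> (nat \<Rightarrow> nat) \<Rightarrow> real" where
  "val f d j \<pi> = f (j \<in> \<pi> ` {d - 2..<d})"

lemma val_compose:
  assumes "\<nu> permutes {..<d}" "\<pi> permutes {..<d}"
  shows "val f d (\<nu> j) (\<nu> \<circ> \<pi>) = val f d j \<pi>"
  unfolding val_def image_comp[symmetric] inj_image_mem_iff[OF permutes_inj[OF assms(1)]] ..

text \<open>Reindexing by \<pi> makes the sum independent of \<pi>.\<close>

lemma sum_val:
  assumes \<pi>: "\<pi> permutes {..<d}" and d: "d \<ge> 2"
  shows "(\<Sum>j<d. val f d j \<pi>) = 2 * f True + real (d - 2) * f False"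
proof -
  have "(\<Sum>j<d. val f d j \<pi>) = (\<Sum>j<d. val f d (\<pi> j) \<pi>)"
    using sum.permute[OF \<pi>, of "\<lambda>j. val f d j \<pi>"] by (simp add: comp_def)
  also have "\<dots> = (\<Sum>j<d. f (j \<in> {d - 2..<d}))"
    using permutes_inj[OF \<pi>] by (simp add: val_def inj_image_mem_iff)
  also have "\<dots> = (\<Sum>j\<in>{..<d - 2} \<union> {d - 2..<d}. f (j \<in> {d - 2..<d}))"
    by (intro sum.cong) auto
  also have "\<dots> = (\<Sum>j\<in>{..<d - 2}. f (j \<in> {d - 2..<d})) + (\<Sum>j\<in>{d - 2..<d}. f (j \<in> {d - 2..<d}))"
    by (intro sum.union_disjoint) auto
  also have "\<dots> = (\<Sum>j\<in>{..<d - 2}. f False) + (\<Sum>j\<in>{d - 2..<d}. f True)"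
    by (intro arg_cong2[where f = "(+)"] sum.cong refl arg_cong[where f = f]) auto
  finally show ?thesis using d by simp
qed

lemma sum_perms_compose:
  assumes "\<nu> permutes {..<d}"
  shows "(\<Sum>\<pi>\<in>perms d. F (\<nu> \<circ> \<pi>)) = (\<Sum>\<pi>\<in>perms d. F \<pi>)"
  unfolding perms_def using setum_permutations_compose_left[OF assms, of F] by simp

text \<open>By symmetry the mean is the same at all positions, and by \<open>sum_val\<close> the sum
  over the positions vanishes for every permutation.\<close>

lemma val_mean:
  assumes d: "d \<ge> 2" and j: "j < d" and mean: "2 * f True + real (d - 2) * f False = 0"
  shows "(\<Sum>\<pi>\<in>perms d. val f d j \<pi>) = 0"
proof -
  have eq: "(\<Sum>\<pi>\<in>perms d. val f d i \<pi>) = (\<Sum>\<pi>\<in>perms d. val f d j \<pi>)" if "i < d" for i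
  proof -
    define \<nu> where "\<nu> = Transposition.transpose j i"
    have \<nu>: "\<nu> permutes {..<d}" unfolding \<nu>_def using that j by (intro permutes_swap_id) auto
    have "(\<Sum>\<pi>\<in>perms d. val f d i \<pi>) = (\<Sum>\<pi>\<in>perms d. val f d (\<nu> j) (\<nu> \<circ> \<pi>))"
      using sum_perms_compose[OF \<nu>, of "val f d i"] by (simp add: \<nu>_def)
    also have "\<dots> = (\<Sum>\<pi>\<in>perms d. val f d j \<pi>)"
      by (intro sum.cong refl val_compose[OF \<nu>]) (simp add: perms_def)
    finally show ?thesis .
  qed
  have "real d * (\<Sum>\<pi>\<in>perms d. val f d j \<pi>) = (\<Sum>i<d. \<Sum>\<pi>\<in>perms d. val f d i \<pi>)"
    using eq by simp
  also have "\<dots> = (\<Sum>\<pi>\<in>perms d. \<Sum>i<d. val f d i \<pi>)" by (rule sum.swap)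
  also have "\<dots> = 0" using mean by (rule_tac sum.neutral, rule_tac ballI) (simp add: sum_val[OF _ d] perms_def)
  finally show ?thesis using d by simp
qed

text \<open>By symmetry all ordered pairs of distinct positions have the same mean, and their sum is
  the square of the sum minus the sum of the squares, both of which are constant by
  \<open>sum_val\<close>.\<close>

lemma val_mean2:
  assumes d: "d \<ge> 2" and j: "j < d" "j' < d" "j \<noteq> j'"
  shows "(\<Sum>\<pi>\<in>perms d. val f d j \<pi> * val f d j' \<pi>) / real (card (perms d)) =
    ((2 * f True + real (d - 2) * f False)\<^sup>2 - (2 * (f True)\<^sup>2 + real (d - 2) * (f False)\<^sup>2)) / (real d * (real d - 1))"
proof -
  define s where "s = 2 * f True + real (d - 2) * f False"
  define q where "q = 2 * (f True)\<^sup>2 + real (d - 2) * (f False)\<^sup>2"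
  define W where "W i i' = (\<Sum>\<pi>\<in>perms d. val f d i \<pi> * val f d i' \<pi>)" for i i'
  have eq: "W i i' = W j j'" if i: "i < d" "i' < d" "i \<noteq> i'" for i i'
  proof -
    \<comment> \<open>The permutation \<nu> has to send j to i and j' to i'; \<open>m\<close> is
      where the first transposition puts j'.\<close>
    define m where "m = Transposition.transpose j i j'"
    define \<nu> where "\<nu> = Transposition.transpose m i' \<circ> Transposition.transpose j i"
    have m: "m < d" "m \<noteq> i" unfolding m_def using i j by (auto simp: Transposition.transpose_def)
    have \<nu>: "\<nu> permutes {..<d}" unfolding \<nu>_def
      using i j m by (intro permutes_compose permutes_swap_id) auto
    have \<nu>j: "\<nu> j = i" "\<nu> j' = i'"
      unfolding \<nu>_def using m i by (simp_all add: Transposition.transpose_def m_def)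
    have "W i i' = (\<Sum>\<pi>\<in>perms d. val f d (\<nu> j) (\<nu> \<circ> \<pi>) * val f d (\<nu> j') (\<nu> \<circ> \<pi>))"
      using sum_perms_compose[OF \<nu>, of "\<lambda>\<pi>. val f d i \<pi> * val f d i' \<pi>"] by (simp add: \<nu>j W_def)
    also have "\<dots> = W j j'"
      unfolding W_def by (intro sum.cong refl arg_cong2[where f = "(*)"] val_compose[OF \<nu>]) (simp_all add: perms_def)
    finally show ?thesis .
  qed
  have "real d * (real d - 1) * W j j' = (\<Sum>i<d. \<Sum>i'\<in>{..<d} - {i}. W j j')"
    using d by (simp add: of_nat_diff algebra_simps)
  also have "\<dots> = (\<Sum>i<d. \<Sum>i'\<in>{..<d} - {i}. W i i')"
    using eq by (intro sum.cong refl) auto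
  also have "\<dots> = (\<Sum>i<d. (\<Sum>i'<d. W i i') - W i i)"
    by (intro sum.cong refl) (simp add: sum_diff1)
  also have "\<dots> = (\<Sum>i<d. \<Sum>i'<d. W i i') - (\<Sum>i<d. W i i)" by (simp add: sum_subtractf)
  also have "(\<Sum>i<d. \<Sum>i'<d. W i i') = (\<Sum>\<pi>\<in>perms d. (\<Sum>i<d. val f d i \<pi>)\<^sup>2)"
  proof -
    have "(\<Sum>i<d. \<Sum>i'<d. W i i') = (\<Sum>i<d. \<Sum>\<pi>\<in>perms d. \<Sum>i'<d. val f d i \<pi> * val f d i' \<pi>)"
      unfolding W_def by (intro sum.cong refl sum.swap)
    also have "\<dots> = (\<Sum>\<pi>\<in>perms d. \<Sum>i<d. \<Sum>i'<d. val f d i \<pi> * val f d i' \<pi>)" by (rule sum.swap)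
    finally show ?thesis by (simp add: power2_eq_square sum_product)
  qed
  also have "\<dots> = real (card (perms d)) * s\<^sup>2"
    by (simp add: sum_val[OF _ d] perms_def s_def)
  also have "(\<Sum>i<d. W i i) = (\<Sum>\<pi>\<in>perms d. \<Sum>i<d. (val f d i \<pi>)\<^sup>2)"
    unfolding W_def power2_eq_square by (rule sum.swap)
  also have "\<dots> = (\<Sum>\<pi>\<in>perms d. q)"
  proof (intro sum.cong refl)
    fix \<pi> assume "\<pi> \<in> perms d"
    hence \<pi>: "\<pi> permutes {..<d}" by (simp add: perms_def)
    have "(\<Sum>i<d. (val f d i \<pi>)\<^sup>2) = (\<Sum>i<d. val (\<lambda>b. (f b)\<^sup>2) d i \<pi>)" by (simp add: val_def)
    thus "(\<Sum>i<d. (val f d i \<pi>)\<^sup>2) = q" unfolding sum_val[OF \<pi> d] q_def .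
  qed
  also have "\<dots> = real (card (perms d)) * q" by simp
  finally have 1: "real d * (real d - 1) * W j j' = real (card (perms d)) * (s\<^sup>2 - q)"
    unfolding right_diff_distrib .
  have 2: "real d * (real d - 1) > 0" using d by simp
  have 3: "real (card (perms d)) > 0" using card_perms_pos[of d] by simp
  have *: "w / C = X / A" if "A * w = C * X" "A > 0" "C > 0" for w C X A :: real
    using that by (simp add: field_simps)
  have "W j j' / real (card (perms d)) = (s\<^sup>2 - q) / (real d * (real d - 1))"
    by (rule *[OF 1 2 3])
  thus ?thesis by (simp add: W_def s_def q_def)
qed

definition reorderings :: "nat \<Rightarrow> nat \<Rightarrow> (nat \<Rightarrow> nat \<Rightarrow> nat) set" where
  "reorderings n d = PiE_dflt {..<n} id (\<lambda>_. perms d)"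

lemma finite_reorderings [simp]: "finite (reorderings n d)"
  unfolding reorderings_def by (intro finite_PiE_dflt) auto

lemma reorderings_nonempty [simp]: "reorderings n d \<noteq> {}"
  unfolding reorderings_def by simp

lemma card_reorderings: "card (reorderings n d) = card (perms d) ^ n"
  unfolding reorderings_def by (simp add: card_PiE_dflt)

lemma reordering_pmf_eq: "reordering_pmf n d = pmf_of_set (reorderings n d)"
  unfolding reordering_pmf_def reorderings_def perms_def[symmetric] by (intro Pi_pmf_of_set) auto

lemma sum_reorderings_prod:
  fixes F :: "nat \<Rightarrow> (nat \<Rightarrow> nat) \<Rightarrow> real"
  shows "(\<Sum>\<sigma>\<in>reorderings n d. \<Prod>v<n. F v (\<sigma> v)) = (\<Prod>v<n. \<Sum>\<pi>\<in>perms d. F v \<pi>)"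
proof -
  have inj: "inj_on (\<lambda>h x. if x \<in> {..<n} then h x else id) (PiE {..<n} (\<lambda>_. perms d))"
  proof (rule inj_onI)
    fix g h assume *: "g \<in> PiE {..<n} (\<lambda>_. perms d)" "h \<in> PiE {..<n} (\<lambda>_. perms d)"
      "(\<lambda>x. if x \<in> {..<n} then g x else id) = (\<lambda>x. if x \<in> {..<n} then h x else id)"
    show "g = h"
    proof (rule PiE_ext[OF *(1,2)])
      fix x assume "x \<in> {..<n}"
      thus "g x = h x" using fun_cong[OF *(3), of x] by simp
    qed
  qed
  have "(\<Sum>\<sigma>\<in>reorderings n d. \<Prod>v<n. F v (\<sigma> v)) = (\<Sum>g\<in>PiE {..<n} (\<lambda>_. perms d). \<Prod>v<n. F v (g v))"
    unfolding reorderings_def dflt_image_PiE[symmetric] by (subst sum.reindex[OF inj]) simp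
  also have "\<dots> = (\<Prod>v<n. \<Sum>\<pi>\<in>perms d. F v \<pi>)"
    by (rule prod_sum_PiE[symmetric]) auto
  finally show ?thesis .
qed

text \<open>The bins \<open>v i\<close> are distinct and hence reordered independently; all other
  bins contribute the factor 1.\<close>

lemma mean_reorderings_prod:
  fixes G :: "nat \<Rightarrow> (nat \<Rightarrow> nat) \<Rightarrow> real"
  assumes v: "inj_on v {..<k}" "v ` {..<k} \<subseteq> {..<n}"
  shows "(\<Sum>\<sigma>\<in>reorderings n d. \<Prod>i<k. G i (\<sigma> (v i))) / real (card (reorderings n d)) =
    (\<Prod>i<k. (\<Sum>\<pi>\<in>perms d. G i \<pi>) / real (card (perms d)))"
proof -
  define F where "F x = (if x \<in> v ` {..<k} then G (inv_into {..<k} v x) else (\<lambda>_. 1))" for x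
  have Fv: "F (v i) = G i" if "i < k" for i using that v(1) by (simp add: F_def)
  have image: "(\<Prod>x<n. H x) = (\<Prod>i<k. H (v i))" if "\<And>x. x \<notin> v ` {..<k} \<Longrightarrow> H x = 1" for H :: "nat \<Rightarrow> real"
  proof -
    have "(\<Prod>x<n. H x) = (\<Prod>x\<in>v ` {..<k}. H x)"
      using v(2) that by (intro prod.mono_neutral_right) auto
    thus ?thesis using prod.reindex[OF v(1), of H] by (simp add: comp_def)
  qed
  have "(\<Prod>i<k. G i (\<sigma> (v i))) = (\<Prod>x<n. F x (\<sigma> x))" for \<sigma>
  proof -
    have "(\<Prod>x<n. F x (\<sigma> x)) = (\<Prod>i<k. F (v i) (\<sigma> (v i)))" by (rule image) (simp add: F_def)
    thus ?thesis by (simp add: Fv)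
  qed
  hence "(\<Sum>\<sigma>\<in>reorderings n d. \<Prod>i<k. G i (\<sigma> (v i))) = (\<Prod>x<n. \<Sum>\<pi>\<in>perms d. F x \<pi>)"
    by (simp add: sum_reorderings_prod)
  hence "(\<Sum>\<sigma>\<in>reorderings n d. \<Prod>i<k. G i (\<sigma> (v i))) / real (card (reorderings n d)) =
      (\<Prod>x<n. (\<Sum>\<pi>\<in>perms d. F x \<pi>) / real (card (perms d)))"
    by (simp add: card_reorderings prod_dividef)
  also have "\<dots> = (\<Prod>i<k. (\<Sum>\<pi>\<in>perms d. F (v i) \<pi>) / real (card (perms d)))"
    using card_perms_pos[of d] by (intro image) (simp add: F_def)
  finally show ?thesis by (simp add: Fv)
qed

lemma cyc_nth:
  assumes s: "cyc n d s" and i: "i < length s"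
  shows "fst (snd (s ! i)) = fst (fst (s ! (Suc i mod length s)))" "snd (s ! i) \<noteq> fst (s ! (Suc i mod length s))"
proof -
  have len: "length s > 0" by (rule le_less_trans[OF le0 i])
  have "fst (snd (s ! i)) = fst (fst (s ! (Suc i mod length s))) \<and> snd (s ! i) \<noteq> fst (s ! (Suc i mod length s))"
  proof (cases "Suc i = length s")
    case True
    have sne: "s \<noteq> []" using len by (rule iffD1[OF length_greater_0_conv])
    have "length s - 1 = i" using True by simp
    hence l: "last s = s ! i" using last_conv_nth[OF sne] by simp
    have m: "Suc i mod length s = 0" using True by simp
    show ?thesis using cyc_close[OF s] unfolding l hd_conv_nth[OF sne] m .
  next
    case False
    hence "Suc i < length s" using i by simp
    thus ?thesis using successively_nth[OF cyc_chain[OF s, unfolded chain_def]] by simp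
  qed
  thus "fst (snd (s ! i)) = fst (fst (s ! (Suc i mod length s)))" "snd (s ! i) \<noteq> fst (s ! (Suc i mod length s))" by blast+
qed

text \<open>
  Product over a set \<open>I\<close> of edges of a cycle: bin \<open>i\<close> contributes the value at the prevertex of edge
  \<open>i\<close> if \<open>i \<in> I\<close>, and that at the prevertex of the preceding edge if this one is in \<open>I\<close>.
\<close>

lemma mean_cycle_subset:
  assumes s: "cyc n d s" and d: "d \<ge> 2" and I: "I \<subseteq> {..<length s}"
    and mean: "2 * f True + real (d - 2) * f False = 0 \<or> I = {..<length s}"
  defines "W \<equiv> \<lambda>\<sigma> x. val f d (snd x) (\<sigma> (fst x))"
  shows "(\<Sum>\<sigma>\<in>reorderings n d. \<Prod>i\<in>I. W \<sigma> (fst (s ! i)) * W \<sigma> (snd (s ! i))) / real (card (reorderings n d)) =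
    (if I = {} then 1 else if I = {..<length s} then
      (((2 * f True + real (d - 2) * f False)\<^sup>2 - (2 * (f True)\<^sup>2 + real (d - 2) * (f False)\<^sup>2)) / (real d * (real d - 1))) ^ length s
     else 0)"
proof -
  define k where "k = length s"
  have k: "k > 0" using s by (simp add: cyc_def k_def)
  define nx where "nx i = Suc i mod k" for i
  define pr where "pr i = (i + (k - 1)) mod k" for i
  have nxpr: "nx (pr i) = i" "pr i < k" if "i < k" for i
  proof -
    have "Suc ((i + (k - 1)) mod k) mod k = Suc (i + (k - 1)) mod k" by (rule mod_Suc_eq)
    also have "Suc (i + (k - 1)) = i + k" using k by simp
    finally show "nx (pr i) = i" using that by (simp add: nx_def pr_def)
    show "pr i < k" using k by (simp add: pr_def)
  qed
  have prnx: "pr (nx i) = i" "nx i < k" if "i < k" for i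
  proof -
    have "(Suc i mod k + (k - 1)) mod k = (Suc i + (k - 1)) mod k" by (rule mod_add_left_eq)
    also have "Suc i + (k - 1) = i + k" using k by simp
    finally show "pr (nx i) = i" using that by (simp add: nx_def pr_def)
    show "nx i < k" using k by (simp add: nx_def)
  qed
  define v where "v i = fst (fst (s ! i))" for i
  define x where "x i = snd (fst (s ! i))" for i
  define y where "y i = snd (snd (s ! i))" for i
  have nth: "fst (snd (s ! i)) = v (nx i)" "snd (s ! i) \<noteq> fst (s ! nx i)" if "i < k" for i
    using cyc_nth[OF s, of i] that by (simp_all add: v_def nx_def k_def)
  have V: "fst (s ! i) \<in> {..<n} \<times> {..<d}" "snd (s ! i) \<in> {..<n} \<times> {..<d}" if "i < k" for i
  proof -
    have "s ! i \<in> set s" using that by (simp add: k_def)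
    hence "fst (s ! i) \<in> set (ends s)" "snd (s ! i) \<in> set (ends s)" unfolding set_ends by blast+
    thus "fst (s ! i) \<in> {..<n} \<times> {..<d}" "snd (s ! i) \<in> {..<n} \<times> {..<d}" using s unfolding cyc_def by blast+
  qed
  have xd: "x i < d" "v i < n" if "i < k" for i using V(1)[OF that] by (auto simp: x_def v_def mem_Times_iff)
  have yd: "y i < d" if "i < k" for i using V(2)[OF that] by (auto simp: y_def mem_Times_iff)
  have xy: "y (pr i) \<noteq> x i" if "i < k" for i
    using nth[of "pr i"] nxpr[OF that] by (auto simp: y_def x_def v_def prod_eq_iff)
  have injv: "inj_on v {..<k}"
  proof -
    have "distinct (map (\<lambda>t. fst (fst t)) s)" using s by (simp add: cyc_def)
    from inj_on_nth[OF this, of "{..<k}"] have "inj_on ((!) (map (\<lambda>t. fst (fst t)) s)) {..<k}" by (simp add: k_def)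
    thus ?thesis by (subst inj_on_cong[of "{..<k}" v]) (simp_all add: v_def k_def)
  qed
  define G where "G i \<pi> = (if i \<in> I then val f d (x i) \<pi> else 1) * (if pr i \<in> I then val f d (y (pr i)) \<pi> else 1)" for i \<pi>
  have Ik: "I \<subseteq> {..<k}" "finite I" using I finite_subset by (auto simp: k_def)
  have reidx: "(\<Prod>i\<in>I. W \<sigma> (fst (s ! i)) * W \<sigma> (snd (s ! i))) = (\<Prod>i<k. G i (\<sigma> (v i)))" for \<sigma>
  proof -
    have "(\<Prod>i\<in>I. W \<sigma> (fst (s ! i)) * W \<sigma> (snd (s ! i))) = (\<Prod>i\<in>I. val f d (x i) (\<sigma> (v i))) * (\<Prod>i\<in>I. val f d (y i) (\<sigma> (v (nx i))))"
      unfolding prod.distrib[symmetric] using Ik nth(1) by (intro prod.cong refl) (auto simp: W_def x_def y_def v_def)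
    also have "(\<Prod>i\<in>I. val f d (x i) (\<sigma> (v i))) = (\<Prod>i<k. if i \<in> I then val f d (x i) (\<sigma> (v i)) else 1)"
      using Ik by (simp add: prod.If_cases Int_absorb1)
    also have "(\<Prod>i\<in>I. val f d (y i) (\<sigma> (v (nx i)))) = (\<Prod>i<k. if i \<in> I then val f d (y i) (\<sigma> (v (nx i))) else 1)"
      using Ik by (simp add: prod.If_cases Int_absorb1)
    also have "\<dots> = (\<Prod>i<k. if pr i \<in> I then val f d (y (pr i)) (\<sigma> (v i)) else 1)"
      by (rule prod.reindex_bij_witness[where i = pr and j = nx]) (auto simp: nxpr prnx)
    finally show ?thesis by (simp add: G_def prod.distrib)
  qed
  have "(\<Sum>\<sigma>\<in>reorderings n d. \<Prod>i\<in>I. W \<sigma> (fst (s ! i)) * W \<sigma> (snd (s ! i))) / real (card (reorderings n d)) =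
    (\<Prod>i<k. (\<Sum>\<pi>\<in>perms d. G i \<pi>) / real (card (perms d)))" (is "?L = _")
    unfolding reidx using xd by (intro mean_reorderings_prod injv) auto
  moreover have "(\<Sum>\<pi>\<in>perms d. G i \<pi>) / real (card (perms d)) = 1" if "I = {}" for i
    using that card_perms_pos[of d] by (simp add: G_def)
  moreover have "(\<Sum>\<pi>\<in>perms d. G i \<pi>) / real (card (perms d)) =
      ((2 * f True + real (d - 2) * f False)\<^sup>2 - (2 * (f True)\<^sup>2 + real (d - 2) * (f False)\<^sup>2)) / (real d * (real d - 1))"
    if "I = {..<k}" "i < k" for i
    using val_mean2[OF d yd[OF nxpr(2)[OF that(2)]] xd(1)[OF that(2)] xy[OF that(2)], of f] that nxpr(2)[OF that(2)]
    by (simp add: G_def mult.commute)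
  moreover have "(\<Prod>i<k. (\<Sum>\<pi>\<in>perms d. G i \<pi>) / real (card (perms d))) = 0" if ne: "I \<noteq> {}" "I \<noteq> {..<k}"
  proof -
    \<comment> \<open>A nonempty proper set of edges on a circle has an edge whose predecessor is
      missing. The bin between the two then carries a single factor, whose mean is 0.\<close>
    have "\<exists>i\<in>I. pr i \<notin> I"
    proof (rule ccontr)
      assume "\<not> (\<exists>i\<in>I. pr i \<notin> I)"
      hence cl: "pr i \<in> I" if "i \<in> I" for i using that by blast
      obtain i0 where i0: "i0 \<in> I" using ne by blast
      have step: "j mod k \<in> I" if "Suc j mod k \<in> I" for j
      proof -
        have "pr (Suc j mod k) = (Suc j + (k - 1)) mod k" unfolding pr_def by (rule mod_add_left_eq)
        also have "Suc j + (k - 1) = j + k" using k by simp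
        finally have "pr (Suc j mod k) = j mod k" by simp
        thus ?thesis using cl[OF that] by simp
      qed
      \<comment> \<open>Walking backwards from \<open>i0\<close>; the added multiple of k keeps the
        subtraction of natural numbers from truncating.\<close>
      have down: "(i0 + m * k - j) mod k \<in> I" if "j \<le> i0 + m * k" for j m
        using that
      proof (induction j)
        case 0
        thus ?case using i0 Ik by auto
      next
        case (Suc j)
        have "Suc (i0 + m * k - Suc j) = i0 + m * k - j" using Suc.prems by simp
        thus ?case using step[of "i0 + m * k - Suc j"] Suc by simp
      qed
      have "j \<in> I" if "j < k" for j
      proof -
        have "i0 + 1 * k - (i0 + k - j) = j" using that by simp
        thus ?thesis using down[of "i0 + k - j" 1] that by simp
      qed
      thus False using ne Ik by blast
    qed
    then obtain i where i: "i \<in> I" "pr i \<notin> I" by blast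
    have "2 * f True + real (d - 2) * f False = 0" using mean ne by (simp add: k_def)
    hence "(\<Sum>\<pi>\<in>perms d. G i \<pi>) = 0"
      using val_mean[OF d, of "x i" f] xd[of i] i Ik by (auto simp: G_def)
    moreover have "i \<in> {..<k}" using i Ik by blast
    ultimately show ?thesis by (intro prod_zero) auto
  qed
  ultimately show ?thesis using k by (simp add: k_def[symmetric])
qed

section \<open>The two laws as mixtures over the types\<close>

definition types_of :: "nat \<Rightarrow> nat \<Rightarrow> (nat \<Rightarrow> nat \<Rightarrow> nat) \<Rightarrow> nat \<Rightarrow> nat set" where
  "types_of h d \<sigma> v = \<sigma> v ` {d - h..<d}"

definition rand_at :: "nat \<Rightarrow> nat \<Rightarrow> nat \<Rightarrow> (nat \<Rightarrow> nat \<Rightarrow> nat) \<Rightarrow> pairing pmf" where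
  "rand_at n d h \<sigma> = rand (types.U0 n d (types_of h d \<sigma>)) (types.B0 n h (types_of h d \<sigma>))"

text \<open>Of the random permutations only the images of the last h prevertices are used; the
  pairing is drawn afresh given these.\<close>

definition law :: "nat \<Rightarrow> nat \<Rightarrow> nat \<Rightarrow> pairing pmf" where
  "law n d h = bind_pmf (reordering_pmf n d) (rand_at n d h)"

lemma reorderings_permutes: "\<sigma> \<in> reorderings n d \<Longrightarrow> v < n \<Longrightarrow> \<sigma> v permutes {..<d}"
  by (auto simp: reorderings_def PiE_dflt_def perms_def)

lemma types_types_of:
  assumes "\<sigma> \<in> reorderings n d" "h = 0 \<or> h = 2" "d \<ge> 3" "r \<ge> 1" "even (n * d)" "real n \<ge> 10 * (real r)\<^sup>2"
  shows "types n d h r (types_of h d \<sigma>)"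
proof
  fix v assume v: "v < n"
  note p = reorderings_permutes[OF assms(1) v]
  have "card (\<sigma> v ` {d - h..<d}) = card {d - h..<d}"
    by (rule card_image) (rule inj_on_subset[OF permutes_inj[OF p] subset_UNIV])
  moreover have "\<sigma> v ` {d - h..<d} \<subseteq> \<sigma> v ` {..<d}" by (intro image_mono) auto
  ultimately show "types_of h d \<sigma> v \<subseteq> {..<d} \<and> card (types_of h d \<sigma> v) = h"
    unfolding types_of_def permutes_image[OF p] using assms(2,3) by auto
qed (use assms in auto)

lemma prob_law: "measure_pmf.prob (law n d h) X = (\<Sum>\<sigma>\<in>reorderings n d. measure_pmf.prob (rand_at n d h \<sigma>) X) / real (card (reorderings n d))"
  unfolding law_def prob_bind_pmf reordering_pmf_eq
  using integral_pmf_of_set[OF reorderings_nonempty finite_reorderings] by simp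

lemma weight_nth: "weight w s = (\<Prod>i<length s. w (fst (s ! i)) (snd (s ! i)))"
  by (simp add: weight_def prod.list_conv_set_nth atLeast0LessThan)

locale model =
  fixes n d h r :: nat
  assumes h: "h = 0 \<or> h = 2" and d: "d \<ge> 3" and r2: "r \<ge> 2" and even_nd: "even (n * d)"
    and n_large: "real n \<ge> 10 * (real r)\<^sup>2"
begin

lemma T: "\<sigma> \<in> reorderings n d \<Longrightarrow> types n d h r (types_of h d \<sigma>)"
  using h d r2 even_nd n_large by (intro types_types_of) auto

definition c where "c = 10 * real r / real n"

text \<open>The first summand is k times the cost of one pair, from \<open>fixed_types\<close>; the
  second is the effect of changing the types in k bins, from \<open>prob_past_agree\<close>.\<close>

definition \<eta> :: "nat \<Rightarrow> real" where
  "\<eta> k = real k * (57 * (real k)\<^sup>2 * real (d - 1) ^ (r - 1) / real n)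
    + 2 * ((9 * (real k)\<^sup>2 + 6 * real k * real d) * real (d - 1) ^ (r - 1) / real n)"

text \<open>With f and g the conditional probabilities of \<alpha> and of \<open>S\<close> given the
  types, the covariance is the mean conditional covariance plus the covariance of f and g. The first
  is small by \<open>fixed_types\<close>; for the second, f depends only on the types in the bins of
  \<alpha> and g hardly depends on these, so \<open>exchange_sum\<close> applies.\<close>

lemma near_independence:
  assumes s: "cyc n d s" "length s = k" "k \<le> r" and \<alpha>: "edges s = \<alpha>" "\<alpha> \<in> cycles_upto n d r" and S: "past n d r \<alpha> S"
  shows "\<bar>measure_pmf.prob (law n d h) {R. \<alpha> \<subseteq> R \<and> R \<in> S} -
      measure_pmf.prob (law n d h) {R. \<alpha> \<subseteq> R} * measure_pmf.prob (law n d h) S\<bar> \<le> measure_pmf.prob (law n d h) {R. \<alpha> \<subseteq> R} * \<eta> k"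
proof -
  define \<Theta> where "\<Theta> = reorderings n d"
  define C where "C = real (card \<Theta>)"
  define f where "f \<sigma> = measure_pmf.prob (rand_at n d h \<sigma>) {R. \<alpha> \<subseteq> R}" for \<sigma>
  define g where "g \<sigma> = measure_pmf.prob (rand_at n d h \<sigma>) {R. R \<in> S}" for \<sigma>
  define fg where "fg \<sigma> = measure_pmf.prob (rand_at n d h \<sigma>) {R. \<alpha> \<subseteq> R \<and> R \<in> S}" for \<sigma>
  define \<epsilon>1 where "\<epsilon>1 = real k * (57 * (real k)\<^sup>2 * real (d - 1) ^ (r - 1) / real n)"
  define \<epsilon>2 where "\<epsilon>2 = 2 * ((9 * (real k)\<^sup>2 + 6 * real k * real d) * real (d - 1) ^ (r - 1) / real n)"
  have fin: "finite \<Theta>" by (simp add: \<Theta>_def)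
  have C0: "C > 0" unfolding C_def \<Theta>_def by (simp add: card_gt_0_iff)
  define mix where "mix a b = (\<lambda>v. if v \<in> bins \<alpha> then a v else b v)" for a b :: "nat \<Rightarrow> nat \<Rightarrow> nat"
  have mix: "mix a b \<in> \<Theta>" if "a \<in> \<Theta>" "b \<in> \<Theta>" for a b
    using that unfolding \<Theta>_def reorderings_def PiE_dflt_def mix_def by auto
  have bins: "finite (bins \<alpha>)" "card (bins \<alpha>) = k"
    using card_bins[OF s(1)] bins_edges[OF s(1)] s(2) \<alpha>(1) by auto
  have \<alpha>V: "\<Union>\<alpha> \<subseteq> {..<n} \<times> {..<d}"
    unfolding \<alpha>(1)[symmetric] Union_edges using s(1) by (simp add: cyc_def)
  have f0: "f \<sigma> \<ge> 0" for \<sigma> by (simp add: f_def)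
  have 1: "\<bar>fg \<sigma> - f \<sigma> * g \<sigma>\<bar> \<le> f \<sigma> * \<epsilon>1" if "\<sigma> \<in> \<Theta>" for \<sigma>
  proof -
    have t: "types n d h r (types_of h d \<sigma>)" using T that unfolding \<Theta>_def by blast
    show ?thesis
      using types.fixed_types(1)[OF t s r2 \<alpha> S] types.\<epsilon>_def[OF t, of k]
      unfolding fg_def f_def g_def rand_at_def \<epsilon>1_def by simp
  qed
  have 2: "\<bar>(\<Sum>a\<in>\<Theta>. f a) * (\<Sum>b\<in>\<Theta>. g b) - C * (\<Sum>a\<in>\<Theta>. f a * g a)\<bar> \<le> \<epsilon>2 * C * (\<Sum>a\<in>\<Theta>. f a)"
    unfolding C_def
  proof (rule exchange_sum[where mix = mix])
    show "mix (mix a b) (mix b a) = a" for a b by (auto simp: mix_def)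
    fix a b assume ab: "a \<in> \<Theta>" "b \<in> \<Theta>"
    have t: "types n d h r (types_of h d (mix a b))" "types n d h r (types_of h d a)" "types n d h r (types_of h d b)"
      using T mix ab unfolding \<Theta>_def by blast+
    show "f (mix a b) = f a"
      unfolding f_def rand_at_def
      by (rule prob_cycle_agree[OF t(1,2) _ \<alpha>V]) (simp add: types_of_def mix_def)
    show "\<bar>g b - g (mix a b)\<bar> \<le> \<epsilon>2"
      using prob_past_agree[OF t(3,1) _ bins r2 S] types.touch_def[OF t(1), of k]
      unfolding g_def rand_at_def \<epsilon>2_def by (simp add: types_of_def mix_def)
  qed (use fin mix f0 in auto)
  have 3: "\<bar>(\<Sum>\<sigma>\<in>\<Theta>. fg \<sigma>) - (\<Sum>\<sigma>\<in>\<Theta>. f \<sigma> * g \<sigma>)\<bar> \<le> \<epsilon>1 * (\<Sum>\<sigma>\<in>\<Theta>. f \<sigma>)"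
  proof -
    have "\<bar>(\<Sum>\<sigma>\<in>\<Theta>. fg \<sigma>) - (\<Sum>\<sigma>\<in>\<Theta>. f \<sigma> * g \<sigma>)\<bar> \<le> (\<Sum>\<sigma>\<in>\<Theta>. \<bar>fg \<sigma> - f \<sigma> * g \<sigma>\<bar>)"
      unfolding sum_subtractf[symmetric] by (rule sum_abs)
    also have "\<dots> \<le> (\<Sum>\<sigma>\<in>\<Theta>. f \<sigma> * \<epsilon>1)" by (intro sum_mono 1)
    finally show ?thesis by (simp add: sum_distrib_left mult.commute)
  qed
  define Sf Sg Sfg Sh where "Sf = (\<Sum>\<sigma>\<in>\<Theta>. f \<sigma>)" and "Sg = (\<Sum>\<sigma>\<in>\<Theta>. g \<sigma>)" and "Sfg = (\<Sum>\<sigma>\<in>\<Theta>. f \<sigma> * g \<sigma>)" and "Sh = (\<Sum>\<sigma>\<in>\<Theta>. fg \<sigma>)"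
  have "\<bar>Sh / C - Sf / C * (Sg / C)\<bar> = \<bar>(Sh - Sfg) / C + (C * Sfg - Sf * Sg) / (C * C)\<bar>"
    using C0 by (simp add: field_simps)
  also have "\<dots> \<le> \<bar>(Sh - Sfg) / C\<bar> + \<bar>(C * Sfg - Sf * Sg) / (C * C)\<bar>" by (rule abs_triangle_ineq)
  also have "\<bar>(Sh - Sfg) / C\<bar> \<le> \<epsilon>1 * Sf / C"
    using 3 C0 unfolding Sh_def[symmetric] Sfg_def[symmetric] Sf_def[symmetric] by (simp add: divide_right_mono)
  also have "\<bar>(C * Sfg - Sf * Sg) / (C * C)\<bar> \<le> \<epsilon>2 * C * Sf / (C * C)"
  proof -
    have "\<bar>C * Sfg - Sf * Sg\<bar> \<le> \<epsilon>2 * C * Sf"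
      using 2 unfolding Sg_def[symmetric] Sfg_def[symmetric] Sf_def[symmetric] by (simp only: abs_minus_commute)
    from divide_right_mono[OF this, of "C * C"] show ?thesis using C0 by simp
  qed
  also have "\<epsilon>1 * Sf / C + \<epsilon>2 * C * Sf / (C * C) = Sf / C * (\<epsilon>1 + \<epsilon>2)"
    using C0 by (simp add: field_simps)
  finally show ?thesis
    unfolding prob_law \<Theta>_def[symmetric] C_def[symmetric]
    by (simp add: Sf_def Sg_def Sh_def f_def g_def fg_def \<epsilon>1_def \<epsilon>2_def \<eta>_def)
qed

text \<open>This is \<open>cycle_lambda\<close> for h = 0 and \<open>cycle_mu\<close> for h = 2, as
  a function of the length of the cycle.\<close>

definition mean :: "nat \<Rightarrow> real" where
  "mean k = (if h = 0 then 1 / (real n * real d) ^ k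
     else 1 / (real n * real d) ^ k + ((-1) ^ k - 1) / (real n * real d * (real d - 1)) ^ k)"

lemma n_pos: "n > 0"
proof -
  have "10 * (real r)\<^sup>2 > 0" using r2 by simp
  hence "real n > 0" using n_large by linarith
  thus ?thesis by simp
qed

lemma c_nonneg: "c \<ge> 0" by (simp add: c_def)

lemma weight_scaled:
  assumes "\<And>t. t \<in> set s \<Longrightarrow> w (fst t) (snd t) = C * w' (fst t) (snd t)"
  shows "weight w s = C ^ length s * weight w' s"
  using assms by (induction s) auto

lemma mem_H0:
  assumes "\<sigma> \<in> reorderings n d" "x \<in> {..<n} \<times> {..<d}"
  shows "x \<in> types.H0 n (types_of h d \<sigma>) \<longleftrightarrow> snd x \<in> \<sigma> (fst x) ` {d - h..<d}"
  unfolding types.H0_def[OF T[OF assms(1)]] using assms(2) by (cases x) (simp add: types_of_def)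

definition C where "C = real (card (reorderings n d))"

lemma C_pos: "C > 0"
  unfolding C_def by (simp add: card_gt_0_iff)

lemma cyc_nth_mem:
  assumes "cyc n d s" "i < length s"
  shows "fst (s ! i) \<in> {..<n} \<times> {..<d}" "snd (s ! i) \<in> {..<n} \<times> {..<d}"
proof -
  have "s ! i \<in> set s" using assms(2) by simp
  hence "fst (s ! i) \<in> set (ends s)" "snd (s ! i) \<in> set (ends s)" unfolding set_ends by blast+
  thus "fst (s ! i) \<in> {..<n} \<times> {..<d}" "snd (s ! i) \<in> {..<n} \<times> {..<d}"
    using assms(1) unfolding cyc_def by blast+
qed

text \<open>
  The probability that two prevertices are matched, as a function of their types, has the orthogonal expansion
  \<open>(1 + \<chi> x * \<chi> y) / (n d)\<close> with \<open>\<chi>\<close> centred. Hence only the empty product and the product over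
  the whole cycle contribute to the mean.
\<close>

lemma mean_approx:
  assumes s: "cyc n d s" "length s = k"
  shows "(\<Sum>\<sigma>\<in>reorderings n d. types.approx n d h r (types_of h d \<sigma>) s) / C = mean k"
proof (cases "h = 0")
  case True
  have "types.approx n d h r (types_of h d \<sigma>) s = 1 / (real n * real d) ^ k" if \<sigma>: "\<sigma> \<in> reorderings n d" for \<sigma>
  proof -
    interpret t: types n d h r "types_of h d \<sigma>" by (rule T[OF \<sigma>])
    have c1: "1 + t.c > 0" using t.c_nonneg by linarith
    have h2: "h \<noteq> 2" using True by simp
    have U: "x \<in> t.U0" if "x \<in> {..<n} \<times> {..<d}" for x
    proof -
      have "x \<notin> t.H0" unfolding mem_H0[OF \<sigma> that] by (simp add: True)
      thus ?thesis using that unfolding t.U0_def t.V_def by blast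
    qed
    have NN: "real t.N = real n * real d" unfolding t.N_def by (simp add: True)
    have "t.wt (fst t) (snd t) = (1 + t.c) * (1 / (real n * real d))" if t: "t \<in> set s" for t
    proof -
      have "fst t \<in> set (ends s)" "snd t \<in> set (ends s)" unfolding set_ends using t by blast+
      hence "fst t \<in> t.U0" "snd t \<in> t.U0" using s(1) U unfolding cyc_def by blast+
      thus ?thesis unfolding t.wt_def NN by (simp only: simp_thms if_True) simp
    qed
    from weight_scaled[of s t.wt "1 + t.c" "\<lambda>_ _. 1 / (real n * real d)", OF this]
    have "weight t.wt s = (1 + t.c) ^ k * weight (\<lambda>_ _. 1 / (real n * real d)) s" unfolding s(2) .
    moreover have "weight (\<lambda>_ _. 1 / (real n * real d)) s = 1 / (real n * real d) ^ k"
      unfolding weight_nth s(2) by (simp add: power_one_over)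
    moreover have "t.approx s = weight t.wt s / (1 + t.c) ^ length s"
      unfolding t.approx_def by (rule if_not_P) (use h2 in blast)
    ultimately show ?thesis unfolding s(2) using c1 by simp
  qed
  hence "(\<Sum>\<sigma>\<in>reorderings n d. types.approx n d h r (types_of h d \<sigma>) s) = (\<Sum>\<sigma>\<in>reorderings n d. 1 / (real n * real d) ^ k)"
    by (intro sum.cong refl)
  moreover have "mean k = 1 / (real n * real d) ^ k" unfolding mean_def by (rule if_P[OF True])
  ultimately show ?thesis using C_pos by (simp add: C_def)
next
  case False
  hence h2: "h = 2" using h by simp
  define D where "D = real (d - 2)"
  have D: "D > 0" "real d = D + 2" using d by (auto simp: D_def)
  \<comment> \<open>With the value \<open>a\<close> at Hamiltonian prevertices and
    \<open>- (1 / a)\<close> elsewhere, one plus the product of two values is d / 2 for two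
    Hamiltonian prevertices, d / (d - 2) for two others and 0 for a mixed pair. Up to the factor 1 +
    c, these are the three values of \<open>wt\<close> times n d.\<close>
  define a where "a = sqrt (D / 2)"
  have a: "a > 0" "a\<^sup>2 = D / 2" using D by (simp_all add: a_def)
  define f where "f b = (if b then a else - (1 / a))" for b
  define fH where "fH b = (if b then 1 else (0::real))" for b
  define W where "W g \<sigma> x = val g d (snd x) (\<sigma> (fst x))" for g and \<sigma> :: "nat \<Rightarrow> nat \<Rightarrow> nat" and x :: prevertex
  have n0: "real n > 0" using n_pos by simp
  have d2: "d \<ge> 2" using d by simp
  have k0: "k > 0" using s by (auto simp: cyc_def)
  have aa: "D / a = 2 * a" using a by (simp add: field_simps power2_eq_square)
  have ia: "1 / a * (1 / a) = 2 / D" using a D by (simp add: field_simps power2_eq_square)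
  \<comment> \<open>The product of the weights has to be replaced by 0 when all pairs are
    Hamiltonian. The second term does this, as \<open>fH\<close> yields the indicator of a
    Hamiltonian prevertex.\<close>
  have ap: "types.approx n d h r (types_of h d \<sigma>) s =
      (1 / (real n * real d)) ^ k * (\<Sum>I\<in>Pow {..<k}. \<Prod>i\<in>I. W f \<sigma> (fst (s ! i)) * W f \<sigma> (snd (s ! i)))
      - (1 / (2 * real n)) ^ k * (\<Prod>i\<in>{..<k}. W fH \<sigma> (fst (s ! i)) * W fH \<sigma> (snd (s ! i)))"
    if \<sigma>: "\<sigma> \<in> reorderings n d" for \<sigma>
  proof -
    interpret t: types n d h r "types_of h d \<sigma>" by (rule T[OF \<sigma>])
    have c1: "1 + t.c > 0" using t.c_nonneg by linarith
    have NN: "real t.N = real n * D" unfolding t.N_def by (simp add: h2 D_def)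
    have H: "x \<in> t.H0 \<longleftrightarrow> snd x \<in> \<sigma> (fst x) ` {d - 2..<d}" if "x \<in> {..<n} \<times> {..<d}" for x
      using mem_H0[OF \<sigma> that] unfolding h2 .
    have U: "x \<in> t.U0 \<longleftrightarrow> x \<notin> t.H0" if "x \<in> {..<n} \<times> {..<d}" for x
      using that unfolding t.U0_def t.V_def by blast
    have Wf: "W f \<sigma> x = (if x \<in> t.H0 then a else - (1 / a))" if "x \<in> {..<n} \<times> {..<d}" for x
      unfolding W_def val_def f_def H[OF that] ..
    have WH: "W fH \<sigma> x = (if x \<in> t.H0 then 1 else 0)" if "x \<in> {..<n} \<times> {..<d}" for x
      unfolding W_def val_def fH_def H[OF that] ..
    have wt: "t.wt x y = (1 + t.c) * (1 / (real n * real d) * (1 + W f \<sigma> x * W f \<sigma> y))"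
      if xy: "x \<in> {..<n} \<times> {..<d}" "y \<in> {..<n} \<times> {..<d}" for x y
    proof -
      have d0: "real d > 0" using D by linarith
      have a1: "1 + a * a = real d / 2" using a(2) D by (simp add: power2_eq_square)
      have e1: "1 / (real n * real d) * (1 + a * a) = 1 / (2 * real n)" unfolding a1 using d0 n0 by simp
      have a2: "1 + 1 / a * (1 / a) = real d / D" unfolding ia using D by (simp add: field_simps)
      have e2: "1 / (real n * real d) * (1 + 1 / a * (1 / a)) = 1 / (real n * D)" unfolding a2 using d0 n0 by simp
      have e3: "1 + a * (- (1 / a)) = 0" "1 + (- (1 / a)) * a = 0" using a(1) by simp_all
      show ?thesis
        unfolding t.wt_def NN U[OF xy(1)] U[OF xy(2)] Wf[OF xy(1)] Wf[OF xy(2)]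
        using e1 e2 e3 by (cases "x \<in> t.H0"; cases "y \<in> t.H0") (simp_all only: simp_thms if_True if_False minus_mult_minus mult_zero_right times_divide_eq_right mult_1_right)
    qed
    have "t.wt (fst t) (snd t) = (1 + t.c) * (1 / (real n * real d) * (1 + W f \<sigma> (fst t) * W f \<sigma> (snd t)))" if t: "t \<in> set s" for t
    proof -
      have "fst t \<in> set (ends s)" "snd t \<in> set (ends s)" unfolding set_ends using t by blast+
      thus ?thesis using s(1) unfolding cyc_def by (intro wt) blast+
    qed
    from weight_scaled[of s t.wt "1 + t.c" "\<lambda>x y. 1 / (real n * real d) * (1 + W f \<sigma> x * W f \<sigma> y)", OF this]
    have w1: "weight t.wt s / (1 + t.c) ^ length s = (\<Prod>i<k. 1 / (real n * real d) * (1 + W f \<sigma> (fst (s ! i)) * W f \<sigma> (snd (s ! i))))"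
      unfolding weight_nth[of "\<lambda>x y. 1 / (real n * real d) * (1 + W f \<sigma> x * W f \<sigma> y)"] s(2) using c1 by simp
    also have "\<dots> = (1 / (real n * real d)) ^ k * (\<Prod>i<k. W f \<sigma> (fst (s ! i)) * W f \<sigma> (snd (s ! i)) + 1)"
      by (simp only: prod.distrib prod_constant card_lessThan add.commute)
    also have "(\<Prod>i<k. W f \<sigma> (fst (s ! i)) * W f \<sigma> (snd (s ! i)) + 1) = (\<Sum>I\<in>Pow {..<k}. \<Prod>i\<in>I. W f \<sigma> (fst (s ! i)) * W f \<sigma> (snd (s ! i)))"
      by (subst prod_add) simp_all
    finally have w2: "weight t.wt s / (1 + t.c) ^ length s = (1 / (real n * real d)) ^ k * (\<Sum>I\<in>Pow {..<k}. \<Prod>i\<in>I. W f \<sigma> (fst (s ! i)) * W f \<sigma> (snd (s ! i)))" .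
    show ?thesis
    proof (cases "\<forall>t\<in>set s. fst t \<in> t.H0 \<and> snd t \<in> t.H0")
      case True
      have i: "fst (s ! i) \<in> t.H0 \<and> snd (s ! i) \<in> t.H0" if "i < k" for i
        using bspec[OF True, of "s ! i"] that s(2) by simp
      have "(\<Prod>i<k. W fH \<sigma> (fst (s ! i)) * W fH \<sigma> (snd (s ! i))) = 1"
        using i cyc_nth_mem[OF s(1)] s(2) by (intro prod.neutral) (simp add: WH)
      moreover have "weight t.wt s / (1 + t.c) ^ length s = (1 / (2 * real n)) ^ k"
      proof -
        have "t.wt (fst t) (snd t) = (1 + t.c) * (1 / (2 * real n))" if "t \<in> set s" for t
        proof -
          have "fst t \<in> t.H0" "snd t \<in> t.H0" "fst t \<notin> t.U0" using bspec[OF True that] unfolding t.U0_def by blast+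
          thus ?thesis unfolding t.wt_def by (simp only: simp_thms if_True if_False) simp
        qed
        from weight_scaled[of s t.wt "1 + t.c" "\<lambda>_ _. 1 / (2 * real n)", OF this] show ?thesis
          using c1 unfolding weight_nth[of "\<lambda>_ _. 1 / (2 * real n)"] s(2) by simp
      qed
      moreover have "t.approx s = 0" unfolding t.approx_def by (rule if_P) (use True h2 in blast)
      ultimately show ?thesis using w2 by simp
    next
      case F: False
      then obtain t where t: "t \<in> set s" "\<not> (fst t \<in> t.H0 \<and> snd t \<in> t.H0)" by blast
      obtain i where i: "i < k" "s ! i = t" using t(1)[unfolded in_set_conv_nth s(2)] by blast
      have "W fH \<sigma> (fst (s ! i)) * W fH \<sigma> (snd (s ! i)) = 0"
        using t(2) i cyc_nth_mem[OF s(1), of i] s(2) by (auto simp: WH)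
      hence "(\<Prod>i<k. W fH \<sigma> (fst (s ! i)) * W fH \<sigma> (snd (s ! i))) = 0"
        using i(1) by (intro prod_zero) auto
      moreover have "t.approx s = weight t.wt s / (1 + t.c) ^ length s"
        unfolding t.approx_def by (rule if_not_P) (use F in blast)
      ultimately show ?thesis using w2 by simp
    qed
  qed
  have dD: "real (d - 2) = D" by (simp add: D_def)
  have fT: "f True = a" and fF: "f False = - (1 / a)" by (simp_all add: f_def)
  have fm: "2 * f True + real (d - 2) * f False = 0" unfolding dD fT fF using aa by simp
  have fF2: "(f False)\<^sup>2 = 2 / D" unfolding fF using ia by (simp add: power2_eq_square)
  have fq: "2 * (f True)\<^sup>2 + real (d - 2) * (f False)\<^sup>2 = real d"
    unfolding dD fF2 unfolding fT a(2) D(2) using D(1) by simp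
  have rho: "(0\<^sup>2 - real d) / (real d * (real d - 1)) = - 1 / (real d - 1)"
  proof -
    have "(0\<^sup>2 - real d) / (real d * (real d - 1)) = (real d * (- 1)) / (real d * (real d - 1))" by simp
    also have "\<dots> = - 1 / (real d - 1)" using d2 by (intro mult_divide_mult_cancel_left) simp
    finally show ?thesis .
  qed
  have E: "(\<Sum>\<sigma>\<in>reorderings n d. \<Prod>i\<in>I. W f \<sigma> (fst (s ! i)) * W f \<sigma> (snd (s ! i))) / C =
      (if I = {} then 1 else if I = {..<k} then (- 1 / (real d - 1)) ^ k else 0)" if I: "I \<in> Pow {..<k}" for I
  proof -
    have I': "I \<subseteq> {..<length s}" using I s(2) by simp
    show ?thesis
      using mean_cycle_subset[OF s(1) d2 I' disjI1[OF fm]] unfolding W_def C_def s(2) fm fq rho .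
  qed
  have vH: "2 * fH True + real (d - 2) * fH False = 2" "2 * (fH True)\<^sup>2 + real (d - 2) * (fH False)\<^sup>2 = 2"
    "2\<^sup>2 - 2 = (2 :: real)" by (simp_all add: fH_def)
  have kne: "{..<k} \<noteq> {}" using k0 by (simp add: lessThan_empty_iff)
  \<comment> \<open>The two prevertices of the cycle in a bin are both Hamiltonian with probability
    2 / (d (d - 1)). As \<open>fH\<close> is not centred, \<open>mean_cycle_subset\<close> is
    applied to the full index set.\<close>
  have EH: "(\<Sum>\<sigma>\<in>reorderings n d. \<Prod>i\<in>{..<k}. W fH \<sigma> (fst (s ! i)) * W fH \<sigma> (snd (s ! i))) / C = (2 / (real d * (real d - 1))) ^ k"
    using mean_cycle_subset[OF s(1) d2 order_refl disjI2[OF refl], of fH]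
    unfolding W_def C_def s(2) vH if_not_P[OF kne] if_P[OF refl] .
  define A where "A = (1 / (real n * real d)) ^ k"
  define B where "B = (1 / (2 * real n)) ^ k"
  define X where "X \<sigma> I = (\<Prod>i\<in>I. W f \<sigma> (fst (s ! i)) * W f \<sigma> (snd (s ! i)))" for \<sigma> I
  define Y where "Y \<sigma> = (\<Prod>i\<in>{..<k}. W fH \<sigma> (fst (s ! i)) * W fH \<sigma> (snd (s ! i)))" for \<sigma>
  have "(\<Sum>\<sigma>\<in>reorderings n d. types.approx n d h r (types_of h d \<sigma>) s) = (\<Sum>\<sigma>\<in>reorderings n d. A * (\<Sum>I\<in>Pow {..<k}. X \<sigma> I) - B * Y \<sigma>)"
    by (intro sum.cong refl) (simp only: ap A_def B_def X_def Y_def)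
  also have "\<dots> = A * (\<Sum>\<sigma>\<in>reorderings n d. \<Sum>I\<in>Pow {..<k}. X \<sigma> I) - B * (\<Sum>\<sigma>\<in>reorderings n d. Y \<sigma>)"
    by (simp only: sum_subtractf sum_distrib_left[symmetric])
  also have "(\<Sum>\<sigma>\<in>reorderings n d. \<Sum>I\<in>Pow {..<k}. X \<sigma> I) = (\<Sum>I\<in>Pow {..<k}. \<Sum>\<sigma>\<in>reorderings n d. X \<sigma> I)"
    by (rule sum.swap)
  finally have "(\<Sum>\<sigma>\<in>reorderings n d. types.approx n d h r (types_of h d \<sigma>) s) / C =
      A * (\<Sum>I\<in>Pow {..<k}. (\<Sum>\<sigma>\<in>reorderings n d. X \<sigma> I) / C) - B * ((\<Sum>\<sigma>\<in>reorderings n d. Y \<sigma>) / C)"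
    by (simp only: sum_divide_distrib[symmetric] diff_divide_distrib times_divide_eq_right)
  hence "(\<Sum>\<sigma>\<in>reorderings n d. types.approx n d h r (types_of h d \<sigma>) s) / C =
      (1 / (real n * real d)) ^ k * (\<Sum>I\<in>Pow {..<k}. (\<Sum>\<sigma>\<in>reorderings n d. \<Prod>i\<in>I. W f \<sigma> (fst (s ! i)) * W f \<sigma> (snd (s ! i))) / C)
      - (1 / (2 * real n)) ^ k * ((\<Sum>\<sigma>\<in>reorderings n d. \<Prod>i\<in>{..<k}. W fH \<sigma> (fst (s ! i)) * W fH \<sigma> (snd (s ! i))) / C)"
    unfolding A_def B_def X_def Y_def .
  also have "(\<Sum>I\<in>Pow {..<k}. (\<Sum>\<sigma>\<in>reorderings n d. \<Prod>i\<in>I. W f \<sigma> (fst (s ! i)) * W f \<sigma> (snd (s ! i))) / C) =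
      (\<Sum>I\<in>Pow {..<k}. if I = {} then 1 else if I = {..<k} then (- 1 / (real d - 1)) ^ k else 0)"
    by (rule sum.cong[OF refl E])
  also have "\<dots> = (\<Sum>I\<in>{{}, {..<k}}. if I = {} then 1 else if I = {..<k} then (- 1 / (real d - 1)) ^ k else 0)"
    by (intro sum.mono_neutral_right) auto
  also have "\<dots> = 1 + (- 1 / (real d - 1)) ^ k"
    using kne by simp
  also note EH
  \<comment> \<open>The removed case contributes 1 / (n d (d - 1))^k, which is the - 1 in the
    numerator of the correction; the product over the whole cycle supplies the (-1)^k.\<close>
  also have "(1 / (real n * real d)) ^ k * (1 + (- 1 / (real d - 1)) ^ k) - (1 / (2 * real n)) ^ k * (2 / (real d * (real d - 1))) ^ k = mean k"
  proof -
    have "(1 / (2 * real n)) ^ k * (2 / (real d * (real d - 1))) ^ k = (1 / (real n * real d * (real d - 1))) ^ k"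
      unfolding power_mult_distrib[symmetric] by (intro arg_cong[where f = "\<lambda>x. x ^ k"]) simp
    moreover have "(1 / (real n * real d)) ^ k * (- 1 / (real d - 1)) ^ k = (- 1) ^ k * (1 / (real n * real d * (real d - 1))) ^ k"
      unfolding power_mult_distrib[symmetric] by (intro arg_cong[where f = "\<lambda>x. x ^ k"]) simp
    ultimately show ?thesis
      using False by (simp add: mean_def distrib_left power_one_over diff_divide_distrib)
  qed
  finally show ?thesis .
qed

lemma prob_cycle:
  assumes s: "cyc n d s" "length s = k" "k \<le> r" and \<alpha>: "edges s = \<alpha>" "\<alpha> \<in> cycles_upto n d r"
  shows "mean k \<le> measure_pmf.prob (law n d h) {R. \<alpha> \<subseteq> R}" "measure_pmf.prob (law n d h) {R. \<alpha> \<subseteq> R} \<le> (1 + c) ^ k * mean k"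
proof -
  have b: "types.approx n d h r (types_of h d \<sigma>) s \<le> measure_pmf.prob (rand_at n d h \<sigma>) {R. \<alpha> \<subseteq> R}"
    "measure_pmf.prob (rand_at n d h \<sigma>) {R. \<alpha> \<subseteq> R} \<le> (1 + c) ^ k * types.approx n d h r (types_of h d \<sigma>) s"
    if \<sigma>: "\<sigma> \<in> reorderings n d" for \<sigma>
    using types.fixed_types(2,3)[OF T[OF \<sigma>] s r2 \<alpha>] types.c_def[OF T[OF \<sigma>]] unfolding rand_at_def c_def by simp_all
  show "mean k \<le> measure_pmf.prob (law n d h) {R. \<alpha> \<subseteq> R}"
    unfolding prob_law mean_approx[OF s(1,2), symmetric] C_def[symmetric]
    using C_pos b(1) by (intro divide_right_mono sum_mono) auto
  have "measure_pmf.prob (law n d h) {R. \<alpha> \<subseteq> R} \<le> (\<Sum>\<sigma>\<in>reorderings n d. (1 + c) ^ k * types.approx n d h r (types_of h d \<sigma>) s) / C"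
    unfolding prob_law C_def[symmetric] using C_pos b(2) by (intro divide_right_mono sum_mono) auto
  also have "\<dots> = (1 + c) ^ k * mean k"
    unfolding mean_approx[OF s(1,2), symmetric] by (simp add: sum_distrib_left)
  finally show "measure_pmf.prob (law n d h) {R. \<alpha> \<subseteq> R} \<le> (1 + c) ^ k * mean k" .
qed

end

lemma chain_bins_closed:
  assumes "chain s" "s \<noteq> []" "fst (fst (hd s)) \<in> A" "\<And>t. t \<in> set s \<Longrightarrow> fst (fst t) \<in> A \<Longrightarrow> fst (snd t) \<in> A"
  shows "\<forall>t\<in>set s. fst (fst t) \<in> A"
  using assms
proof (induction s)
  case (Cons t s)
  show ?case
  proof (cases "s = []")
    case False
    have "fst (snd t) \<in> A" using Cons.prems(3,4) by simp
    hence "fst (fst (hd s)) \<in> A" using Cons.prems(1) False by (simp add: chain_Cons)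
    moreover have "chain s" using Cons.prems(1) False by (simp add: chain_Cons)
    ultimately show ?thesis using Cons.IH[OF _ False] Cons.prems(3,4) by simp
  qed (use Cons in simp)
qed simp

section \<open>The Hamiltonian part of the tilted law\<close>

definition column :: "nat \<Rightarrow> nat \<Rightarrow> prevertex set" where
  "column d v = {v} \<times> {d - 2..<d}"

lemma column_pair: "d \<ge> 2 \<Longrightarrow> column d v = {(v, d - 2), (v, d - 1)}"
  by (auto simp: column_def)

lemma Union_columns: "\<Union>(column d ` I) = I \<times> {d - 2..<d}"
  by (auto simp: column_def)

text \<open>Induction over contractions: reinserting the column of \<open>v\<close> replaces the
  step from \<open>a\<close> to \<open>b\<close> by one from \<open>a\<close> to \<open>y\<close>
  and one from \<open>z\<close> to \<open>b\<close>, which extends the traversal of the contracted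
  cycle.\<close>

lemma ham_columns_cyc:
  assumes d: "d \<ge> 2" and I: "finite I" "I \<noteq> {}" "I \<subseteq> {..<n}"
  shows "M \<in> ham (column d ` I) \<Longrightarrow> \<exists>s. cyc n d s \<and> edges s = M"
  using I
proof (induction I arbitrary: M rule: finite_ne_induct)
  case (singleton v)
  define y z where "y = (v, d - 2)" and "z = (v, d - 1)"
  have col: "column d ` {v} = {{y, z}}" using d by (simp add: column_pair y_def z_def)
  have yz: "y \<noteq> z" using d by (simp add: y_def z_def)
  have M: "M \<in> matchings {y, z}" using ham_matchings[OF singleton(1)] unfolding col by simp
  have "mate M y = z"
    using mate_mem[OF M, of y] mate_neq[OF M, of y] by simp
  hence e: "{y, z} \<in> M" using mate_in[OF M, of y] by simp
  have "g = {y, z}" if g: "g \<in> M" for g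
  proof -
    have "g \<subseteq> {y, z}" "g \<noteq> {}" using matchings_Union[OF M] matchings_card[OF M g] g by auto
    then obtain w where "w \<in> g" "w \<in> {y, z}" by blast
    from matchings_disjoint[OF M g e this] show ?thesis .
  qed
  hence "M = {{y, z}}" using e by blast
  moreover have "cyc n d [(y, z)]"
    using singleton(2) d unfolding cyc_def by (auto simp: chain_Cons y_def z_def)
  ultimately show ?case by (intro exI[of _ "[(y, z)]"]) simp
next
  case (insert v I)
  define y z where "y = (v, d - 2)" and "z = (v, d - 1)"
  have cv: "column d v = {y, z}" using d by (simp add: column_pair y_def z_def)
  have yz: "y \<noteq> z" using d by (simp add: y_def z_def)
  define B where "B = column d ` I"
  have UB: "\<Union>B = I \<times> {d - 2..<d}" by (simp add: B_def Union_columns)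
  have out: "y \<notin> \<Union>B" "z \<notin> \<Union>B" unfolding UB using insert.hyps(3) by (simp_all add: y_def z_def)
  have Bne: "B \<noteq> {}" using insert.hyps(2) by (simp add: B_def)
  have M: "M \<in> ham (Set.insert {y, z} B)" using insert.prems(1) cv by (simp add: B_def)
  define M1 where "M1 = del y z M"
  define a where "a = mate M y"
  have D: "M1 \<in> ham B" "a \<in> \<Union>B" "ins y z M1 a = M"
    using del_ham[OF M out yz Bne] unfolding M1_def a_def by blast+
  note P1 = ham_matchings[OF D(1)]
  obtain s where s: "cyc n d s" "edges s = M1" using insert.IH[of M1] D(1) insert.prems(2) unfolding B_def by blast
  define b where "b = mate M1 a"
  have ab: "{a, b} \<in> M1" unfolding b_def using mate_in[OF P1 D(2)] .
  have "a \<in> \<Union>(edges s)" using ab s(2) by blast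
  then obtain s' where s': "cyc n d s'" "edges s' = edges s" "length s' = length s" "fst (hd s') = a"
    by (rule cyc_start[OF s(1)])
  obtain t q where tq: "s' = t # q" using s'(1) by (cases s') (auto simp: cyc_def)
  have ta: "fst t = a" using s'(4) tq by simp
  have "{a, snd t} \<in> M1" using s'(2) s(2) tq ta by auto
  hence "snd t = b" unfolding b_def using mate_eq[OF P1] by simp
  hence t: "t = (a, b)" using ta by (simp add: prod_eq_iff)
  have az: "a \<noteq> z" using D(2) out by blast
  have Meq: "M = Set.insert {y, a} (Set.insert {z, b} (M1 - {{a, b}}))"
    using D(3) az by (simp add: ins_def b_def)
  have dist: "distinct (ends s')" using s'(1) by (simp add: cyc_def)
  have eq: "edges q = M1 - {{a, b}}"
  proof -
    have "{a, b} \<notin> edges q" using dist edges_in_ends[of "{a, b}" q] by (auto simp: tq t)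
    moreover have "M1 = Set.insert {a, b} (edges q)" using s'(2) s(2) by (simp add: tq t)
    ultimately show ?thesis by simp
  qed
  have endsB: "set (ends s') = \<Union>B" unfolding Union_edges[symmetric] s'(2) s(2) by (rule matchings_Union[OF P1])
  define s'' where "s'' = (a, y) # (z, b) # q"
  have "edges s'' = M" unfolding Meq s''_def using eq by (simp add: insert_commute)
  moreover have "cyc n d s''"
    unfolding cyc_def
  proof (intro conjI)
    show "s'' \<noteq> []" by (simp add: s''_def)
    have c: "chain (((a, b) # q) @ [(a, b)])" using s'(1) by (simp add: cyc_def tq t)
    have "chain ([(a, y)] @ ((z, b) # q) @ [(a, y)])"
    proof -
      have "fst y = fst z" by (simp add: y_def z_def)
      moreover have "chain (((z, b) # q) @ [(a, y)])"
      proof -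
        have c1: "chain ((a, b) # q)" "fst (snd (last ((a, b) # q))) = fst a" "snd (last ((a, b) # q)) \<noteq> a"
          using c unfolding chain_append by simp_all
        have "chain ((z, b) # q)" using c1(1) by (simp add: chain_Cons)
        moreover have "snd (last ((z, b) # q)) = snd (last ((a, b) # q))" by (cases "q = []") simp_all
        ultimately show ?thesis using c1(2,3) unfolding chain_append by simp
      qed
      ultimately show ?thesis using yz by (simp add: chain_append chain_Cons)
    qed
    thus "chain (s'' @ [hd s''])" by (simp add: s''_def)
    have vb: "fst x \<noteq> v" if "x \<in> set (ends s')" for x
      using that insert.hyps(3) unfolding endsB UB by (auto simp: mem_Times_iff)
    have "distinct (map (\<lambda>t. fst (fst t)) s')" using s'(1) by (simp add: cyc_def)
    moreover have "v \<notin> set (map (\<lambda>t. fst (fst t)) s')"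
    proof
      assume "v \<in> set (map (\<lambda>t. fst (fst t)) s')"
      then obtain w where w: "w \<in> set s'" "v = fst (fst w)" by auto
      have "fst w \<in> set (ends s')" unfolding set_ends using w(1) by blast
      thus False using vb w(2) by blast
    qed
    ultimately show "distinct (map (\<lambda>t. fst (fst t)) s'')"
      by (simp add: s''_def tq t z_def)
    have "y \<notin> set (ends s')" "z \<notin> set (ends s')" unfolding endsB using out by blast+
    thus "distinct (ends s'')" using dist yz by (auto simp: s''_def tq t)
    have "set (ends s'') = {y, z} \<union> set (ends s')" by (auto simp: s''_def tq t)
    moreover have "y \<in> {..<n} \<times> {..<d}" "z \<in> {..<n} \<times> {..<d}" using insert.prems(2) d by (auto simp: y_def z_def)
    moreover have "set (ends s') \<subseteq> {..<n} \<times> {..<d}" using s'(1) by (simp add: cyc_def)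
    ultimately show "set (ends s'') \<subseteq> {..<n} \<times> {..<d}" by simp
  qed
  ultimately show ?case by (intro exI[of _ s'']) simp
qed

lemma projection_edges:
  assumes s: "cyc n d s"
  shows "projection (edges s) = cycle_edges (map (\<lambda>t. fst (fst t)) s)"
proof -
  define vs where "vs = map (\<lambda>t. fst (fst t)) s"
  have inj: "inj_on (\<lambda>i. {fst (s ! i), snd (s ! i)}) {..<length s}"
  proof (rule eq_card_imp_inj_on)
    have "(\<lambda>i. {fst (s ! i), snd (s ! i)}) ` {..<length s} = edges s"
      unfolding edges_def case_prod_unfold set_conv_nth by blast
    thus "card ((\<lambda>i. {fst (s ! i), snd (s ! i)}) ` {..<length s}) = card {..<length s}"
      using cyc_length[OF s] by simp
  qed simp
  have "edges s = (\<lambda>i. {fst (s ! i), snd (s ! i)}) ` {..<length s}"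
    unfolding edges_def case_prod_unfold set_conv_nth by blast
  hence "projection (edges s) = image_mset (\<lambda>i. fst ` {fst (s ! i), snd (s ! i)}) (mset_set {..<length s})"
    unfolding projection_def by (simp add: image_mset_mset_set[OF inj, symmetric] multiset.map_comp comp_def)
  also have "\<dots> = image_mset (\<lambda>i. {vs ! i, vs ! (Suc i mod length vs)}) (mset_set {..<length s})"
  proof (rule image_mset_cong)
    fix i assume "i \<in># mset_set {..<length s}"
    hence i: "i < length s" by simp
    have "Suc i mod length s < length s" using i by (intro mod_less_divisor) linarith
    thus "fst ` {fst (s ! i), snd (s ! i)} = {vs ! i, vs ! (Suc i mod length vs)}"
      using cyc_nth(1)[OF s i] i by (simp add: vs_def)
  qed
  finally show ?thesis by (simp add: cycle_edges_def vs_def)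
qed

text \<open>In one direction the vertex list is read off a traversal. In the other, \<open>M\<close>
  is completed by some matching of the remaining prevertices, so that \<open>cycle_steps\<close>
  provides a traversal; it never leaves a closed set of columns, which therefore contains all of
  them.\<close>

lemma hamiltonian_iff_ham:
  assumes n: "n \<ge> 1" and d: "d \<ge> 2" and ev: "even (n * (d - 2))" and M: "M \<in> matchings ({..<n} \<times> {d - 2..<d})"
  shows "is_hamiltonian_cycle n (projection M) \<longleftrightarrow> M \<in> ham (column d ` {..<n})"
proof
  assume "M \<in> ham (column d ` {..<n})"
  moreover have "{..<n} \<noteq> {}" using n by (simp add: lessThan_empty_iff)
  ultimately obtain s where s: "cyc n d s" "edges s = M"
    using ham_columns_cyc[OF d, of "{..<n}" n M] by auto
  have "set (map (\<lambda>t. fst (fst t)) s) = bins M" using bins_edges[OF s(1)] s(2) by simp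
  also have "bins M = {..<n}" unfolding bins_def matchings_Union[OF M] using d by (simp add: fst_image_times)
  finally show "is_hamiltonian_cycle n (projection M)"
    unfolding is_hamiltonian_cycle_def s(2)[symmetric] projection_edges[OF s(1)]
    using s(1) by (intro exI[of _ "map (\<lambda>t. fst (fst t)) s"]) (simp add: cyc_def)
next
  assume "is_hamiltonian_cycle n (projection M)"
  then obtain vs where vs: "distinct vs" "set vs = {..<n}" "projection M = cycle_edges vs"
    unfolding is_hamiltonian_cycle_def by blast
  have lvs: "length vs = n" using distinct_card[OF vs(1)] vs(2) by simp
  obtain Q where Q: "Q \<in> matchings ({..<n} \<times> {..<d - 2})"
    using matchings_nonempty[of "{..<n} \<times> {..<d - 2}"] ev by (auto simp: card_cartesian_product)
  have "Q \<union> M \<in> pairings n d"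
  proof -
    have V: "({..<n} \<times> {..<d - 2}) \<union> ({..<n} \<times> {d - 2..<d}) = {..<n} \<times> {..<d}" by auto
    have "disjnt q m" if "q \<in> Q" "m \<in> M" for q m
    proof -
      have "q \<subseteq> {..<n} \<times> {..<d - 2}" "m \<subseteq> {..<n} \<times> {d - 2..<d}"
        using matchings_Union[OF Q] matchings_Union[OF M] that by blast+
      moreover have "({..<n} \<times> {..<d - 2}) \<inter> ({..<n} \<times> {d - 2..<d}) = {}" by auto
      ultimately show ?thesis unfolding disjnt_def by blast
    qed
    note QM = this
    have one: "disjnt u v" if "R \<in> matchings W" "u \<in> R" "v \<in> R" "u \<noteq> v" for R u v and W :: "prevertex set"
      using matchings_disjoint[OF that(1-3)] that(4) unfolding disjnt_def by blast
    have "disjoint (Q \<union> M)"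
    proof (rule pairwiseI)
      fix u v assume uv: "u \<in> Q \<union> M" "v \<in> Q \<union> M" "u \<noteq> v"
      from uv(1,2) consider "u \<in> Q" "v \<in> Q" | "u \<in> M" "v \<in> M" | "u \<in> Q" "v \<in> M" | "v \<in> Q" "u \<in> M" by blast
      thus "disjnt u v"
      proof cases
        case 1 thus ?thesis using one[OF Q] uv(3) by simp
      next
        case 2 thus ?thesis using one[OF M] uv(3) by simp
      next
        case 3 thus ?thesis by (rule QM)
      next
        case 4
        from QM[OF this] show ?thesis by (rule disjnt_sym)
      qed
    qed
    moreover have "\<Union>(Q \<union> M) = {..<n} \<times> {..<d}"
      unfolding Union_Un_distrib matchings_Union[OF Q] matchings_Union[OF M] by (rule V)
    moreover have card: "card e = 2" if "e \<in> Q \<union> M" for e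
      using that matchings_card[OF Q] matchings_card[OF M] by blast
    moreover have "{} \<notin> Q \<union> M" using card[of "{}"] by auto
    ultimately show ?thesis unfolding pairings_def pairings_on_eq matchings_def partition_on_def by blast
  qed
  moreover have "is_cycle n (projection M)" unfolding is_cycle_def using n vs lvs by blast
  ultimately have "M \<in> cycles_of_length n d n" unfolding cycles_of_length_def by blast
  then obtain s where s: "cyc n d s" "length s = n" "edges s = M" by (rule cycle_steps)
  have UB: "\<Union>(column d ` {..<n}) = {..<n} \<times> {d - 2..<d}" by (rule Union_columns)
  show "M \<in> ham (column d ` {..<n})"
  proof (rule hamI)
    show "M \<in> matchings (\<Union>(column d ` {..<n}))" unfolding UB by (rule M)
    fix S assume S: "S \<subseteq> column d ` {..<n}" "S \<noteq> {}"
      and cl: "\<And>e. e \<in> M \<Longrightarrow> e \<inter> \<Union>S \<noteq> {} \<Longrightarrow> e \<subseteq> \<Union>S"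
    define A where "A = {v. v < n \<and> column d v \<in> S}"
    have SA: "S = column d ` A" using S(1) unfolding A_def by blast
    have US: "\<Union>S = A \<times> {d - 2..<d}" unfolding SA by (rule Union_columns)
    obtain v where v: "v \<in> A" using S(2) SA by auto
    have vn: "v < n" using v by (simp add: A_def)
    define z where "z = (v, d - 1)"
    have "z \<in> \<Union>M" unfolding matchings_Union[OF M] using vn d by (simp add: z_def)
    then obtain s' where s': "cyc n d s'" "edges s' = edges s" "length s' = length s" "fst (hd s') = z"
      using cyc_start[OF s(1)] unfolding s(3)[symmetric] by blast
    have MV: "w \<in> \<Union>M \<Longrightarrow> snd w \<in> {d - 2..<d}" for w unfolding matchings_Union[OF M] by (auto simp: mem_Times_iff)
    have "\<forall>t\<in>set s'. fst (fst t) \<in> A"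
    proof (rule chain_bins_closed[OF cyc_chain[OF s'(1)]])
      show "s' \<noteq> []" using s'(1) by (simp add: cyc_def)
      show "fst (fst (hd s')) \<in> A" using s'(4) v by (simp add: z_def)
      fix t assume t: "t \<in> set s'" "fst (fst t) \<in> A"
      have e: "{fst t, snd t} \<in> M" using in_edges[OF t(1)] s'(2) s(3) by simp
      have "fst t \<in> \<Union>S" unfolding US using t(2) MV[of "fst t"] e by (auto simp: mem_Times_iff)
      hence "snd t \<in> \<Union>S" using cl[OF e] by blast
      thus "fst (snd t) \<in> A" unfolding US by (simp add: mem_Times_iff)
    qed
    hence "bins M \<subseteq> A" using bins_edges[OF s'(1)] s'(2) s(3) by auto
    moreover have "bins M = {..<n}" unfolding bins_def matchings_Union[OF M] using d by (simp add: fst_image_times)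
    ultimately have "A = {..<n}" by (auto simp: A_def)
    thus "S = column d ` {..<n}" using SA by simp
  qed
qed

section \<open>Comparison with the Poisson vectors\<close>

lemma cond_pmf_of_set:
  assumes A: "finite A" and ne: "A \<inter> B \<noteq> {}"
  shows "cond_pmf (pmf_of_set A) B = pmf_of_set (A \<inter> B)"
proof (rule pmf_eqI)
  fix x
  have A0: "A \<noteq> {}" using ne by auto
  have "set_pmf (pmf_of_set A) \<inter> B \<noteq> {}" using A A0 ne by simp
  from pmf_cond[OF this, of x] show "pmf (cond_pmf (pmf_of_set A) B) x = pmf (pmf_of_set (A \<inter> B)) x"
    using A A0 ne by (auto simp: measure_pmf_of_set indicator_def card_gt_0_iff)
qed

text \<open>With h = 0 there are no types to draw, so every reordering gives the same law.\<close>

lemma config_law: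
  assumes "model n d 0 r"
  shows "law n d 0 = config_pmf n d"
proof -
  interpret model n d 0 r by (rule assms)
  have "rand_at n d 0 \<sigma> = config_pmf n d" if "\<sigma> \<in> reorderings n d" for \<sigma>
  proof -
    interpret t: types n d 0 r "types_of 0 d \<sigma>" by (rule T[OF that])
    have "t.H0 = {}" using t.card_H0 t.finite_H0 by simp
    hence U: "t.U0 = {..<n} \<times> {..<d}" by (simp add: t.U0_def t.V_def)
    show ?thesis
      unfolding rand_at_def rand_def U t.B0_empty[OF refl] config_pmf_def pairings_def pairings_on_eq
      by (simp add: pmf_of_set_singleton pair_return_pmf2 map_pmf_comp)
  qed
  hence "law n d 0 = bind_pmf (reordering_pmf n d) (\<lambda>_. config_pmf n d)"
    unfolding law_def by (intro bind_pmf_cong refl) (simp add: reordering_pmf_eq)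
  thus ?thesis by simp
qed

lemma image_Sigma:
  "(\<lambda>(i, j). (i, g i j)) ` Sigma I S = Sigma I (\<lambda>v. g v ` S v)"
  by force

text \<open>Reordering carries the last two prevertices of each bin to the random types, and
  \<open>rand\<close> is equivariant under such maps. The three independent draws may then be made
  in any order.\<close>

lemma tilted_law:
  assumes "model n d 2 r"
  shows "law n d 2 = tilted_pmf n d"
proof -
  interpret model n d 2 r by (rule assms)
  interpret t0: types n d 2 r "\<lambda>_. {d - 2..<d}"
    using d r2 even_nd n_large by unfold_locales auto
  have n1: "n \<ge> 1" using n_pos by simp
  have d2: "d \<ge> 2" using d by simp
  have B0: "t0.B0 = column d ` {..<n}" unfolding t0.B0_def column_def by simp
  have U0: "t0.U0 = {..<n} \<times> {..<d - 2}" unfolding t0.U0_Sigma by (intro Sigma_cong refl) auto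
  have ev: "even (n * (d - 2))" using even_nd d by auto
  have UB: "\<Union>t0.B0 = {..<n} \<times> {d - 2..<d}" unfolding B0 by (rule Union_columns)
  have hamU: "matchings ({..<n} \<times> {d - 2..<d}) \<inter> {H. is_hamiltonian_cycle n (projection H)} = ham t0.B0"
  proof (intro equalityI subsetI)
    fix M assume "M \<in> matchings ({..<n} \<times> {d - 2..<d}) \<inter> {H. is_hamiltonian_cycle n (projection H)}"
    thus "M \<in> ham t0.B0" using hamiltonian_iff_ham[OF n1 d2 ev, of M] unfolding B0 by simp
  next
    fix M assume M: "M \<in> ham t0.B0"
    hence "M \<in> matchings ({..<n} \<times> {d - 2..<d})" using ham_matchings[OF M] UB by simp
    thus "M \<in> matchings ({..<n} \<times> {d - 2..<d}) \<inter> {H. is_hamiltonian_cycle n (projection H)}"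
      using hamiltonian_iff_ham[OF n1 d2 ev, of M] M unfolding B0 by simp
  qed
  have ne: "matchings t0.U0 \<noteq> {}" "ham t0.B0 \<noteq> {}" using t0.inv_nonempty[OF t0.inv_start] by simp_all
  have hp: "hamiltonian_pmf n d = pmf_of_set (ham t0.B0)"
    unfolding hamiltonian_pmf_def pairings_on_eq hamU[symmetric]
    by (rule cond_pmf_of_set) (simp_all add: hamU ne(2) finite_matchings)
  have cp: "config_pmf n (d - 2) = pmf_of_set (matchings t0.U0)"
    unfolding config_pmf_def pairings_def pairings_on_eq U0 ..
  have at: "rand_at n d 2 \<sigma> = map_pmf (reorder \<sigma>) (rand t0.U0 t0.B0)" if \<sigma>: "\<sigma> \<in> reorderings n d" for \<sigma>
  proof -
    interpret t: types n d 2 r "types_of 2 d \<sigma>" by (rule T[OF \<sigma>])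
    define f where "f = (\<lambda>(i, j). (i, \<sigma> i j))"
    note p = reorderings_permutes[OF \<sigma>]
    have inj: "inj_on f ({..<n} \<times> {..<d})"
    proof (rule inj_onI)
      fix x y assume xy: "x \<in> {..<n} \<times> {..<d}" "y \<in> {..<n} \<times> {..<d}" "f x = f y"
      have e: "fst x = fst y" "\<sigma> (fst x) (snd x) = \<sigma> (fst y) (snd y)" using xy(3) unfolding f_def case_prod_unfold prod.inject by blast+
      have "fst x < n" using xy(1) by (simp add: mem_Times_iff)
      from injD[OF permutes_inj[OF p[OF this]] e(2)[folded e(1)]] have "snd x = snd y" .
      thus "x = y" using \<open>fst x = fst y\<close> by (simp add: prod_eq_iff)
    qed
    have U: "f ` t0.U0 = t.U0"
    proof -
      have "\<sigma> v ` ({..<d} - {d - 2..<d}) = {..<d} - types_of 2 d \<sigma> v" if "v < n" for v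
        unfolding types_of_def image_set_diff[OF permutes_inj[OF p[OF that]]] permutes_image[OF p[OF that]] ..
      thus ?thesis unfolding t0.U0_Sigma t.U0_Sigma f_def image_Sigma by (intro Sigma_cong) simp_all
    qed
    have B: "(`) f ` t0.B0 = t.B0"
    proof -
      have h2: "(2::nat) \<noteq> 0" by simp
      have "f ` ({v} \<times> {d - 2..<d}) = {v} \<times> types_of 2 d \<sigma> v" for v
        unfolding types_of_def f_def using image_Sigma[of \<sigma> "{v}" "\<lambda>_. {d - 2..<d}"] by auto
      thus ?thesis unfolding t0.B0_image[OF h2] t.B0_image[OF h2] image_image by simp
    qed
    have "t0.U0 \<union> \<Union>t0.B0 \<subseteq> {..<n} \<times> {..<d}"
      using t0.U0_subset t0.H0_subset unfolding t0.Union_B0 t0.V_def by simp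
    from map_pmf_rand[OF inj_on_subset[OF inj this] _ _ ne]
    have "map_pmf ((`) ((`) f)) (rand t0.U0 t0.B0) = rand t.U0 t.B0"
      using t0.inv_finite[OF t0.inv_start] unfolding U B by simp
    moreover have "reorder \<sigma> = (`) ((`) f)" by (rule ext) (simp add: reorder_def f_def)
    ultimately show ?thesis by (simp add: rand_at_def)
  qed
  have "law n d 2 = bind_pmf (reordering_pmf n d) (\<lambda>\<sigma>. map_pmf (reorder \<sigma>) (rand t0.U0 t0.B0))"
    unfolding law_def by (intro bind_pmf_cong refl) (simp add: reordering_pmf_eq at)
  also have "\<dots> = bind_pmf (reordering_pmf n d) (\<lambda>\<sigma>. bind_pmf (config_pmf n (d - 2)) (\<lambda>P. bind_pmf (hamiltonian_pmf n d) (\<lambda>H. return_pmf (reorder \<sigma> (P \<union> H)))))"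
    unfolding rand_def cp hp pair_pmf_def map_pmf_def by (simp add: bind_assoc_pmf bind_return_pmf)
  also have "\<dots> = bind_pmf (config_pmf n (d - 2)) (\<lambda>P. bind_pmf (reordering_pmf n d) (\<lambda>\<sigma>. bind_pmf (hamiltonian_pmf n d) (\<lambda>H. return_pmf (reorder \<sigma> (P \<union> H)))))"
    by (rule bind_commute_pmf)
  also have "\<dots> = bind_pmf (config_pmf n (d - 2)) (\<lambda>P. bind_pmf (hamiltonian_pmf n d) (\<lambda>H. bind_pmf (reordering_pmf n d) (\<lambda>\<sigma>. return_pmf (reorder \<sigma> (P \<union> H)))))"
    by (intro bind_pmf_cong refl bind_commute_pmf)
  also have "\<dots> = tilted_pmf n d" unfolding tilted_pmf_def ..
  finally show ?thesis .
qed

section \<open>Error terms and their sum over all cycles\<close>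

context model
begin

text \<open>The correction is 0 or -2 / (d - 1)^k times the main term, and (d - 1)^k \<ge> 2; for
  loops with d = 3 and h = 2 the two cancel.\<close>

lemma mean_bounds:
  assumes k: "k \<ge> 1"
  shows "0 \<le> mean k" "mean k \<le> 1 / (real n * real d) ^ k"
proof -
  define y where "y = 1 / (real n * real d) ^ k"
  define e where "e = (real d - 1) ^ k"
  have y0: "y \<ge> 0" by (simp add: y_def)
  have "(2::real) ^ 1 \<le> 2 ^ k" using k by (intro power_increasing) auto
  also have "\<dots> \<le> e" unfolding e_def using d by (intro power_mono) auto
  finally have e2: "e \<ge> 2" by simp
  have s: "((- 1) ^ k - 1) / (real n * real d * (real d - 1)) ^ k = ((- 1) ^ k - 1) / e * y"
    by (simp add: y_def e_def power_mult_distrib)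
  have "(- 1) ^ k = (1::real) \<or> (- 1) ^ k = (-1::real)" by (rule minus_one_power_iff[THEN ssubst]) auto
  hence "- 1 \<le> ((- 1) ^ k - 1) / e \<and> ((- 1) ^ k - 1) / e \<le> (0::real)" using e2 by (auto simp: field_simps)
  then obtain "- 1 \<le> ((- 1) ^ k - 1) / e" "((- 1) ^ k - 1) / e \<le> (0::real)" by blast
  note this[THEN mult_right_mono, OF y0]
  thus "0 \<le> mean k" "mean k \<le> 1 / (real n * real d) ^ k"
    unfolding mean_def s y_def[symmetric] using y0 by (auto split: if_splits)
qed

text \<open>From exp x \<le> 1 + x + \<open>x\<^sup>2\<close> \<le> 1 + 2x with x = k c \<le> 1,
  where 2 k c = 20 k r / n.\<close>

lemma inflation:
  assumes k: "k \<le> r"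
  shows "(1 + c) ^ k \<le> 3" "(1 + c) ^ k - 1 \<le> 20 * real k * real r / real n"
proof -
  have n0: "real n > 0" using n_pos by simp
  have "real k * c \<le> real r * c" using k c_nonneg by (intro mult_right_mono) auto
  also have "\<dots> \<le> 1" using n_large n0 by (simp add: c_def power2_eq_square field_simps)
  finally have kc: "real k * c \<le> 1" .
  have kc0: "real k * c \<ge> 0" using c_nonneg by simp
  have "(1 + c) ^ k \<le> exp c ^ k"
    using c_nonneg exp_ge_add_one_self[of c] by (intro power_mono) auto
  also have "\<dots> = exp (real k * c)" by (simp add: exp_of_nat_mult)
  also have "\<dots> \<le> 1 + real k * c + (real k * c)\<^sup>2" by (rule exp_bound[OF kc0 kc])
  also have "(real k * c)\<^sup>2 \<le> real k * c"
    unfolding power2_eq_square using kc kc0 by (intro mult_left_le) auto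
  finally have 1: "(1 + c) ^ k \<le> 1 + 2 * (real k * c)" by simp
  thus "(1 + c) ^ k \<le> 3" using kc by linarith
  show "(1 + c) ^ k - 1 \<le> 20 * real k * real r / real n" using 1 by (simp add: c_def)
qed

lemma \<eta>_eq: "\<eta> k = real k * (57 * (real k)\<^sup>2 + 18 * real k + 12 * real d) * (real (d - 1) ^ (r - 1) / real n)"
  by (simp add: \<eta>_def power2_eq_square algebra_simps add_divide_distrib)

lemma \<eta>_nonneg: "\<eta> k \<ge> 0"
  by (simp add: \<eta>_eq)

text \<open>One factor k of the error term cancels against the k traversals in
  \<open>cycles_of_length_count\<close>, which leaves \<open>r\<^sup>2\<close> rather than
  \<open>r\<^sup>3\<close>. The constant is 1413 = 3 / 2 * 471 * 2 with 471 = 21 + 6 * 75: here 21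
  collects the first two summands, 75 = 57 + 18 comes from \<eta>, 3 / 2 bounds d / (d - 1), and 2
  is the geometric sum over k.\<close>

lemma cycle_sum:
  "(\<Sum>\<alpha>\<in>cycles_upto n d r. 1 / (real n * real d) ^ card \<alpha> *
      (20 * real (card \<alpha>) * real r / real n + 1 / real n + 6 * \<eta> (card \<alpha>)))
    \<le> 1413 * ((real r)\<^sup>2 + real d) * (real d - 1) ^ (2 * r - 1) / real n"
proof -
  define D where "D = real (d - 1)"
  have D2: "D \<ge> 2" using d by (simp add: D_def)
  have Dd: "real d \<le> 3 / 2 * D" "real d - 1 = D" using d by (simp_all add: D_def of_nat_diff)
  have n0: "real n > 0" using n_pos by simp
  define P where "P = D ^ (r - 1) / real n"
  have "1 \<le> D ^ (r - 1)" using D2 by (intro one_le_power) simp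
  hence P1: "1 / real n \<le> P" unfolding P_def using n0 by (intro divide_right_mono) auto
  have P0: "P \<ge> 0" unfolding P_def using D2 by simp
  define b where "b k = 20 * real k * real r / real n + 1 / real n + 6 * \<eta> k" for k
  have b0: "b k \<ge> 0" for k unfolding b_def using \<eta>_nonneg[of k] by simp
  define X where "X = (real r)\<^sup>2 + real d"
  have bk: "b k \<le> real k * (471 * X * P)" if k: "1 \<le> k" "k \<le> r" for k
  proof -
    have r1: "real k \<le> real r" "1 \<le> real r" "1 \<le> real k" using k by simp_all
    have "real r * 1 \<le> real r * real r" using r1 by (intro mult_left_mono) auto
    hence rr: "real r \<le> (real r)\<^sup>2" "1 \<le> (real r)\<^sup>2" using r1(2) unfolding power2_eq_square by linarith+
    have kr: "(real k)\<^sup>2 \<le> (real r)\<^sup>2" using r1 by (intro power_mono) auto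
    have "20 * real k * real r / real n + 1 / real n = (20 * real k * real r + 1) * (1 / real n)" by (simp add: add_divide_distrib)
    also have "\<dots> \<le> (20 * real k * real r + real k * real r) * (1 / real n)"
      using r1 n0 mult_mono[of 1 "real k" 1 "real r"] by (intro mult_right_mono) auto
    also have "\<dots> = real k * (21 * real r) * (1 / real n)" by (simp add: algebra_simps)
    also have "\<dots> \<le> real k * (21 * (real r)\<^sup>2) * P" using rr P1 n0 by (intro mult_mono) auto
    finally have 1: "20 * real k * real r / real n + 1 / real n \<le> real k * (21 * (real r)\<^sup>2) * P" .
    have "\<eta> k = real k * (57 * (real k)\<^sup>2 + 18 * real k + 12 * real d) * P" unfolding \<eta>_eq P_def D_def ..
    also have "\<dots> \<le> real k * (75 * (real r)\<^sup>2 + 12 * real d) * P"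
    proof (intro mult_right_mono mult_left_mono)
      show "57 * (real k)\<^sup>2 + 18 * real k + 12 * real d \<le> 75 * (real r)\<^sup>2 + 12 * real d" using kr rr(1) r1(1) by linarith
    qed (use P0 in simp_all)
    finally have 2: "6 * \<eta> k \<le> 6 * (real k * (75 * (real r)\<^sup>2 + 12 * real d) * P)" by simp
    have "b k \<le> real k * (21 * (real r)\<^sup>2) * P + 6 * (real k * (75 * (real r)\<^sup>2 + 12 * real d) * P)"
      unfolding b_def using 1 2 by (rule add_mono)
    also have "\<dots> = real k * ((471 * (real r)\<^sup>2 + 72 * real d) * P)" by (simp add: algebra_simps)
    also have "\<dots> \<le> real k * (471 * X * P)"
      using P0 by (intro mult_left_mono mult_right_mono) (auto simp: X_def)
    finally show ?thesis .
  qed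
  have XP: "X * P \<ge> 0" using P0 by (simp add: X_def)
  have "(\<Sum>\<alpha>\<in>cycles_upto n d r. 1 / (real n * real d) ^ card \<alpha> * b (card \<alpha>))
    \<le> (\<Sum>k\<in>{1..r}. \<Sum>\<alpha>\<in>cycles_of_length n d k. 1 / (real n * real d) ^ card \<alpha> * b (card \<alpha>))"
    unfolding cycles_upto_def using b0 by (intro sum_UN_le) auto
  also have "\<dots> \<le> (\<Sum>k\<in>{1..r}. 3 / 2 * D ^ k * (471 * X * P))"
  proof (rule sum_mono)
    fix k assume k: "k \<in> {1..r}"
    have ck: "card \<alpha> = k" if \<alpha>: "\<alpha> \<in> cycles_of_length n d k" for \<alpha>
    proof -
      obtain s where "cyc n d s" "length s = k" "edges s = \<alpha>" by (rule cycle_steps[OF \<alpha>])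
      thus ?thesis using cyc_length by blast
    qed
    define M where "M = real (card (cycles_of_length n d k)) * (1 / (real n * real d)) ^ k"
    have M0: "M \<ge> 0" by (simp add: M_def)
    have "(\<Sum>\<alpha>\<in>cycles_of_length n d k. 1 / (real n * real d) ^ card \<alpha> * b (card \<alpha>)) = M * b k"
      by (simp add: ck M_def power_one_over)
    also have "\<dots> \<le> M * (real k * (471 * X * P))" using bk[of k] k M0 by (intro mult_left_mono) auto
    also have "\<dots> = (real k * M) * (471 * X * P)" by simp
    also have "\<dots> \<le> (3 / 2 * D ^ k) * (471 * X * P)"
    proof (rule mult_right_mono)
      have "real k * M \<le> real d * D ^ (k - 1)"
        using cycles_of_length_count[of n d k] n_pos d k by (simp add: M_def D_def mult.assoc)
      also have "\<dots> \<le> 3 / 2 * D * D ^ (k - 1)" using Dd(1) D2 by (intro mult_right_mono) auto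
      also have "\<dots> = 3 / 2 * D ^ Suc (k - 1)" by simp
      also have "Suc (k - 1) = k" using k by simp
      finally show "real k * M \<le> 3 / 2 * D ^ k" .
      show "0 \<le> 471 * X * P" using XP by (simp add: mult_ac)
    qed
    finally show "(\<Sum>\<alpha>\<in>cycles_of_length n d k. 1 / (real n * real d) ^ card \<alpha> * b (card \<alpha>)) \<le> 3 / 2 * D ^ k * (471 * X * P)" .
  qed
  also have "\<dots> = 3 / 2 * (471 * X * P) * (\<Sum>k\<in>{1..r}. D ^ k)"
    unfolding sum_distrib_left by (intro sum.cong refl) (simp only: mult_ac)
  also have "\<dots> \<le> 3 / 2 * (471 * X * P) * (\<Sum>k<Suc r. D ^ k)"
    using XP D2 by (intro mult_left_mono sum_mono2) auto
  also have "\<dots> \<le> 3 / 2 * (471 * X * P) * (2 * D ^ r)"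
    using geometric_le[OF D2, of r] XP by (intro mult_left_mono) auto
  also have "\<dots> = 1413 * X * (D ^ r * D ^ (r - 1)) / real n" by (simp add: P_def)
  also have "D ^ r * D ^ (r - 1) = D ^ (2 * r - 1)"
    unfolding power_add[symmetric] using r2 by (intro arg_cong[where f = "(^) D"]) linarith
  finally show ?thesis by (simp add: b_def X_def Dd(2))
qed

lemma model_bound:
  assumes m: "\<And>\<alpha>. \<alpha> \<in> cycles_upto n d r \<Longrightarrow> m \<alpha> = mean (card \<alpha>)"
  shows "tv_dist (map_pmf (cycle_indicators n d r) (law n d h)) (poisson_vector_pmf (cycles_upto n d r) m)
    \<le> 1413 * ((real r)\<^sup>2 + real d) * (real d - 1) ^ (2 * r - 1) / real n"
proof (rule tv_dist_le)
  fix A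
  define J where "J = cycles_upto n d r"
  define p where "p \<alpha> = measure_pmf.prob (law n d h) {R. \<alpha> \<subseteq> R}" for \<alpha>
  have n0: "real n > 0" using n_pos by simp
  have d0: "real d \<ge> 1" using d by simp
  have J: "\<exists>s. cyc n d s \<and> length s = card \<alpha> \<and> card \<alpha> \<le> r \<and> edges s = \<alpha> \<and> card \<alpha> \<ge> 1" if "\<alpha> \<in> J" for \<alpha>
  proof -
    have "\<alpha> \<in> cycles_upto n d r" using that by (simp add: J_def)
    then obtain s where s: "cyc n d s" "length s \<le> r" "edges s = \<alpha>" by (rule cycle_steps_upto)
    have "card \<alpha> = length s" using cyc_length[OF s(1)] s(3) by simp
    moreover have "length s \<ge> 1" using s(1) by (cases s) (auto simp: cyc_def)
    ultimately show ?thesis using s by (intro exI[of _ s]) simp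
  qed
  have "\<bar>measure_pmf.prob (map_pmf (\<lambda>X \<alpha>. if \<alpha> \<in> J then of_bool (\<alpha> \<subseteq> X) else 0) (law n d h)) A -
      measure_pmf.prob (poisson_vector_pmf J m) A\<bar> \<le> (\<Sum>\<alpha>\<in>J. \<bar>p \<alpha> - m \<alpha>\<bar> + (m \<alpha>)\<^sup>2 + 2 * (p \<alpha> * \<eta> (card \<alpha>)))"
  proof (rule indicator_vector_poisson)
    show "finite J" by (simp add: J_def)
    show "m \<alpha> \<ge> 0" if "\<alpha> \<in> J" for \<alpha> using J[OF that] mean_bounds(1)[of "card \<alpha>"] m that by (auto simp: J_def)
    show "p \<alpha> = measure_pmf.prob (law n d h) {X. \<alpha> \<subseteq> X}" for \<alpha> by (simp add: p_def)
    fix \<alpha> S assume \<alpha>: "\<alpha> \<in> J" and S: "\<And>X Y. (\<And>b. b \<in> J \<Longrightarrow> b \<noteq> \<alpha> \<Longrightarrow> (b \<subseteq> X) = (b \<subseteq> Y)) \<Longrightarrow> (X \<in> S) = (Y \<in> S)"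
    have past: "past n d r \<alpha> S" unfolding past_def J_def[symmetric]
    proof (intro allI impI)
      fix X Y assume XY: "\<forall>\<beta>\<in>J. \<beta> \<noteq> \<alpha> \<longrightarrow> (\<beta> \<subseteq> X) = (\<beta> \<subseteq> Y)"
      show "(X \<in> S) = (Y \<in> S)" by (rule S) (rule XY[rule_format])
    qed
    obtain s where s: "cyc n d s" "length s = card \<alpha>" "card \<alpha> \<le> r" "edges s = \<alpha>" using J[OF \<alpha>] by blast
    show "\<bar>measure_pmf.prob (law n d h) {X. \<alpha> \<subseteq> X \<and> X \<in> S} - p \<alpha> * measure_pmf.prob (law n d h) S\<bar> \<le> p \<alpha> * \<eta> (card \<alpha>)"
      unfolding p_def using \<alpha> by (intro near_independence[OF s _ past]) (simp add: J_def)
  qed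
  \<comment> \<open>The three summands bound the error of the mean, the square of the mean and the
    dependence term. The 6 is 2 * 3, as the probability of a cycle is at most 3 times its
    mean.\<close>
  also have "\<dots> \<le> (\<Sum>\<alpha>\<in>J. 1 / (real n * real d) ^ card \<alpha> * (20 * real (card \<alpha>) * real r / real n + 1 / real n + 6 * \<eta> (card \<alpha>)))"
  proof (rule sum_mono)
    fix \<alpha> assume \<alpha>: "\<alpha> \<in> J"
    define k where "k = card \<alpha>"
    define l where "l = 1 / (real n * real d) ^ k"
    obtain s where s: "cyc n d s" "length s = k" "k \<le> r" "edges s = \<alpha>" "k \<ge> 1" using J[OF \<alpha>] unfolding k_def by blast
    have l0: "l \<ge> 0" by (simp add: l_def)
    have mk: "m \<alpha> = mean k" using m \<alpha> by (simp add: J_def k_def)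
    have mb: "0 \<le> mean k" "mean k \<le> l" using mean_bounds[OF s(5)] by (simp_all add: l_def)
    have pb: "mean k \<le> p \<alpha>" "p \<alpha> \<le> (1 + c) ^ k * mean k"
      using prob_cycle[OF s(1-4)] \<alpha> by (simp_all add: p_def J_def)
    note infl = inflation[OF s(3)]
    have "p \<alpha> - mean k \<le> ((1 + c) ^ k - 1) * mean k" using pb(2) by (simp add: algebra_simps)
    also have "\<dots> \<le> (20 * real k * real r / real n) * mean k" using infl(2) mb by (intro mult_right_mono) auto
    also have "\<dots> \<le> (20 * real k * real r / real n) * l" using mb by (intro mult_left_mono) auto
    finally have 1: "\<bar>p \<alpha> - m \<alpha>\<bar> \<le> l * (20 * real k * real r / real n)"
      using pb(1) unfolding mk by (simp only: abs_of_nonneg diff_ge_0_iff_ge mult.commute[of l])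
    have "l \<le> 1 / real n"
    proof -
      have nd: "real n * real d \<ge> real n * 1" using d0 by (intro mult_left_mono) auto
      have n1: "real n \<ge> 1" using n_pos by simp
      have "real n \<le> (real n * real d) ^ 1" using nd by simp
      also have "\<dots> \<le> (real n * real d) ^ k" using power_increasing[OF s(5), of "real n * real d"] nd n1 by linarith
      finally show ?thesis unfolding l_def using n0 by (intro divide_left_mono) auto
    qed
    hence "mean k * mean k \<le> l * (1 / real n)" using mb l0 by (intro mult_mono) auto
    hence 2: "(m \<alpha>)\<^sup>2 \<le> l * (1 / real n)" by (simp add: mk power2_eq_square)
    have "p \<alpha> \<le> 3 * l"
    proof -
      have "(1 + c) ^ k * mean k \<le> 3 * l" using infl(1) mb by (intro mult_mono) auto
      thus ?thesis using pb(2) by simp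
    qed
    hence "p \<alpha> * \<eta> k \<le> 3 * l * \<eta> k" using \<eta>_nonneg by (intro mult_right_mono)
    hence 3: "2 * (p \<alpha> * \<eta> k) \<le> l * (6 * \<eta> k)" by simp
    have "\<bar>p \<alpha> - m \<alpha>\<bar> + (m \<alpha>)\<^sup>2 + 2 * (p \<alpha> * \<eta> k) \<le> l * (20 * real k * real r / real n) + l * (1 / real n) + l * (6 * \<eta> k)"
      using 1 2 3 by linarith
    thus "\<bar>p \<alpha> - m \<alpha>\<bar> + (m \<alpha>)\<^sup>2 + 2 * (p \<alpha> * \<eta> (card \<alpha>)) \<le>
      1 / (real n * real d) ^ card \<alpha> * (20 * real (card \<alpha>) * real r / real n + 1 / real n + 6 * \<eta> (card \<alpha>))"
      unfolding k_def[symmetric] l_def[symmetric] by (simp only: distrib_left)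
  qed
  also have "\<dots> \<le> 1413 * ((real r)\<^sup>2 + real d) * (real d - 1) ^ (2 * r - 1) / real n"
    unfolding J_def by (rule cycle_sum)
  finally show "\<bar>measure_pmf.prob (map_pmf (cycle_indicators n d r) (law n d h)) A -
      measure_pmf.prob (poisson_vector_pmf (cycles_upto n d r) m) A\<bar>
      \<le> 1413 * ((real r)\<^sup>2 + real d) * (real d - 1) ^ (2 * r - 1) / real n"
    unfolding J_def cycle_indicators_def[abs_def] .
qed

end

theorem corollary1p8:
  shows "\<exists>C::real. \<forall>n d r :: nat. n \<ge> 3 \<longrightarrow> d \<ge> 3 \<longrightarrow> r \<ge> 4 \<longrightarrow> even (n * d) \<longrightarrow>
     tv_dist (map_pmf (cycle_indicators n d r) (config_pmf n d))
             (poisson_vector_pmf (cycles_upto n d r) (cycle_lambda n d))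
       \<le> C * (real d + (ln (real n))\<^sup>2) * (real d - 1) ^ (2 * r - 1) / real n \<and>
     tv_dist (map_pmf (cycle_indicators n d r) (tilted_pmf n d))
             (poisson_vector_pmf (cycles_upto n d r) (cycle_mu n d))
       \<le> C * (real d + (ln (real n))\<^sup>2) * (real d - 1) ^ (2 * r - 1) / real n"
proof (intro exI[of _ 1413] allI impI)
  fix n d r :: nat
  assume n: "n \<ge> 3" and d: "d \<ge> 3" and r: "r \<ge> 4" and ev: "even (n * d)"
  define Q where "Q = 1413 * (real d + (ln (real n))\<^sup>2) * (real d - 1) ^ (2 * r - 1) / real n"
  have "tv_dist (map_pmf (cycle_indicators n d r) (config_pmf n d)) (poisson_vector_pmf (cycles_upto n d r) (cycle_lambda n d)) \<le> Q \<and>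
     tv_dist (map_pmf (cycle_indicators n d r) (tilted_pmf n d)) (poisson_vector_pmf (cycles_upto n d r) (cycle_mu n d)) \<le> Q"
  \<comment> \<open>A bound of at least 1 holds for any total variation distance. Otherwise n
    exceeds (d - 1)^(2r - 1), which is how r gets bounded by ln n.\<close>
  proof (cases "Q \<ge> 1")
    case True
    thus ?thesis using tv_dist_le_1 order_trans by blast
  next
    case False
    have n0: "real n > 0" using n by simp
    define E where "E = (real d - 1) ^ (2 * r - 1)"
    define L where "L = ln (real n)"
    have E2: "2 ^ (2 * r - 1) \<le> E" unfolding E_def using d by (intro power_mono) auto
    have "(1::real) \<le> 2 ^ (2 * r - 1)" by (intro one_le_power) simp
    hence E1: "E \<ge> 1" using E2 by linarith
    have big: "1413 * (real d + L\<^sup>2) * E < real n"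
      using False n0 by (simp add: Q_def E_def L_def field_simps)
    have "1 * E \<le> 1413 * (real d + L\<^sup>2) * E"
      using E1 d by (intro mult_right_mono) (auto intro: order_trans[of 1 "1413 * real d"])
    hence "2 ^ (2 * r - 1) \<le> real n" using E2 big by linarith
    hence "ln (2 ^ (2 * r - 1)) \<le> L" unfolding L_def using n0 by (subst ln_le_cancel_iff) auto
    hence "real (2 * r - 1) * ln 2 \<le> L" by (simp add: ln_realpow)
    moreover have "real (2 * r - 1) * (2 / 3) \<le> real (2 * r - 1) * ln 2"
      using ln2_ge_two_thirds by (intro mult_left_mono) auto
    moreover have "real r \<le> real (2 * r - 1) * (2 / 3)" using r by (simp add: of_nat_diff)
    ultimately have rL: "real r \<le> L" by linarith
    hence rL2: "(real r)\<^sup>2 \<le> L\<^sup>2" by (intro power_mono) auto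
    \<comment> \<open>The assumption that the bound is below 1 also provides the lower bound on n
      that the locale \<open>model\<close> requires.\<close>
    have "10 * (real r)\<^sup>2 \<le> 1413 * (real d + L\<^sup>2) * 1"
      using rL2 zero_le_power2[of L] of_nat_0_le_iff[of d, where ?'a = real] unfolding mult_1_right distrib_left by linarith
    also have "\<dots> \<le> 1413 * (real d + L\<^sup>2) * E" using E1 by (intro mult_left_mono) auto
    finally have large: "10 * (real r)\<^sup>2 \<le> real n" using big by linarith
    have M0: "model n d 0 r" and M2: "model n d 2 r"
      using d r ev large by (unfold_locales; simp)+
    have Q: "1413 * ((real r)\<^sup>2 + real d) * (real d - 1) ^ (2 * r - 1) / real n \<le> Q"
      unfolding Q_def using rL2 d by (intro divide_right_mono mult_right_mono mult_left_mono) (auto simp: L_def)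
    have "tv_dist (map_pmf (cycle_indicators n d r) (law n d 0)) (poisson_vector_pmf (cycles_upto n d r) (cycle_lambda n d))
        \<le> 1413 * ((real r)\<^sup>2 + real d) * (real d - 1) ^ (2 * r - 1) / real n"
      by (rule model.model_bound[OF M0]) (simp add: cycle_lambda_def model.mean_def[OF M0])
    moreover have "tv_dist (map_pmf (cycle_indicators n d r) (law n d 2)) (poisson_vector_pmf (cycles_upto n d r) (cycle_mu n d))
        \<le> 1413 * ((real r)\<^sup>2 + real d) * (real d - 1) ^ (2 * r - 1) / real n"
      by (rule model.model_bound[OF M2]) (simp add: cycle_mu_def model.mean_def[OF M2])
    ultimately show ?thesis
      unfolding config_law[OF M0] tilted_law[OF M2] using Q by linarith
  qed
  thus "tv_dist (map_pmf (cycle_indicators n d r) (config_pmf n d))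
             (poisson_vector_pmf (cycles_upto n d r) (cycle_lambda n d))
       \<le> 1413 * (real d + (ln (real n))\<^sup>2) * (real d - 1) ^ (2 * r - 1) / real n \<and>
     tv_dist (map_pmf (cycle_indicators n d r) (tilted_pmf n d))
             (poisson_vector_pmf (cycles_upto n d r) (cycle_mu n d))
       \<le> 1413 * (real d + (ln (real n))\<^sup>2) * (real d - 1) ^ (2 * r - 1) / real n"
    unfolding Q_def .
qed

end
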